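(* Let $\lambda\in\mathbb Z^r$ be a weight, let $y\in W$ be minimal (of minimal length) such that $y(\lambda)$ is antidominant, and let $w\in W$. Then $$\sigma^{\mathbf z}_w(\varpi^\lambda)=q^{-\langle\rho,\lambda\rangle}\,q^{|\Phi^+|}\,Z\bigl(\mathfrak S_{-y(\lambda),\,yw_0\mathbf c_0,\,ww_0\mathbf c_0}(\mathbf z^{-1};q^{-1})\bigr).$$
   Context: p-adic side. $F$ is a nonarchimedean local field with ring of integers $\mathfrak o$, maximal ideal $\mathfrak p=(\varpi)$, residue field of cardinality $q$. $K=\mathrm{GL}_r(\mathfrak o)$; $J\subset K$ is the Iwahori subgroup (upper triangular modulo $\mathfrak p$); $B$ the upper triangular Borel subgroup, $T$ the diagonal torus, $N$ the upper triangular unipotent subgroup of $\mathrm{GL}_r$. $W=S_r$ is identified with the permutation matrices, so that $w\varpi^\lambda w^{-1}=\varpi^{w(\lambda)}$, where $\varpi^\lambda=\mathrm{diag}(\varpi^{\lambda_1},\dots,\varpi^{\lambda_r})$ and $(w(\lambda))_i=\lambda_{w^{-1}(i)}$; $w_0$ is the longest element; $|\Phi^+|=r(r-1)/2$. $\mu\in\mathbb Z^r$ is dominant if $\mu_1\ge\cdots\ge\mu_r$, antidominant if $-\mu$ is dominant. $\langle\,,\,\rangle$ is the standard inner product and $\rho=\frac12(r-1,r-3,\dots,1-r)$. For $\mathbf z\in(\mathbb C^\times)^r$, $\mathbf z^\lambda=\prod z_i^{\lambda_i}$, $\mathbf z^{-1}=(z_1^{-1},\dots,z_r^{-1})$, and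 $\chi_{\mathbf z}$ is the character of $B(F)$ trivial on $N(F)$ and $T(\mathfrak o)$ with $\chi_{\mathbf z}(\varpi^\lambda)=\mathbf z^\lambda$. $\delta$ is the modular quasicharacter of $B(F)$, $\delta(\varpi^\lambda)=q^{-\langle2\rho,\lambda\rangle}$. $\phi^{\mathbf z}_w$ is the function on $\mathrm{GL}_r(F)=\bigsqcup_{w'\in W}B(F)w'J$ with $\phi^{\mathbf z}_w(bw'k)=\delta^{1/2}\chi_{\mathbf z}(b)$ if $w'=w$ and $0$ otherwise ($b\in B(F)$, $w'\in W$, $k\in J$). $\sigma^{\mathbf z}_w(g)=\int_K\phi^{\mathbf z}_w(kg)\,dk$, with Haar measure normalized so that $J$ has volume $1$. Flags. Fix colors $\gamma_1>\gamma_2>\cdots>\gamma_r$. A flag is a sequence $\mathbf c=(c_1,\dots,c_r)$ of colors, proper if its entries are distinct. $S_r$ acts by $(w\mathbf c)_i=c_{w^{-1}(i)}$; $\mathbf c_0=(\gamma_1,\dots,\gamma_r)$. Colored weights with parameters $x$ and $t$. Horizontal spins are $\{+,\gamma_1,\dots,\gamma_r\}$; vertical spins are multisets $\gamma_1^{m_1}\cdots\gamma_r^{m_r}$ with $m_k\in\mathbb N=\{0,1,2,\dots\}$. Vertex spins are listed in the order (left, top, right, bottom). The monochrome vertex of type $(x,g)$ ($g$ a color) has vertical spins in $\mathbb N$ and weights, for $n\in\mathbb N$: $(+,n,+,n)$: $1$; $(h,n,h,n)$ for a color $h$: $1$ if $g<h$, $x$ if $g=h$, $t^n$ if $g>h$;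 $(g,n,+,n+1)$: $P$-weight $x(1-t^{n+1})$, $R$-weight $x(1-t)$; $(+,n+1,g,n)$: $P$-weight $1$, $R$-weight $\frac{1-t^{n+1}}{1-t}$; all others $0$. The colored weight of $(a,\gamma_1^{b_1}\cdots\gamma_r^{b_r},c,\gamma_1^{d_1}\cdots\gamma_r^{d_r})$ is the partition function of a row of monochrome vertices of types $(x,\gamma_r),(x,\gamma_{r-1}),\dots,(x,\gamma_1)$ from left to right, the one of color $\gamma_k$ having top spin $b_k$ and bottom spin $d_k$, with leftmost spin $a$ and rightmost spin $c$, summed over interior horizontal spins. System. For a dominant weight $\mu\in\mathbb Z^r$ (negative parts allowed), proper flags $\mathbf c,\mathbf d$, $\mathbf x=(x_1,\dots,x_r)$, and integers $N\ge\mu_1\ge\mu_r\ge M$, consider the grid with $r$ rows (labeled $1,\dots,r$ top to bottom, row $i$ using parameter $x_i$) and columns labeled $M,M+1,\dots,N$ from right to left, with boundary spins: left edges $+$; right edge of row $i$: $d_i$; bottom edges: the empty multiset; top edge of column $j$: the multiset in which $\gamma_k$ has multiplicity $\#\{i:\mu_i=j,\ c_i=\gamma_k\}$. Then $Z(\mathfrak S_{\mu,\mathbf c,\mathbf d}(\mathbf x;t))$ is $(x_1\cdots x_r)^M$ times the sum over all assignments of spins to interior edges of the product of the colored vertex weights. It is independent of $M,N$, and for proper flags the $P$- and $R$-weights give the same value.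
   Formalization: The prefactor q^{-⟨ρ,λ⟩} is replaced by q^{⟨ρ,y(λ)⟩}; they agree for dominant λ, but the printed one fails otherwise: for r=2, λ=(0,1), w=1 the average is q^{-1/2}z_2 while the printed right side is q^{1/2}z_2. *)

theory Defs
  imports
    "HOL-Analysis.Analysis"
    "HOL-Combinatorics.Combinatorics"
    "Jordan_Normal_Form.Matrix"
begin

text \<open>
  All indices are shifted by one: rows and columns of matrices, coordinates of weights,
  entries of flags, and the colors are indexed by 0, ..., r - 1 instead of 1, ..., r.
\<close>

section \<open>Nonarchimedean local fields\<close>

text \<open>
  The field is given by its normalized discrete valuation; the value of the valuation at 0
  (morally infinity) is irrelevant.
\<close>

definition fractional_ideal :: "('a::field \<Rightarrow> int) \<Rightarrow> int \<Rightarrow> 'a set" where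
  "fractional_ideal ord n = {x. x = 0 \<or> n \<le> ord x}"

abbreviation ring_of_integers :: "('a::field \<Rightarrow> int) \<Rightarrow> 'a set" where
  "ring_of_integers ord \<equiv> fractional_ideal ord 0"

abbreviation maximal_ideal :: "('a::field \<Rightarrow> int) \<Rightarrow> 'a set" where
  "maximal_ideal ord \<equiv> fractional_ideal ord 1"

definition residue_field :: "('a::field \<Rightarrow> int) \<Rightarrow> 'a set set" where
  "residue_field ord = ring_of_integers ord //
     {(x, y). x \<in> ring_of_integers ord \<and> y \<in> ring_of_integers ord \<and> x - y \<in> maximal_ideal ord}"

definition residue_card :: "('a::field \<Rightarrow> int) \<Rightarrow> nat" where
  "residue_card ord = card (residue_field ord)"

definition uniformizer :: "('a::field \<Rightarrow> int) \<Rightarrow> 'a \<Rightarrow> bool" where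
  "uniformizer ord varpi \<longleftrightarrow> varpi \<noteq> 0 \<and> ord varpi = 1"

locale nonarch_local_field =
  fixes ord :: "'a::field \<Rightarrow> int"
  assumes ord_mult: "x \<noteq> 0 \<Longrightarrow> y \<noteq> 0 \<Longrightarrow> ord (x * y) = ord x + ord y"
    and ord_add: "x \<noteq> 0 \<Longrightarrow> y \<noteq> 0 \<Longrightarrow> x + y \<noteq> 0 \<Longrightarrow> min (ord x) (ord y) \<le> ord (x + y)"
    and ex_uniformizer: "\<exists>varpi. uniformizer ord varpi"
    and finite_residue_field: "finite (residue_field ord)"
    and complete:
      "(\<And>n. \<exists>k0. \<forall>k\<ge>k0. \<forall>l\<ge>k0. X k - X l \<in> fractional_ideal ord n) \<Longrightarrow>
       \<exists>L. \<forall>n. \<exists>k0. \<forall>k\<ge>k0. (X :: nat \<Rightarrow> 'a) k - L \<in> fractional_ideal ord n"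

section \<open>Weights and the Weyl group\<close>

text \<open>
  The Weyl group is the set of all w with \<open>w permutes {..<r}\<close>, and the action below serves both
  for weights and for flags.
\<close>

definition act :: "(nat \<Rightarrow> nat) \<Rightarrow> (nat \<Rightarrow> 'b) \<Rightarrow> nat \<Rightarrow> 'b" where
  "act w f = (\<lambda>i. f (inv_into UNIV w i))"

definition weyl_length :: "nat \<Rightarrow> (nat \<Rightarrow> nat) \<Rightarrow> nat" where
  "weyl_length r w = (LEAST n. \<exists>js. length js = n \<and> (\<forall>j\<in>set js. Suc j < r) \<and>
     w = foldr (\<lambda>j f. Transposition.transpose j (Suc j) \<circ> f) js id)"

definition longest_element :: "nat \<Rightarrow> nat \<Rightarrow> nat" where
  "longest_element r = (\<lambda>i. if i < r then r - 1 - i else i)"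

definition dominant :: "nat \<Rightarrow> (nat \<Rightarrow> int) \<Rightarrow> bool" where
  "dominant r \<mu> \<longleftrightarrow> (\<forall>i j. i \<le> j \<and> j < r \<longrightarrow> \<mu> j \<le> \<mu> i)"

definition antidominant :: "nat \<Rightarrow> (nat \<Rightarrow> int) \<Rightarrow> bool" where
  "antidominant r \<mu> \<longleftrightarrow> dominant r (\<lambda>i. - \<mu> i)"

definition minimal_antidominant :: "nat \<Rightarrow> (nat \<Rightarrow> int) \<Rightarrow> (nat \<Rightarrow> nat) \<Rightarrow> bool" where
  "minimal_antidominant r lam y \<longleftrightarrow> y permutes {..<r} \<and> antidominant r (act y lam) \<and>
     (\<forall>y'. y' permutes {..<r} \<and> antidominant r (act y' lam) \<longrightarrow> weyl_length r y \<le> weyl_length r y')"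

definition pair :: "nat \<Rightarrow> (nat \<Rightarrow> real) \<Rightarrow> (nat \<Rightarrow> int) \<Rightarrow> real" where
  "pair r a lam = (\<Sum>i<r. a i * of_int (lam i))"

definition weyl_vector :: "nat \<Rightarrow> nat \<Rightarrow> real" where
  "weyl_vector r i = (real r - 1 - 2 * real i) / 2"

definition monomial :: "nat \<Rightarrow> (nat \<Rightarrow> complex) \<Rightarrow> (nat \<Rightarrow> int) \<Rightarrow> complex" where
  "monomial r z lam = (\<Prod>i<r. z i powi lam i)"

section \<open>The group and its subgroups\<close>

definition GL :: "nat \<Rightarrow> 'a::field mat set" where
  "GL r = {g \<in> carrier_mat r r. invertible_mat g}"

definition borel_subgroup :: "nat \<Rightarrow> 'a::field mat set" where
  "borel_subgroup r = {b \<in> GL r. upper_triangular b}"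

definition integral_mat :: "('a::field \<Rightarrow> int) \<Rightarrow> nat \<Rightarrow> 'a mat \<Rightarrow> bool" where
  "integral_mat ord r g \<longleftrightarrow> g \<in> carrier_mat r r \<and>
     (\<forall>i<r. \<forall>j<r. g $$ (i, j) \<in> ring_of_integers ord)"

definition GL_integers :: "('a::field \<Rightarrow> int) \<Rightarrow> nat \<Rightarrow> 'a mat set" where
  "GL_integers ord r = {k. integral_mat ord r k \<and>
     (\<exists>k'. integral_mat ord r k' \<and> k * k' = 1\<^sub>m r \<and> k' * k = 1\<^sub>m r)}"

definition iwahori :: "('a::field \<Rightarrow> int) \<Rightarrow> nat \<Rightarrow> 'a mat set" where
  "iwahori ord r = {k \<in> GL_integers ord r. \<forall>i<r. \<forall>j<i. k $$ (i, j) \<in> maximal_ideal ord}"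

definition perm_mat :: "nat \<Rightarrow> (nat \<Rightarrow> nat) \<Rightarrow> 'a::field mat" where
  "perm_mat r w = Matrix.mat r r (\<lambda>(i, j). if i = w j then 1 else 0)"

definition torus_elt :: "'a::field \<Rightarrow> nat \<Rightarrow> (nat \<Rightarrow> int) \<Rightarrow> 'a mat" where
  "torus_elt varpi r lam = Matrix.mat r r (\<lambda>(i, j). if i = j then varpi powi lam i else 0)"

text \<open>
  The subspace topology on \<open>GL_integers ord r\<close> is the one induced by the valuation topology on the
  matrix entries (inversion is automatically continuous), and Haar measure is a left invariant
  measure on its Borel sets.
\<close>

definition open_in_GL_integers :: "('a::field \<Rightarrow> int) \<Rightarrow> nat \<Rightarrow> 'a mat set \<Rightarrow> bool" where
  "open_in_GL_integers ord r U \<longleftrightarrow> U \<subseteq> GL_integers ord r \<and>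
     (\<forall>g\<in>U. \<exists>n. \<forall>h\<in>GL_integers ord r.
        (\<forall>i<r. \<forall>j<r. h $$ (i, j) - g $$ (i, j) \<in> fractional_ideal ord n) \<longrightarrow> h \<in> U)"

definition normalized_haar :: "('a::field \<Rightarrow> int) \<Rightarrow> nat \<Rightarrow> 'a mat measure \<Rightarrow> bool" where
  "normalized_haar ord r dk \<longleftrightarrow>
     space dk = GL_integers ord r \<and>
     sets dk = sigma_sets (GL_integers ord r) {U. open_in_GL_integers ord r U} \<and>
     (\<forall>k\<in>GL_integers ord r. \<forall>A\<in>sets dk. emeasure dk ((\<lambda>g. k * g) ` A) = emeasure dk A) \<and>
     emeasure dk (iwahori ord r) = 1"

section \<open>Iwahori fixed vectors and spherical averages\<close>

text \<open>
  An element b of the Borel subgroup lies in the double coset of the torus element with exponents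
  \<open>borel_weight ord b\<close> under the product of the unipotent radical and the integral torus, on which
  both quasicharacters below are trivial.
\<close>

definition borel_weight :: "('a::field \<Rightarrow> int) \<Rightarrow> 'a mat \<Rightarrow> nat \<Rightarrow> int" where
  "borel_weight ord b = (\<lambda>i. ord (b $$ (i, i)))"

definition modular_character :: "('a::field \<Rightarrow> int) \<Rightarrow> nat \<Rightarrow> 'a mat \<Rightarrow> real" where
  "modular_character ord r b =
     real (residue_card ord) powr (- pair r (\<lambda>i. 2 * weyl_vector r i) (borel_weight ord b))"

definition unramified_character ::
    "('a::field \<Rightarrow> int) \<Rightarrow> nat \<Rightarrow> (nat \<Rightarrow> complex) \<Rightarrow> 'a mat \<Rightarrow> complex" where
  "unramified_character ord r z b = monomial r z (borel_weight ord b)"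

definition iwahori_vector ::
    "('a::field \<Rightarrow> int) \<Rightarrow> nat \<Rightarrow> (nat \<Rightarrow> complex) \<Rightarrow> (nat \<Rightarrow> nat) \<Rightarrow> 'a mat \<Rightarrow> complex" where
  "iwahori_vector ord r z w g = (THE v. \<exists>b\<in>borel_subgroup r. \<exists>w'. \<exists>k\<in>iwahori ord r.
     w' permutes {..<r} \<and> g = b * perm_mat r w' * k \<and>
     v = (if w' = w then complex_of_real (sqrt (modular_character ord r b)) *
            unramified_character ord r z b else 0))"

definition spherical_average ::
    "('a::field \<Rightarrow> int) \<Rightarrow> nat \<Rightarrow> 'a mat measure \<Rightarrow> (nat \<Rightarrow> complex) \<Rightarrow> (nat \<Rightarrow> nat) \<Rightarrow> 'a mat \<Rightarrow> complex"
  where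
  "spherical_average ord r dk z w g = (LINT k|dk. iwahori_vector ord r z w (k * g))"

section \<open>The colored lattice model\<close>

text \<open>
  \<open>Color k\<close> stands for the (k+1)-st color. The first color is the largest one, so the order on
  colors is the reverse of the order on their indices. A flag is a function from indices to
  indices of colors, and the standard flag is the identity.
\<close>

datatype spin = Plus | Color nat

datatype weight_kind = P_weight | R_weight

definition standard_flag :: "nat \<Rightarrow> nat" where
  "standard_flag = (\<lambda>i. i)"

definition hspins :: "nat \<Rightarrow> spin set" where
  "hspins r = insert Plus (Color ` {..<r})"

definition vspins :: "nat \<Rightarrow> nat multiset set" where
  "vspins r = {B. set_mset B \<subseteq> {..<r}}"

definition mono_weight ::
    "weight_kind \<Rightarrow> complex \<Rightarrow> complex \<Rightarrow> nat \<Rightarrow> spin \<Rightarrow> nat \<Rightarrow> spin \<Rightarrow> nat \<Rightarrow> complex" where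
  "mono_weight kind x t g a b c d =
     (case (a, c) of
        (Plus, Plus) \<Rightarrow> if d = b then 1 else 0
      | (Color h, Color h') \<Rightarrow>
          if h' = h \<and> d = b
          then (if h < g then 1 else if h = g then x else t ^ b) else 0
      | (Color h, Plus) \<Rightarrow>
          if h = g \<and> d = Suc b
          then (case kind of P_weight \<Rightarrow> x * (1 - t ^ d) | R_weight \<Rightarrow> x * (1 - t)) else 0
      | (Plus, Color h) \<Rightarrow>
          if h = g \<and> b = Suc d
          then (case kind of P_weight \<Rightarrow> 1 | R_weight \<Rightarrow> (1 - t ^ b) / (1 - t)) else 0)"

text \<open>
  In the row of monochrome vertices the colors increase from left to right, that is, their indices
  decrease: the vertex of color index k has left spin \<open>s (Suc k)\<close> and right spin \<open>s k\<close>.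
\<close>

definition colored_weight ::
    "weight_kind \<Rightarrow> nat \<Rightarrow> complex \<Rightarrow> complex \<Rightarrow> spin \<Rightarrow> nat multiset \<Rightarrow> spin \<Rightarrow> nat multiset \<Rightarrow> complex"
  where
  "colored_weight kind r x t a b c d =
     (\<Sum>s \<in> {s \<in> {0..r} \<rightarrow>\<^sub>E hspins r. s r = a \<and> s 0 = c}.
        \<Prod>k<r. mono_weight kind x t k (s (Suc k)) (count b k) (s k) (count d k))"

definition top_boundary :: "nat \<Rightarrow> (nat \<Rightarrow> int) \<Rightarrow> (nat \<Rightarrow> nat) \<Rightarrow> int \<Rightarrow> nat multiset" where
  "top_boundary r \<mu> c j = image_mset c (mset_set {i. i < r \<and> \<mu> i = j})"

text \<open>
  Since columns are labeled from right to left, the vertex in row i and column j has left edge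
  \<open>H (i, j + 1)\<close>, right edge \<open>H (i, j)\<close>, top edge \<open>V (i, j)\<close> and bottom edge \<open>V (Suc i, j)\<close>.
\<close>

definition states ::
    "nat \<Rightarrow> int \<Rightarrow> int \<Rightarrow> (nat \<Rightarrow> int) \<Rightarrow> (nat \<Rightarrow> nat) \<Rightarrow> (nat \<Rightarrow> nat) \<Rightarrow>
     ((nat \<times> int \<Rightarrow> spin) \<times> (nat \<times> int \<Rightarrow> nat multiset)) set" where
  "states r M N \<mu> c d = {(H, V).
     H \<in> {..<r} \<times> {M..N + 1} \<rightarrow>\<^sub>E hspins r \<and>
     V \<in> {..r} \<times> {M..N} \<rightarrow>\<^sub>E vspins r \<and>
     (\<forall>i<r. H (i, N + 1) = Plus \<and> H (i, M) = Color (d i)) \<and>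
     (\<forall>j\<in>{M..N}. V (0, j) = top_boundary r \<mu> c j \<and> V (r, j) = {#})}"

text \<open>
  The set of states is infinite, but by conservation of colors only finitely many states have
  nonzero weight.
\<close>

definition partition_function ::
    "weight_kind \<Rightarrow> nat \<Rightarrow> int \<Rightarrow> int \<Rightarrow> (nat \<Rightarrow> int) \<Rightarrow> (nat \<Rightarrow> nat) \<Rightarrow> (nat \<Rightarrow> nat) \<Rightarrow>
     (nat \<Rightarrow> complex) \<Rightarrow> complex \<Rightarrow> complex" where
  "partition_function kind r M N \<mu> c d x t =
     (\<Prod>i<r. x i) powi M *
     (\<Sum>\<^sub>\<infinity>(H, V)\<in>states r M N \<mu> c d. \<Prod>i<r. \<Prod>j\<in>{M..N}.
        colored_weight kind r (x i) t (H (i, j + 1)) (V (i, j)) (H (i, j)) (V (Suc i, j)))"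

text \<open>
  The formula for spherical averages over a torus element with exponents lam is normalized by the
  power of q with exponent \<open>pair r (weyl_vector r) (act y lam)\<close>, where y sorts lam into
  antidominant position. For dominant lam this equals the exponent
  \<open>- pair r (weyl_vector r) lam\<close> found in the literature; for other lam the latter is incorrect
  (already for r = 2, lam = (0, 1) and w = 1, where the average is the inverse square root of q
  times the second spectral parameter, while the partition function is the inverse of q times that
  parameter).
\<close>

end

theory Submission
  imports Defs
begin

text \<open>
  Both sides are regarded as functions of a weight and a permutation. Each satisfies a recursion
  relating a weight to its image under an adjacent transposition, and a relation under the rotation
  \<open>(\<lambda>\<^sub>0, \<dots>, \<lambda>\<^sub>r\<^sub>-\<^sub>1) \<mapsto> (\<lambda>\<^sub>r\<^sub>-\<^sub>1 + 1, \<lambda>\<^sub>0, \<dots>, \<lambda>\<^sub>r\<^sub>-\<^sub>2)\<close>; since adjacent transpositions and the rotation generate the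
  extended affine Weyl group, these relations together with the value at the identity determine the
  function.

  For spherical averages the recursions come from the generators of the Iwahori Hecke algebra.
  For the lattice model the adjacent recursion is an exchange relation between two neighboring
  colors, proved row by row, while the rotation moves the window of columns by one monochrome column.
\<close>

section \<open>Exchange of adjacent colors in the lattice model\<close>

text \<open>Sorting by \<open>y\<close> permutes the columns and the colors of the top boundary
  together, so color \<open>g\<close> always starts in column \<open>- lam (r - 1 - g)\<close>.
  Hence \<open>y\<close> cancels and the lattice side becomes a function of the same pair
  \<open>(lam, w)\<close> as the average. Both adjacent recursions express a Hecke generator: on the
  lattice side the exchange of two colors acts through the matrix with rows (0, t) and (1, 1 - t),
  which satisfies (T - 1)(T + t) = 0, and for t = 1/q the multiple q T satisfies the Iwahori
  relation. This exchange is not a symmetry of a single vertex: it holds edge by edge only as long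
  as the relative position of the two colors is tracked. The obstacle in the rotation is that the
  largest color becomes the smallest, so that weights 1 and t trade places; the resulting power of t
  counts the colors to the left of color 0. The normalizing power of q depends only on the sum of
  all |lam i - lam j|, which permutations preserve and whose change under the rotation absorbs that
  count.\<close>

text \<open>
  For a proper flag each color occurs at most once in a state. A configuration gives the column that
  each color occupies, if any; the site \<open>(j, g)\<close> is the monochrome vertex of color g in column j.
  A color picks up a factor x for each column that it crosses; \<open>vstep\<close> charges these factors when
  the color enters and leaves the horizontal edge, so that empty columns have weight 1.
\<close>

type_synonym config = "nat \<Rightarrow> int option"

definition vstep :: "complex \<Rightarrow> complex \<Rightarrow> int \<times> nat \<Rightarrow> (spin \<Rightarrow> config \<Rightarrow> complex) \<Rightarrow> spin \<Rightarrow> config \<Rightarrow> complex" where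
  "vstep x t s f a p = (case s of (j, g) \<Rightarrow>
     (case a of
        Plus \<Rightarrow> f Plus p + (if p g = Some j then x powi j * f (Color g) (p(g := None)) else 0)
      | Color h \<Rightarrow>
          if h = g then f a p + (1 - t) * x powi (- j) * f Plus (p(g := Some j))
          else (if p g = Some j \<and> g < h then t else 1) * f a p))"

definition sweep :: "complex \<Rightarrow> complex \<Rightarrow> (int \<times> nat) list \<Rightarrow> (spin \<Rightarrow> config \<Rightarrow> complex) \<Rightarrow> spin \<Rightarrow> config \<Rightarrow> complex" where
  "sweep x t ss f = foldr (vstep x t) ss f"

definition exit_right :: "nat \<Rightarrow> (config \<Rightarrow> complex) \<Rightarrow> spin \<Rightarrow> config \<Rightarrow> complex" where
  "exit_right d F a p = (if a = Color d then F p else 0)"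

fun rows_value :: "complex \<Rightarrow> (int \<times> nat) list \<Rightarrow> (complex \<times> nat) list \<Rightarrow> config \<Rightarrow> complex" where
  "rows_value t ss [] p = (if p = (\<lambda>_. None) then 1 else 0)"
| "rows_value t ss ((x, d) # rws) p = sweep x t ss (exit_right d (rows_value t ss rws)) Plus p"

lemma sweep_simps [simp]:
  "sweep x t [] f = f"
  "sweep x t (s # ss) f = vstep x t s (sweep x t ss f)"
  "sweep x t (ss @ ss') f = sweep x t ss (sweep x t ss' f)"
  by (simp_all add: sweep_def)

definition relabel :: "(nat \<Rightarrow> nat) \<Rightarrow> spin \<Rightarrow> spin" where
  "relabel f a = (case a of Plus \<Rightarrow> Plus | Color h \<Rightarrow> Color (f h))"

abbreviation adj :: "nat \<Rightarrow> nat \<Rightarrow> nat" where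
  "adj k \<equiv> Transposition.transpose k (Suc k)"

text \<open>
  A color on the horizontal edge counts as located between the columns J + 1 and J.
\<close>

definition weakly_before :: "nat \<Rightarrow> int \<Rightarrow> spin \<Rightarrow> config \<Rightarrow> bool" where
  "weakly_before k J a p \<longleftrightarrow>
     (if a = Color k then p k = None \<and> (\<exists>j. p (Suc k) = Some j \<and> j \<le> J)
      else if a = Color (Suc k) then p (Suc k) = None \<and> (\<exists>i. p k = Some i \<and> J < i)
      else (\<exists>i j. p k = Some i \<and> p (Suc k) = Some j \<and> j \<le> i))"

text \<open>
  E and L continue the computation in two models in which the exit rows of the colors k and k + 1
  are exchanged; color k + 1 exits earlier in E.
\<close>

definition swap_related ::
    "nat \<Rightarrow> int \<Rightarrow> complex \<Rightarrow> int \<Rightarrow> (spin \<Rightarrow> config \<Rightarrow> complex) \<Rightarrow> (spin \<Rightarrow> config \<Rightarrow> complex) \<Rightarrow> bool" where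
  "swap_related k M t J E L \<longleftrightarrow>
     (\<forall>a p. weakly_before k J a p \<longrightarrow> (\<forall>g j. p g = Some j \<longrightarrow> M \<le> j) \<longrightarrow>
        E (relabel (adj k) a) (p \<circ> adj k) = t * L a p \<and>
        L (relabel (adj k) a) (p \<circ> adj k) = E a p + (1 - t) * L a p)"

lemma upd_comp_adj:
  "(p(g := v)) \<circ> adj k = (p \<circ> adj k)(adj k g := v)"
  by (auto simp: fun_eq_iff Transposition.transpose_def)

lemma adj_simps [simp]: "adj k k = Suc k" "adj k (Suc k) = k" "g \<noteq> k \<Longrightarrow> g \<noteq> Suc k \<Longrightarrow> adj k g = g"
  by (auto simp: Transposition.transpose_def)

lemma swap_relatedD:
  assumes "swap_related k M t J E L" "weakly_before k J a p" "\<And>g j. p g = Some j \<Longrightarrow> M \<le> j"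
  shows "E (relabel (adj k) a) (p \<circ> adj k) = t * L a p"
    and "L (relabel (adj k) a) (p \<circ> adj k) = E a p + (1 - t) * L a p"
  using assms unfolding swap_related_def by blast+

text \<open>The indices k and k + 1 are neighbors, so any other color compares in the same way with
  both. Hence a vertex of another color acts on the two models by the same linear operator, and the
  relation, being linear, survives.\<close>

lemma swap_related_vstep:
  assumes sr: "swap_related k M t J E L" and g: "g \<noteq> k" "g \<noteq> Suc k" and "M \<le> j"
  shows "swap_related k M t J (vstep x t (j, g) E) (vstep x t (j, g) L)"
  unfolding swap_related_def
proof (intro allI impI)
  fix a p
  assume wb: "weakly_before k J a p" and rng: "\<forall>g j. p g = Some j \<longrightarrow> M \<le> j"
  have 0: "E (relabel (adj k) a) (p \<circ> adj k) = t * L a p"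
     "L (relabel (adj k) a) (p \<circ> adj k) = E a p + (1 - t) * L a p"
    by (rule swap_relatedD[OF sr wb rng[rule_format]], assumption)+
  have pg: "(p \<circ> adj k) g = p g" using g by simp
  show "vstep x t (j, g) E (relabel (adj k) a) (p \<circ> adj k) = t * vstep x t (j, g) L a p \<and>
        vstep x t (j, g) L (relabel (adj k) a) (p \<circ> adj k) =
          vstep x t (j, g) E a p + (1 - t) * vstep x t (j, g) L a p"
  proof (cases a)
    case Plus
    have "weakly_before k J (Color g) (p(g := None))"
      using wb Plus g by (auto simp: weakly_before_def)
    moreover have "\<And>h i. (p(g := None)) h = Some i \<Longrightarrow> M \<le> i"
      using rng by (auto split: if_splits)
    ultimately have 2: "E (Color g) ((p \<circ> adj k)(g := None)) = t * L (Color g) (p(g := None))"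
      "L (Color g) ((p \<circ> adj k)(g := None)) = E (Color g) (p(g := None)) + (1 - t) * L (Color g) (p(g := None))"
      using swap_relatedD[OF sr, of "Color g" "p(g := None)"] g by (simp_all add: relabel_def upd_comp_adj)
    have 1: "E Plus (p \<circ> adj k) = t * L Plus p" "L Plus (p \<circ> adj k) = E Plus p + (1 - t) * L Plus p"
      using 0 Plus by (simp_all add: relabel_def)
    show ?thesis
      unfolding Plus vstep_def relabel_def using 1 2 pg
      by (simp del: comp_apply) (simp add: algebra_simps)
  next
    case (Color h)
    show ?thesis
    proof (cases "h = g")
      case True
      have "weakly_before k J Plus (p(g := Some j))"
        using wb Color True g by (auto simp: weakly_before_def)
      moreover have "\<And>h i. (p(g := Some j)) h = Some i \<Longrightarrow> M \<le> i"
        using rng \<open>M \<le> j\<close> by (auto split: if_splits)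
      ultimately have 2: "E Plus ((p \<circ> adj k)(g := Some j)) = t * L Plus (p(g := Some j))"
        "L Plus ((p \<circ> adj k)(g := Some j)) = E Plus (p(g := Some j)) + (1 - t) * L Plus (p(g := Some j))"
        using swap_relatedD[OF sr, of Plus "p(g := Some j)"] g by (simp_all add: relabel_def upd_comp_adj)
      have 1: "E (Color g) (p \<circ> adj k) = t * L (Color g) p"
          "L (Color g) (p \<circ> adj k) = E (Color g) p + (1 - t) * L (Color g) p"
        using 0 Color True g by (simp_all add: relabel_def)
      show ?thesis
        unfolding Color True vstep_def relabel_def using 1 2 g
        by simp (simp add: algebra_simps)
    next
      case False
      have "adj k h \<noteq> g" "g < adj k h \<longleftrightarrow> g < h"
        using False g by (auto simp: Transposition.transpose_def)
      moreover have 1: "E (Color (adj k h)) (p \<circ> adj k) = t * L (Color h) p"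
          "L (Color (adj k h)) (p \<circ> adj k) = E (Color h) p + (1 - t) * L (Color h) p"
        using 0 Color by (simp_all add: relabel_def)
      ultimately show ?thesis
        unfolding Color vstep_def relabel_def using False pg
        by (simp del: comp_apply) (simp add: algebra_simps)
    qed
  qed
qed

text \<open>\<open>weakly_before\<close> compares columns only and does not describe a configuration
  in which just one of the two sites of column J has been passed; therefore both sites are handled
  in one step.\<close>

lemma swap_related_pair:
  assumes sr: "swap_related k M t (J - 1) E L" and "M \<le> J" and x: "x \<noteq> 0"
  shows "swap_related k M t J (vstep x t (J, Suc k) (vstep x t (J, k) E))
    (vstep x t (J, Suc k) (vstep x t (J, k) L))"
  unfolding swap_related_def
proof (intro allI impI)
  fix a p
  assume wb: "weakly_before k J a p" and rng: "\<forall>g j. p g = Some j \<longrightarrow> M \<le> j"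
  \<comment> \<open>Only the positions of the two colors matter here. Writing the configuration as
    \<open>P u v\<close> turns composition with \<open>adj k\<close> into
    \<open>P v u\<close>.\<close>
  define P where "P u v = p(k := u, Suc k := v)" for u v
  have P [simp]: "P u v k = u" "P u v (Suc k) = v" "(P u v)(k := w) = P w v" "(P u v)(Suc k := w) = P u w"
    "P u v \<circ> adj k = P v u" for u v w
    by (auto simp: P_def fun_eq_iff Transposition.transpose_def)
  obtain u v where p: "p = P u v"
    using that[of "p k" "p (Suc k)"] by (simp add: P_def)
  have rP: "\<forall>g j. P u' v' g = Some j \<longrightarrow> M \<le> j"
    if "\<And>j. u' = Some j \<Longrightarrow> M \<le> j" "\<And>j. v' = Some j \<Longrightarrow> M \<le> j" for u' v'
    using rng that by (auto simp: P_def split: if_splits)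
  have rng': "u = Some j \<Longrightarrow> M \<le> j" "v = Some j \<Longrightarrow> M \<le> j" for j
    using rng[rule_format, of k j] rng[rule_format, of "Suc k" j] P(1,2)[of u v, folded p] by simp_all
  have D: "E (relabel (adj k) a) (P v' u') = t * L a (P u' v') \<and>
       L (relabel (adj k) a) (P v' u') = E a (P u' v') + (1 - t) * L a (P u' v')"
    if "weakly_before k (J - 1) a (P u' v')" "\<And>j. u' = Some j \<Longrightarrow> M \<le> j" "\<And>j. v' = Some j \<Longrightarrow> M \<le> j"
    for a u' v'
    using swap_relatedD[OF sr that(1)] rP[OF that(2,3)] by simp
  let ?T = "\<lambda>F. vstep x t (J, Suc k) (vstep x t (J, k) F)"
  \<comment> \<open>One of the two colors enters the edge in column J and the other leaves it there;
    the two charges cancel.\<close>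
  have xx: "x powi J * (x powi - J * c) = c" for c :: complex
    using x by (simp add: power_int_minus)
  \<comment> \<open>The next three facts specialize the relation at \<open>J - 1\<close> to the
    situations that can arise after column J: color k + 1 on the edge, color k on the edge, neither
    of them on the edge.\<close>
  have DS: "E (Color k) (P None u') = t * L (Color (Suc k)) (P u' None)"
      "L (Color k) (P None u') = E (Color (Suc k)) (P u' None) + (1 - t) * L (Color (Suc k)) (P u' None)"
    if "u' = Some i" "J \<le> i" for u' i
    using D[of "Color (Suc k)" u' None] that \<open>M \<le> J\<close> by (simp_all add: weakly_before_def relabel_def)
  have DK: "E (Color (Suc k)) (P v' None) = t * L (Color k) (P None v')"
      "L (Color (Suc k)) (P v' None) = E (Color k) (P None v') + (1 - t) * L (Color k) (P None v')"
    if "v' = Some j" "j < J" "M \<le> j" for v' j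
    using D[of "Color k" None v'] that by (simp_all add: weakly_before_def relabel_def)
  have DP: "E Plus (P v' u') = t * L Plus (P u' v')"
      "L Plus (P v' u') = E Plus (P u' v') + (1 - t) * L Plus (P u' v')"
    if "u' = Some i" "v' = Some j" "j \<le> i" "M \<le> j" for u' v' i j
    using D[of Plus u' v'] that by (simp_all add: weakly_before_def relabel_def)
  have "?T E (relabel (adj k) a) (P v u) = t * ?T L a (P u v) \<and>
        ?T L (relabel (adj k) a) (P v u) = ?T E a (P u v) + (1 - t) * ?T L a (P u v)"
  proof -
    consider (k) "a = Color k" | (Sk) "a = Color (Suc k)" | (Plus) "a = Plus"
      | (h) h where "a = Color h" "h \<noteq> k" "h \<noteq> Suc k"
      by (cases a) auto
    then show ?thesis
    proof cases
      case k
      then obtain j where j: "u = None" "v = Some j" "j \<le> J"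
        using wb P(1,2)[of u v, folded p] by (auto simp: weakly_before_def)
      show ?thesis
      proof (cases "j = J")
        case True
        with j k DS[of "Some J" J] DP(1)[of "Some J" J "Some J" J] \<open>M \<le> J\<close> show ?thesis
          by (simp add: vstep_def relabel_def) (simp add: algebra_simps xx)
      next
        case False
        with j k DK[of "Some j" j] DP[of "Some J" J "Some j" j] rng' show ?thesis
          by (simp add: vstep_def relabel_def) (simp add: algebra_simps xx)
      qed
    next
      case Sk
      then obtain j where j: "v = None" "u = Some j" "J < j"
        using wb P(1,2)[of u v, folded p] by (auto simp: weakly_before_def)
      with Sk DS[of "Some j" j] DP[of "Some j" j "Some J" J] \<open>M \<le> J\<close> show ?thesis
        by (simp add: vstep_def relabel_def) (simp add: algebra_simps xx)
    next
      case Plus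
      then obtain i j where j: "u = Some i" "v = Some j" "j \<le> i"
        using wb P(1,2)[of u v, folded p] by (auto simp: weakly_before_def)
      have P1: "E Plus (P v u) = t * L Plus (P u v)"
         "L Plus (P v u) = E Plus (P u v) + (1 - t) * L Plus (P u v)"
        using DP[of u i v j] j rng' by auto
      consider "i = J" "j = J" | "i = J" "j < J" | "j = J" "i > J" | "i \<noteq> J" "j \<noteq> J"
        using \<open>j \<le> i\<close> by linarith
      then show ?thesis
      proof cases
        case 1
        with P1(1) DS[of "Some J" J] j Plus show ?thesis
          by (simp add: vstep_def relabel_def) (simp add: algebra_simps xx)
      next
        case 2
        with P1 DK[of "Some j" j] j Plus rng' show ?thesis
          by (simp add: vstep_def relabel_def) (simp add: algebra_simps xx)
      next
        case 3
        with P1 DS[of "Some i" i] j Plus rng' show ?thesis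
          by (simp add: vstep_def relabel_def) (simp add: algebra_simps xx)
      next
        case 4
        with P1 j Plus show ?thesis
          by (simp add: vstep_def relabel_def)
      qed
    next
      case h
      then obtain i j where j: "u = Some i" "v = Some j" "j \<le> i"
        using wb P(1,2)[of u v, folded p] by (auto simp: weakly_before_def)
      have less: "Suc k < h \<longleftrightarrow> k < h" using h by auto
      have P1: "E (Color h) (P v u) = t * L (Color h) (P u v)"
         "L (Color h) (P v u) = E (Color h) (P u v) + (1 - t) * L (Color h) (P u v)"
        using D[of "Color h" u v] h j rng' by (auto simp: weakly_before_def relabel_def)
      show ?thesis
        using h less by (simp add: vstep_def relabel_def P1) (simp add: algebra_simps xx)
    qed
  qed
  then show "?T E (relabel (adj k) a) (p \<circ> adj k) = t * ?T L a p \<and>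
        ?T L (relabel (adj k) a) (p \<circ> adj k) = ?T E a p + (1 - t) * ?T L a p"
    by (metis p P(5))
qed

definition column_sites :: "nat \<Rightarrow> int \<Rightarrow> (int \<times> nat) list" where
  "column_sites r j = map (Pair j) (rev [0..<r])"

definition site_list :: "nat \<Rightarrow> int \<Rightarrow> int \<Rightarrow> (int \<times> nat) list" where
  "site_list r M N = concat (map (column_sites r) (rev [M..N]))"

lemma site_list_empty: "N < M \<Longrightarrow> site_list r M N = []"
  by (simp add: site_list_def)

lemma site_list_rec: "M \<le> N \<Longrightarrow> site_list r M N = column_sites r N @ site_list r M (N - 1)"
  by (simp add: site_list_def upto_rec2)

lemma column_sites_split:
  assumes "Suc k < r"
  shows "column_sites r j =
    map (Pair j) (rev [Suc (Suc k)..<r]) @ (j, Suc k) # (j, k) # map (Pair j) (rev [0..<k])"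
proof -
  have "[0..<r] = [0..<k] @ k # Suc k # [Suc (Suc k)..<r]"
    using assms upt_add_eq_append[of 0 k "r - k"] upt_conv_Cons[of k r] upt_conv_Cons[of "Suc k" r]
    by simp
  then show ?thesis by (simp add: column_sites_def)
qed

lemma swap_related_singles:
  assumes "swap_related k M t J E L" "k \<notin> set gs" "Suc k \<notin> set gs" "M \<le> j"
  shows "swap_related k M t J (sweep x t (map (Pair j) gs) E) (sweep x t (map (Pair j) gs) L)"
  using assms(2,3) by (induction gs) (use assms(1,4) in \<open>auto intro!: swap_related_vstep\<close>)

lemma swap_related_column:
  assumes "swap_related k M t (j - 1) E L" "M \<le> j" "Suc k < r" "x \<noteq> 0"
  shows "swap_related k M t j (sweep x t (column_sites r j) E) (sweep x t (column_sites r j) L)"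
  unfolding column_sites_split[OF assms(3)] sweep_simps
  by (intro swap_related_singles swap_related_pair) (use assms in auto)

text \<open>The value at an edge is determined by the sites to its right, so the relation propagates
  from the right boundary to the left, column by column.\<close>

lemma swap_related_sites:
  assumes "swap_related k M t (M - 1) E L" "Suc k < r" "x \<noteq> 0" "M - 1 \<le> N"
  shows "swap_related k M t N (sweep x t (site_list r M N) E) (sweep x t (site_list r M N) L)"
  using \<open>M - 1 \<le> N\<close>
proof (induction N rule: int_ge_induct)
  case base
  then show ?case using assms by (simp add: site_list_empty)
next
  case (step N)
  then show ?case
    using swap_related_column[of k M t "N + 1"] assms by (simp add: site_list_rec)
qed

section \<open>Symmetry once one of two adjacent colors has left\<close>

definition mirrored :: "nat \<Rightarrow> (spin \<Rightarrow> config \<Rightarrow> complex) \<Rightarrow> (spin \<Rightarrow> config \<Rightarrow> complex) \<Rightarrow> bool" where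
  "mirrored k E L \<longleftrightarrow> (\<forall>a p. p (Suc k) = None \<longrightarrow> a \<noteq> Color (Suc k) \<longrightarrow>
     L (relabel (adj k) a) (p \<circ> adj k) = E a p)"

text \<open>When only one of the two colors is present, it compares with every other color in the
  same way under either name, so renaming it is an exact symmetry.\<close>

lemma mirrored_vstep:
  assumes "mirrored k E L" "g \<noteq> k" "g \<noteq> Suc k"
  shows "mirrored k (vstep x t (j, g) E) (vstep x t (j, g) L)"
  unfolding mirrored_def
proof (intro allI impI)
  fix a and p :: config assume p: "p (Suc k) = None" and a: "a \<noteq> Color (Suc k)"
  have D: "L (relabel (adj k) a) (p \<circ> adj k) = E a p" if "p (Suc k) = None" "a \<noteq> Color (Suc k)" for a and p :: config
    using assms(1) that by (simp add: mirrored_def)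
  have D1: "L (Color g) ((p \<circ> adj k)(g := None)) = E (Color g) (p(g := None))"
    using D[of "p(g := None)" "Color g"] assms p by (simp add: upd_comp_adj relabel_def)
  have D2: "L Plus ((p \<circ> adj k)(g := Some j)) = E Plus (p(g := Some j))"
    using D[of "p(g := Some j)" Plus] assms p by (simp add: upd_comp_adj relabel_def)
  show "vstep x t (j, g) L (relabel (adj k) a) (p \<circ> adj k) = vstep x t (j, g) E a p"
  proof (cases a)
    case Plus
    then show ?thesis using D[of p a, OF p a] D1 assms by (simp add: vstep_def relabel_def)
  next
    case (Color h)
    have "adj k h = g \<longleftrightarrow> h = g" "h \<noteq> g \<Longrightarrow> g < adj k h \<longleftrightarrow> g < h"
      using assms by (auto simp: Transposition.transpose_def)
    then show ?thesis using D[of p a, OF p a] D2 assms Color by (auto simp: vstep_def relabel_def)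
  qed
qed

text \<open>Only the site belonging to the color that is present can act; the other one is empty and
  is crossed with weight 1. So the order of the two sites is immaterial.\<close>

lemma mirrored_pair:
  assumes "mirrored k E L"
  shows "mirrored k (vstep x t (J, Suc k) (vstep x t (J, k) E)) (vstep x t (J, Suc k) (vstep x t (J, k) L))"
  unfolding mirrored_def
proof (intro allI impI)
  fix a and p :: config assume p: "p (Suc k) = None" and a: "a \<noteq> Color (Suc k)"
  have D: "L (relabel (adj k) a) (p \<circ> adj k) = E a p" if "p (Suc k) = None" "a \<noteq> Color (Suc k)" for a and p :: config
    using assms(1) that by (simp add: mirrored_def)
  have D1: "L (Color (Suc k)) ((p \<circ> adj k)(Suc k := None)) = E (Color k) (p(k := None))"
    using D[of "p(k := None)" "Color k"] assms p by (simp add: upd_comp_adj relabel_def)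
  have D2: "L Plus ((p \<circ> adj k)(Suc k := Some J)) = E Plus (p(k := Some J))"
    using D[of "p(k := Some J)" Plus] assms p by (simp add: upd_comp_adj relabel_def)
  show "vstep x t (J, Suc k) (vstep x t (J, k) L) (relabel (adj k) a) (p \<circ> adj k) =
     vstep x t (J, Suc k) (vstep x t (J, k) E) a p"
  proof (cases a)
    case Plus
    then show ?thesis using D[of p a, OF p a] D1 p by (simp add: vstep_def relabel_def)
  next
    case (Color h)
    then have "h \<noteq> Suc k" using a by auto
    have "h \<noteq> k \<Longrightarrow> adj k h = h" "h \<noteq> k \<Longrightarrow> Suc k < h \<longleftrightarrow> k < h"
      using \<open>h \<noteq> Suc k\<close> by auto
    then show ?thesis using D[of p a, OF p a] D2 p Color \<open>h \<noteq> Suc k\<close>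
      by (cases "h = k") (auto simp: vstep_def relabel_def)
  qed
qed

lemma mirrored_sites:
  assumes m: "mirrored k E L" and k: "Suc k < r"
  shows "mirrored k (sweep x t (site_list r M N) E) (sweep x t (site_list r M N) L)"
proof -
  have 1: "mirrored k (sweep x t (map (Pair j) gs) E) (sweep x t (map (Pair j) gs) L)"
    if "k \<notin> set gs" "Suc k \<notin> set gs" "mirrored k E L" for gs j E L
    using that by (induction gs) (auto intro!: mirrored_vstep)
  have 2: "mirrored k (sweep x t (column_sites r j) E) (sweep x t (column_sites r j) L)"
    if "mirrored k E L" for j E L
    unfolding column_sites_split[OF k] sweep_simps by (intro 1 mirrored_pair) (use that in auto)
  have "mirrored k (sweep x t (concat (map (column_sites r) js)) E) (sweep x t (concat (map (column_sites r) js)) L)" for js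
    by (induction js) (auto intro: 2 m)
  then show ?thesis by (simp add: site_list_def)
qed

lemma rows_value_mirrored:
  assumes k: "Suc k < r"
  shows "p (Suc k) = None \<Longrightarrow>
    rows_value t (site_list r M N) (map (apsnd (adj k)) rws) (p \<circ> adj k) = rows_value t (site_list r M N) rws p"
proof (induction rws arbitrary: p)
  case Nil
  have "p \<circ> adj k = (\<lambda>_. None) \<longleftrightarrow> p = (\<lambda>_. None)"
  proof
    assume "p \<circ> adj k = (\<lambda>_. None)"
    then have "p \<circ> adj k \<circ> adj k = (\<lambda>_. None)" by (simp add: comp_def)
    then show "p = (\<lambda>_. None)" by (simp add: comp_assoc)
  qed (simp add: comp_def)
  then show ?case by (simp only: rows_value.simps list.map)
next
  case (Cons row rws)
  obtain x d where row: "row = (x, d)" by force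
  let ?v = "rows_value t (site_list r M N)"
  have "mirrored k (exit_right d (?v rws)) (exit_right (adj k d) (?v (map (apsnd (adj k)) rws)))"
    unfolding mirrored_def
  proof (intro allI impI)
    fix a and p :: config assume "p (Suc k) = None" "a \<noteq> Color (Suc k)"
    then show "exit_right (adj k d) (?v (map (apsnd (adj k)) rws)) (relabel (adj k) a) (p \<circ> adj k) = exit_right d (?v rws) a p"
      using Cons.IH[of p]
      by (cases a) (auto simp: exit_right_def relabel_def inj_eq[OF inj_transpose] simp del: comp_apply)
  qed
  from mirrored_sites[OF this k, of x t M N] show ?case
    using Cons.prems by (auto simp: row mirrored_def relabel_def simp del: comp_apply dest!: spec[of _ Plus])
qed

fun exits_first :: "nat \<Rightarrow> (complex \<times> nat) list \<Rightarrow> bool" where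
  "exits_first k [] \<longleftrightarrow> True"
| "exits_first k ((x, d) # rws) \<longleftrightarrow> d = Suc k \<or> d \<noteq> k \<and> exits_first k rws"

text \<open>Rows are passed with the exchange relation until color k + 1 exits in the first model
  and color k in the second. From there on the two continuations are mirror images of each other,
  which supplies the relation at the right end of that row.\<close>

lemma rows_value_swap:
  assumes k: "Suc k < r" and MN: "M \<le> N"
  shows "exits_first k rws \<Longrightarrow> (\<And>x d. (x, d) \<in> set rws \<Longrightarrow> x \<noteq> 0) \<Longrightarrow>
    p k = Some i \<Longrightarrow> p (Suc k) = Some j \<Longrightarrow> j \<le> i \<Longrightarrow> (\<And>g j. p g = Some j \<Longrightarrow> M \<le> j) \<Longrightarrow>
    rows_value t (site_list r M N) rws (p \<circ> adj k) =
      t * rows_value t (site_list r M N) (map (apsnd (adj k)) rws) p \<and>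
    rows_value t (site_list r M N) (map (apsnd (adj k)) rws) (p \<circ> adj k) =
      rows_value t (site_list r M N) rws p + (1 - t) * rows_value t (site_list r M N) (map (apsnd (adj k)) rws) p"
proof (induction rws arbitrary: p i j)
  case Nil
  \<comment> \<open>Both colors are still inside while no row is left, so all four values are
    0.\<close>
  then have "p k \<noteq> None" "(p \<circ> adj k) k \<noteq> None" by auto
  then have "p \<noteq> (\<lambda>_. None)" "p \<circ> adj k \<noteq> (\<lambda>_. None)" by metis+
  then show ?case by (simp only: rows_value.simps list.map) simp
next
  case (Cons row rws)
  obtain x d where row: "row = (x, d)" by force
  let ?v = "rows_value t (site_list r M N)"
  let ?E = "exit_right d (?v rws)" and ?L = "exit_right (adj k d) (?v (map (apsnd (adj k)) rws))"
  have "swap_related k M t (M - 1) ?E ?L"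
    unfolding swap_related_def
  proof (intro allI impI)
    fix a p
    assume wb: "weakly_before k (M - 1) a p" and rng: "\<forall>g j. p g = Some j \<longrightarrow> M \<le> j"
    show "?E (relabel (adj k) a) (p \<circ> adj k) = t * ?L a p \<and> ?L (relabel (adj k) a) (p \<circ> adj k) = ?E a p + (1 - t) * ?L a p"
    proof (cases "d = Suc k")
      case True
      \<comment> \<open>With color k on the last edge, color k + 1 would lie in a column below M. So
        only k + 1 can stand at the exit: the first equation reads 0 = 0 and the second one is the
        mirror symmetry.\<close>
      have "a \<noteq> Color k" using wb rng by (fastforce simp: weakly_before_def)
      moreover have "?v (map (apsnd (adj k)) rws) (p \<circ> adj k) = ?v rws p" if "a = Color (Suc k)"
        by (rule rows_value_mirrored[OF k]) (use wb that in \<open>simp add: weakly_before_def\<close>)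
      ultimately show ?thesis
        using True by (cases a) (auto simp: exit_right_def relabel_def Transposition.transpose_def)
    next
      case False
      then have d: "d \<noteq> k" "d \<noteq> Suc k" and ef: "exits_first k rws" using Cons.prems(1) row by auto
      show ?thesis
      proof (cases "a = Color d")
        case True
        then obtain i j where ij: "p k = Some i" "p (Suc k) = Some j" "j \<le> i"
          using wb d by (auto simp: weakly_before_def)
        have "?v rws (p \<circ> adj k) = t * ?v (map (apsnd (adj k)) rws) p \<and>
          ?v (map (apsnd (adj k)) rws) (p \<circ> adj k) = ?v rws p + (1 - t) * ?v (map (apsnd (adj k)) rws) p"
          by (rule Cons.IH[OF ef _ ij]) (use Cons.prems(2) rng in auto)
        then show ?thesis
          using True d by (simp add: exit_right_def relabel_def del: comp_apply)
      next
        case False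
        with d show ?thesis by (cases a) (auto simp: exit_right_def relabel_def Transposition.transpose_def)
      qed
    qed
  qed
  from swap_related_sites[OF this k, of x N]
  have "swap_related k M t N (sweep x t (site_list r M N) ?E) (sweep x t (site_list r M N) ?L)"
    using Cons.prems(2) row MN by auto
  from swap_relatedD[OF this, of Plus p] Cons.prems(3-6) show ?case
    by (simp add: row relabel_def weakly_before_def del: comp_apply)
qed

section \<open>Rotation of the lattice model\<close>

definition avoids :: "int \<times> nat \<Rightarrow> config \<Rightarrow> bool" where
  "avoids s p \<longleftrightarrow> p (snd s) \<noteq> Some (fst s)"

text \<open>A vertex can fill or empty only its own site, so a sweep over other sites never makes s
  occupied.\<close>

lemma sweep_cong_avoids:
  assumes "\<And>a p. avoids s p \<Longrightarrow> F a p = G a p"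
  shows "s \<notin> set ss \<Longrightarrow> avoids s p \<Longrightarrow> sweep x t ss F a p = sweep x t ss G a p"
proof (induction ss arbitrary: a p)
  case Nil
  then show ?case using assms by simp
next
  case (Cons s' ss)
  obtain j g where s': "s' = (j, g)" by force
  have "avoids s (p(g := None))" "avoids s (p(g := Some j))"
    using Cons.prems s' by (auto simp: avoids_def split: if_splits)
  then show ?case
    using Cons by (auto simp: s' vstep_def split: spin.split)
qed

text \<open>Each row starts with \<open>Plus\<close>, which passes an empty site unchanged.\<close>

lemma rows_value_cons_site:
  assumes "s \<notin> set ss"
  shows "avoids s p \<Longrightarrow> rows_value t (s # ss) rws p = rows_value t ss rws p"
proof (induction rws arbitrary: p)
  case (Cons row rws)
  obtain x d where row: "row = (x, d)" by force
  have "rows_value t (s # ss) (row # rws) p = sweep x t ss (exit_right d (rows_value t (s # ss) rws)) Plus p"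
    using Cons.prems by (auto simp: row vstep_def avoids_def split: prod.split)
  also have "\<dots> = sweep x t ss (exit_right d (rows_value t ss rws)) Plus p"
    by (rule sweep_cong_avoids[OF _ assms Cons.prems]) (simp add: exit_right_def Cons.IH)
  finally show ?case by (simp add: row)
qed simp

text \<open>A color that stopped at the last site would leave \<open>Plus\<close> on the right edge,
  which \<open>exit_right\<close> rejects. Crossing the empty site costs nothing, because
  \<open>vstep\<close> charges powers of x only on entering and leaving the edge.\<close>

lemma rows_value_snoc_site:
  assumes "s \<notin> set ss"
  shows "avoids s p \<Longrightarrow> rows_value t (ss @ [s]) rws p = rows_value t ss rws p"
proof (induction rws arbitrary: p)
  case (Cons row rws)
  obtain x d where row: "row = (x, d)" by force
  have "rows_value t (ss @ [s]) (row # rws) p =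
      sweep x t ss (vstep x t s (exit_right d (rows_value t (ss @ [s]) rws))) Plus p"
    by (simp add: row)
  also have "\<dots> = sweep x t ss (exit_right d (rows_value t ss rws)) Plus p"
  proof (rule sweep_cong_avoids[OF _ assms Cons.prems])
    fix a p assume "avoids s p"
    then show "vstep x t s (exit_right d (rows_value t (ss @ [s]) rws)) a p = exit_right d (rows_value t ss rws) a p"
      using Cons.IH[of p] by (auto simp: exit_right_def vstep_def avoids_def split: prod.split spin.split)
  qed
  finally show ?case by (simp add: row)
qed simp

section \<open>The linear order of the sites\<close>

definition site_of :: "nat \<Rightarrow> int \<Rightarrow> int \<times> nat" where
  "site_of r S = (S div int r, nat (S mod int r))"

text \<open>Sites are numbered from right to left across all columns, so a window may begin and end
  in the middle of a column. The rotation needs this, as it moves the window by a single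
  site.\<close>

definition interval_sites :: "nat \<Rightarrow> int \<Rightarrow> int \<Rightarrow> (int \<times> nat) list" where
  "interval_sites r A B = map (site_of r) (rev [A..B])"

lemma site_of_eq:
  assumes "g < r"
  shows "site_of r (j * int r + int g) = (j, g)"
proof -
  have "(j * int r + int g) div int r = j" "(j * int r + int g) mod int r = int g"
    using assms by (simp_all add: div_pos_pos_trivial)
  then show ?thesis by (simp add: site_of_def)
qed

lemma site_ofD:
  assumes "site_of r S = (j, g)" "0 < r"
  shows "S = j * int r + int g" "g < r"
  using assms by (auto simp: site_of_def nat_less_iff)

lemma site_of_inj: "0 < r \<Longrightarrow> site_of r S = site_of r S' \<longleftrightarrow> S = S'"
  by (metis site_ofD(1) surj_pair)

lemma interval_sites_empty: "B < A \<Longrightarrow> interval_sites r A B = []"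
  by (simp add: interval_sites_def)

lemma interval_sites_rec: "A \<le> B \<Longrightarrow> interval_sites r A B = site_of r B # interval_sites r A (B - 1)"
  by (simp add: interval_sites_def upto_rec2)

lemma interval_sites_rec': "A \<le> B \<Longrightarrow> interval_sites r A B = interval_sites r (A + 1) B @ [site_of r A]"
  by (simp add: interval_sites_def upto_rec1)

lemma site_list_conv:
  assumes "0 < r"
  shows "M - 1 \<le> N \<Longrightarrow> site_list r M N = interval_sites r (M * int r) (N * int r + int r - 1)"
proof (induction N rule: int_ge_induct)
  case base
  show ?case by (simp add: site_list_empty interval_sites_empty algebra_simps)
next
  case (step N)
  have "column_sites r (N + 1) = interval_sites r ((N + 1) * int r) ((N + 1) * int r + int r - 1)"
  proof -
    have "map (site_of r) [(N + 1) * int r..(N + 1) * int r + int r - 1] = map (Pair (N + 1)) [0..<r]"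
      by (rule nth_equalityI) (auto simp: site_of_eq)
    then show ?thesis by (simp add: column_sites_def interval_sites_def flip: rev_map)
  qed
  moreover have "[M * int r..(N + 1) * int r + int r - 1] =
     [M * int r..(N + 1) * int r - 1] @ [(N + 1) * int r..(N + 1) * int r + int r - 1]"
  proof (rule upto_split1)
    have "M * int r \<le> (N + 1) * int r" using step by (intro mult_right_mono) auto
    then show "M * int r \<le> (N + 1) * int r" .
    show "(N + 1) * int r \<le> (N + 1) * int r + int r - 1" using assms by simp
  qed
  ultimately show ?case
    using step by (simp add: site_list_rec interval_sites_def algebra_simps)
qed

definition in_window :: "nat \<Rightarrow> int \<Rightarrow> int \<Rightarrow> config \<Rightarrow> bool" where
  "in_window r A B p \<longleftrightarrow> (\<forall>g j. p g = Some j \<longrightarrow> g < r \<and> A \<le> j * int r + int g \<and> j * int r + int g \<le> B)"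

lemma avoids_site_of:
  assumes "in_window r A B p" "S < A \<or> B < S" "0 < r"
  shows "avoids (site_of r S) p"
  unfolding avoids_def
proof
  assume "p (snd (site_of r S)) = Some (fst (site_of r S))"
  moreover have "S = fst (site_of r S) * int r + int (snd (site_of r S))"
    by (rule site_ofD(1)[OF _ assms(3)]) simp
  ultimately show False using assms(1,2) unfolding in_window_def by force
qed

text \<open>The surplus sites are empty, and they are removed one at a time at either end.\<close>

lemma rows_value_window:
  assumes w: "in_window r A B p" and "0 < r" and "A' \<le> A" "B \<le> B'" "A \<le> B"
  shows "rows_value t (interval_sites r A' B') rws p = rows_value t (interval_sites r A B) rws p"
proof -
  have *: "site_of r S \<in> set (interval_sites r A B) \<longleftrightarrow> A \<le> S \<and> S \<le> B" for S A B
    using site_of_inj[OF \<open>0 < r\<close>] by (auto simp: interval_sites_def)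
  have 1: "rows_value t (interval_sites r A B') rws p = rows_value t (interval_sites r A B) rws p"
    using \<open>B \<le> B'\<close>
  proof (induction B' rule: int_ge_induct)
    case (step B')
    have "interval_sites r A (B' + 1) = site_of r (B' + 1) # interval_sites r A B'"
      using step.hyps \<open>A \<le> B\<close> by (simp add: interval_sites_rec)
    then show ?case
      using rows_value_cons_site[of "site_of r (B' + 1)" "interval_sites r A B'" p t rws]
        avoids_site_of[OF w _ \<open>0 < r\<close>] step by (simp add: *)
  qed simp
  have "rows_value t (interval_sites r A' B') rws p = rows_value t (interval_sites r A B') rws p"
    using \<open>A' \<le> A\<close>
  proof (induction A' rule: int_le_induct)
    case (step A')
    then show ?case
      using \<open>B \<le> B'\<close> rows_value_snoc_site[of "site_of r (A' - 1)" "interval_sites r A' B'" p t rws]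
        avoids_site_of[OF w _ \<open>0 < r\<close>] assms interval_sites_rec'[of "A' - 1" B' r] by (simp add: *)
  qed simp
  with 1 show ?thesis by simp
qed

section \<open>Rotation of colors and sites\<close>

definition rot_color :: "nat \<Rightarrow> nat \<Rightarrow> nat" where
  "rot_color r h = (if h = 0 then r - 1 else h - 1)"

text \<open>In the linear order this moves every occupied site one step to the right: color 0 of
  column j becomes color r - 1 of column j - 1, and any other color keeps its column and lowers its
  index.\<close>

definition rot_config :: "nat \<Rightarrow> config \<Rightarrow> config" where
  "rot_config r p = (\<lambda>g. if g = r - 1 then map_option (\<lambda>j. j - 1) (p 0) else p (Suc g))"

text \<open>
  The exponent that makes the rotation relation hold at every intermediate edge. A color on the
  horizontal edge counts as located at site T.
\<close>

definition ahead :: "nat \<Rightarrow> int \<Rightarrow> spin \<Rightarrow> config \<Rightarrow> nat set" where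
  "ahead r T a p = {g. 0 < g \<and> g < r \<and>
     (if a = Color 0 then \<exists>j. p g = Some j \<and> T < j * int r + int g
      else if a = Color g then \<exists>i. p 0 = Some i \<and> i * int r \<le> T
      else \<exists>i j. p 0 = Some i \<and> p g = Some j \<and> i \<le> j)}"

lemma finite_ahead [simp]: "finite (ahead r T a p)"
  by (rule finite_subset[of _ "{..<r}"]) (auto simp: ahead_def)

definition state_on :: "nat set \<Rightarrow> int \<Rightarrow> nat \<Rightarrow> spin \<Rightarrow> config \<Rightarrow> bool" where
  "state_on Q A r a p \<longleftrightarrow> {g. p g \<noteq> None} \<union> {h. a = Color h} = Q \<and> (\<forall>h. a = Color h \<longrightarrow> p h = None) \<and>
     (\<forall>g j. p g = Some j \<longrightarrow> A \<le> j * int r + int g)"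

text \<open>The factor x appears because a rotated color 0 on the edge will leave in a column one
  lower than the original, where the charge on leaving is larger by one factor x.\<close>

definition rotation_related :: "nat set \<Rightarrow> int \<Rightarrow> nat \<Rightarrow> complex \<Rightarrow> complex \<Rightarrow> complex \<Rightarrow> int \<Rightarrow>
   (spin \<Rightarrow> config \<Rightarrow> complex) \<Rightarrow> (spin \<Rightarrow> config \<Rightarrow> complex) \<Rightarrow> bool" where
  "rotation_related Q A r t x c T f f' \<longleftrightarrow> (\<forall>a p. state_on Q A r a p \<longrightarrow>
     f' (relabel (rot_color r) a) (rot_config r p) * t ^ card (ahead r T a p) =
       c * (if a = Color 0 then x else 1) * f a p)"

lemma lex_le:
  assumes "g < r" "h < r"
  shows "i * int r + int g \<le> j * int r + int h \<longleftrightarrow> i < j \<or> i = j \<and> g \<le> h"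
    and "i * int r + int g < j * int r + int h \<longleftrightarrow> i < j \<or> i = j \<and> g < h"
proof -
  have *: "i * int r + int g < j * int r + int h" if "i < j" "g < r" for i j :: int and g h
  proof -
    have "(i + 1) * int r \<le> j * int r" using that by (intro mult_right_mono) auto
    then show ?thesis using that by (simp add: algebra_simps)
  qed
  show "i * int r + int g \<le> j * int r + int h \<longleftrightarrow> i < j \<or> i = j \<and> g \<le> h"
    using *[of i j g h] *[of j i h g] assms by (cases i j rule: linorder_cases) auto
  show "i * int r + int g < j * int r + int h \<longleftrightarrow> i < j \<or> i = j \<and> g < h"
    using *[of i j g h] *[of j i h g] assms by (cases i j rule: linorder_cases) auto
qed

lemma rot_config_upd:
  assumes "g < r"
  shows "rot_config r (p(g := v)) =
    (rot_config r p)(rot_color r g := (if g = 0 then map_option (\<lambda>j. j - 1) v else v))"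
  using assms by (auto simp: rot_config_def rot_color_def fun_eq_iff)

lemma rot_config_at:
  assumes "g < r"
  shows "rot_config r p (rot_color r g) = (if g = 0 then map_option (\<lambda>j. j - 1) (p 0) else p g)"
  using assms by (auto simp: rot_config_def rot_color_def)

lemma rot_color_eq: "g < r \<Longrightarrow> h < r \<Longrightarrow> rot_color r g = rot_color r h \<longleftrightarrow> g = h"
  by (auto simp: rot_color_def)

lemma rot_site:
  assumes "g < r"
  shows "site_of r (j * int r + int g - 1) = (if g = 0 then j - 1 else j, rot_color r g)"
proof (cases "g = 0")
  case True
  have "j * int r + int g - 1 = (j - 1) * int r + int (r - 1)"
    using True assms by (simp add: algebra_simps of_nat_diff)
  then show ?thesis using True assms site_of_eq[of "r - 1" r "j - 1"] by (simp add: rot_color_def add_diff_eq)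
next
  case False
  have "j * int r + int g - 1 = j * int r + int (g - 1)"
    using False by (simp add: of_nat_diff)
  then show ?thesis using False assms site_of_eq[of "g - 1" r j] by (simp add: rot_color_def add_diff_eq)
qed

text \<open>The rotation turns the largest color into the smallest. When color 0 crosses another
  color the weight is 1 before and t after the rotation; when another color crosses color 0 it is t
  before and 1 after. In either case \<open>ahead\<close> changes by one element, which makes up for
  the difference.\<close>

lemma rotation_related_vstep:
  assumes rr: "rotation_related Q A r t x c (T - 1) f f'"
    and Q: "Q \<subseteq> {..<r}" "0 \<in> Q" and x: "x \<noteq> 0" and "A \<le> T"
  shows "rotation_related Q A r t x c T (vstep x t (site_of r T) f) (vstep x t (site_of r (T - 1)) f')"
  unfolding rotation_related_def
proof (intro allI impI)
  fix a p assume st: "state_on Q A r a p"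
  obtain j g where site: "site_of r T = (j, g)" by force
  have "0 < r" using Q by auto
  note T = site_ofD[OF site this]
  have g: "g < r" by (rule T)
  have site': "site_of r (T - 1) = (if g = 0 then j - 1 else j, rot_color r g)"
    using rot_site[OF g] T by simp
  let ?R = "relabel (rot_color r)" and ?P = "rot_config r"
  have D: "f' (?R a) (?P p) * t ^ card (ahead r (T - 1) a p) = c * (if a = Color 0 then x else 1) * f a p"
    if "state_on Q A r a p" for a p
    using rr that unfolding rotation_related_def by blast
  have T1: "T - 1 < S \<longleftrightarrow> T \<le> S" "S \<le> T - 1 \<longleftrightarrow> S < T" for S :: int by auto
  note TT = T(1)[symmetric]
  note lex = lex_le[OF g, where i = j, unfolded TT] lex_le[OF _ g, where j = j, unfolded TT]
    lex_le[where g = 0 and r = r and h = g and j = j, simplified, unfolded TT, OF g]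
  have none: "p h = None" if "r \<le> h" for h
    using st Q that unfolding state_on_def by (metis (mono_tags, lifting) UnI1 lessThan_iff mem_Collect_eq not_le subsetD)
  show "vstep x t (site_of r (T - 1)) f' (?R a) (?P p) * t ^ card (ahead r T a p) =
     c * (if a = Color 0 then x else 1) * vstep x t (site_of r T) f a p"
  proof (cases a)
    case Plus
    have a1: "ahead r (T - 1) Plus p = ahead r T Plus p" by (simp add: ahead_def)
    show ?thesis
    proof (cases "p g = Some j")
      case False
      then show ?thesis
        using D[OF st] Plus a1 g
        by (auto simp: vstep_def site site' relabel_def rot_config_at)
    next
      case True
      have st2: "state_on Q A r (Color g) (p(g := None))"
        using st Plus True by (auto simp: state_on_def)
      have "ahead r (T - 1) (Color g) (p(g := None)) = ahead r T Plus p"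
      proof (cases "g = 0")
        case g0: True
        then show ?thesis using True g by (auto simp: ahead_def T1 lex)
      next
        case False
        then show ?thesis using True g by (auto simp: ahead_def T1 lex)
      qed
      note D2 = D[OF st2, unfolded this]
      \<comment> \<open>The rotated color 0 enters in column j - 1; the missing factor x is the one
        that the relation carries while color 0 is on the edge.\<close>
      have xj: "x powi (j - 1) * x = x powi j" using x by (simp add: power_int_diff)
      show ?thesis
      proof (cases "g = 0")
        case True
        have "vstep x t (site_of r (T - 1)) f' (?R a) (?P p) * t ^ card (ahead r T a p) =
          f' Plus (?P p) * t ^ card (ahead r T Plus p) + x powi (j - 1) *
            (f' (Color (rot_color r g)) ((?P p)(rot_color r g := None)) * t ^ card (ahead r T Plus p))"
          using Plus \<open>p g = Some j\<close> True g
          by (simp add: vstep_def site' relabel_def rot_config_at algebra_simps)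
        also have "\<dots> = c * f Plus p + x powi (j - 1) * (c * x * f (Color g) (p(g := None)))"
          using D[OF st] D2 Plus True g a1 by (simp add: relabel_def rot_config_upd)
        also have "\<dots> = c * f Plus p + c * (x powi (j - 1) * x) * f (Color g) (p(g := None))"
          by (simp add: algebra_simps)
        finally show ?thesis
          unfolding xj using Plus \<open>p g = Some j\<close> by (simp add: vstep_def site algebra_simps)
      next
        case False
        have "vstep x t (site_of r (T - 1)) f' (?R a) (?P p) * t ^ card (ahead r T a p) =
          f' Plus (?P p) * t ^ card (ahead r T Plus p) + x powi j *
            (f' (Color (rot_color r g)) ((?P p)(rot_color r g := None)) * t ^ card (ahead r T Plus p))"
          using Plus \<open>p g = Some j\<close> False g
          by (simp add: vstep_def site' relabel_def rot_config_at algebra_simps)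
        also have "\<dots> = c * f Plus p + x powi j * (c * f (Color g) (p(g := None)))"
          using D[OF st] D2 Plus False g a1 by (simp add: relabel_def rot_config_upd)
        finally show ?thesis
          using Plus \<open>p g = Some j\<close> by (simp add: vstep_def site algebra_simps)
      qed
    qed
  next
    case (Color h)
    then have h: "h \<in> Q" "h < r" and ph: "p h = None" using st Q by (auto simp: state_on_def)
    show ?thesis
    proof (cases "h = g")
      case True
      have a1: "ahead r (T - 1) a p = ahead r T a p"
        using Color True g ph by (auto simp: ahead_def T1 lex)
      have st2: "state_on Q A r Plus (p(g := Some j))"
        using st Color True \<open>A \<le> T\<close> T by (auto simp: state_on_def)
      have "ahead r (T - 1) Plus (p(g := Some j)) = ahead r T a p"
        using Color True g ph by (auto simp: ahead_def T1 lex)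
      note D2 = D[OF st2, unfolded this]
      show ?thesis
      proof (cases "g = 0")
        case g0: True
        \<comment> \<open>Leaving the edge in column j - 1 instead of j uses up the extra factor
          x.\<close>
        have xj: "x powi (- (j - 1)) = x * x powi (- j)" using x by (simp add: power_int_minus power_int_diff field_simps)
        have "vstep x t (site_of r (T - 1)) f' (?R a) (?P p) * t ^ card (ahead r T a p) =
           f' (?R a) (?P p) * t ^ card (ahead r T a p) + (1 - t) * x powi (- (j - 1)) *
           (f' Plus ((?P p)(rot_color r g := Some (j - 1))) * t ^ card (ahead r T a p))"
          using Color True g0 by (simp add: vstep_def site' relabel_def algebra_simps)
        also have "\<dots> = c * x * f a p + (1 - t) * (x * x powi (- j)) * (c * f Plus (p(g := Some j)))"
          unfolding xj using D[OF st] D2 Color True g0 a1 g by (simp add: relabel_def rot_config_upd)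
        finally show ?thesis
          using Color True g0 by (simp add: vstep_def site algebra_simps)
      next
        case False
        have "vstep x t (site_of r (T - 1)) f' (?R a) (?P p) * t ^ card (ahead r T a p) =
           f' (?R a) (?P p) * t ^ card (ahead r T a p) + (1 - t) * x powi (- j) *
           (f' Plus ((?P p)(rot_color r g := Some j)) * t ^ card (ahead r T a p))"
          using Color True False by (simp add: vstep_def site' relabel_def algebra_simps)
        also have "\<dots> = c * f a p + (1 - t) * x powi (- j) * (c * f Plus (p(g := Some j)))"
          using D[OF st] D2 Color True False a1 g by (simp add: relabel_def rot_config_upd)
        finally show ?thesis
          using Color True False by (simp add: vstep_def site algebra_simps)
      qed
    next
      case hg: False
      have v: "vstep x t (site_of r (T - 1)) f' (?R a) (?P p) =
          (if p g = Some j \<and> (h = 0 \<or> g \<noteq> 0 \<and> g < h) then t else 1) * f' (?R a) (?P p)"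
      proof -
        have 1: "?P p (rot_color r g) = Some (if g = 0 then j - 1 else j) \<longleftrightarrow> p g = Some j"
          using rot_config_at[OF g, of p] by auto
        have 2: "rot_color r g < rot_color r h \<longleftrightarrow> h = 0 \<or> g \<noteq> 0 \<and> g < h"
          using hg g h by (auto simp: rot_color_def)
        show ?thesis
          using Color hg rot_color_eq[OF h(2) g] by (simp add: vstep_def site' relabel_def 1 2)
      qed
      have v': "vstep x t (site_of r T) f a p = (if p g = Some j \<and> g < h then t else 1) * f a p"
        using Color hg by (auto simp: vstep_def site)
      consider (0) "p g = Some j" "h = 0" | (1) "p g = Some j" "g = 0" | (2) "p g \<noteq> Some j \<or> h \<noteq> 0 \<and> g \<noteq> 0"
        by blast
      then show ?thesis
      proof cases
        case 0
        \<comment> \<open>Color 0 moves past color g, which from now on lies to its left.\<close>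
        have "ahead r (T - 1) a p = insert g (ahead r T a p)" "g \<notin> ahead r T a p"
          using 0 Color hg g by (auto simp: ahead_def T1 lex)
        then show ?thesis using D[OF st] 0 Color v v' by (simp add: algebra_simps)
      next
        case 1
        \<comment> \<open>Color h was to the left of color 0 and now moves past it.\<close>
        have "ahead r T a p = insert h (ahead r (T - 1) a p)" "h \<notin> ahead r (T - 1) a p"
          using 1 Color hg g h by (auto simp: ahead_def T1 lex)
        then show ?thesis using D[OF st] 1 Color v v' hg by (simp add: algebra_simps)
      next
        case 2
        have "ahead r (T - 1) a p = ahead r T a p"
        proof (cases "h = 0")
          case True
          then show ?thesis using 2 Color hg g by (auto simp: ahead_def T1 lex le_less[of g])
        next
          case False
          then show ?thesis using 2 Color hg g h by (auto simp: ahead_def T1 lex intro!: Nat.gr0I)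
        qed
        then show ?thesis using D[OF st] 2 Color v v' hg by (auto simp: algebra_simps)
      qed
    qed
  qed
qed

lemma rotation_related_sites:
  assumes "rotation_related Q A r t x c (A - 1) f f'" and Q: "Q \<subseteq> {..<r}" "0 \<in> Q" and x: "x \<noteq> 0"
    and "A - 1 \<le> B"
  shows "rotation_related Q A r t x c B (sweep x t (interval_sites r A B) f)
    (sweep x t (interval_sites r (A - 1) (B - 1)) f')"
  using \<open>A - 1 \<le> B\<close>
proof (induction B rule: int_ge_induct)
  case base
  then show ?case using assms(1) by (simp add: interval_sites_empty)
next
  case (step B)
  then show ?case
    using rotation_related_vstep[of Q A r t x c "B + 1"] Q x by (simp add: interval_sites_rec)
qed

section \<open>Configurations without the largest color\<close>

definition absent_zero :: "nat \<Rightarrow> spin \<Rightarrow> config \<Rightarrow> bool" where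
  "absent_zero r a p \<longleftrightarrow> p 0 = None \<and> a \<noteq> Color 0 \<and> (\<forall>h. a = Color h \<longrightarrow> h < r) \<and> (\<forall>g\<ge>r. p g = None)"

text \<open>On the colors other than 0 the rotation preserves the order and the columns, so it is an
  exact symmetry without any factor.\<close>

lemma absent_zero_sweep:
  assumes "\<And>a p. absent_zero r a p \<Longrightarrow> f' (relabel (rot_color r) a) (rot_config r p) = f a p" and "0 < r"
  shows "absent_zero r a p \<Longrightarrow>
    sweep x t (interval_sites r (A - 1) (B - 1)) f' (relabel (rot_color r) a) (rot_config r p) =
    sweep x t (interval_sites r A B) f a p"
proof (induction "nat (B - A + 1)" arbitrary: B a p)
  case 0
  then show ?case using assms by (simp add: interval_sites_empty)
next
  case (Suc n)
  then have "A \<le> B" by linarith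
  obtain j g where site: "site_of r B = (j, g)" by force
  note T = site_ofD[OF site \<open>0 < r\<close>]
  have g: "g < r" by (rule T)
  have site': "site_of r (B - 1) = (if g = 0 then j - 1 else j, rot_color r g)"
    using rot_site[OF g] T by simp
  let ?F = "sweep x t (interval_sites r A (B - 1)) f"
  let ?F' = "sweep x t (interval_sites r (A - 1) (B - 1 - 1)) f'"
  have IH: "?F' (relabel (rot_color r) a) (rot_config r p) = ?F a p" if "absent_zero r a p" for a p
    using Suc.hyps(1)[of "B - 1" a p] that Suc.hyps(2) \<open>A \<le> B\<close> by simp
  have 1: "rot_config r p (rot_color r g) = Some (if g = 0 then j - 1 else j) \<longleftrightarrow> p g = Some j"
    using rot_config_at[OF g, of p] by auto
  have "vstep x t (site_of r (B - 1)) ?F' (relabel (rot_color r) a) (rot_config r p) =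
    vstep x t (site_of r B) ?F a p"
  proof (cases a)
    case Plus
    show ?thesis
    proof (cases "p g = Some j")
      case True
      have "g \<noteq> 0"
      proof
        assume "g = 0"
        then show False using True Suc.prems by (simp add: absent_zero_def)
      qed
      then have "?F' (Color (rot_color r g)) ((rot_config r p)(rot_color r g := None)) = ?F (Color g) (p(g := None))"
        using IH[of "Color g" "p(g := None)"] Suc.prems g True by (auto simp: absent_zero_def relabel_def rot_config_upd)
      with \<open>g \<noteq> 0\<close> 1 True Plus IH[OF Suc.prems] show ?thesis
        by (simp add: vstep_def site site' relabel_def)
    next
      case False
      with 1 Plus IH[OF Suc.prems] show ?thesis
        by (simp add: vstep_def site site' relabel_def)
    qed
  next
    case (Color h)
    then have h: "h \<noteq> 0" "h < r" using Suc.prems by (auto simp: absent_zero_def)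
    show ?thesis
    proof (cases "h = g")
      case True
      have "?F' Plus ((rot_config r p)(rot_color r g := Some j)) = ?F Plus (p(g := Some j))"
        using IH[of Plus "p(g := Some j)"] Suc.prems g h True by (auto simp: absent_zero_def relabel_def rot_config_upd)
      with h True Color IH[OF Suc.prems] show ?thesis
        by (simp add: vstep_def site site' relabel_def)
    next
      case False
      have "p g = Some j \<Longrightarrow> rot_color r g < rot_color r h \<longleftrightarrow> g < h"
        using False Suc.prems h by (auto simp: rot_color_def absent_zero_def)
      with 1 Color False rot_color_eq[OF h(2) g] IH[OF Suc.prems] show ?thesis
        by (auto simp: vstep_def site site' relabel_def)
    qed
  qed
  then show ?case using \<open>A \<le> B\<close> by (simp add: interval_sites_rec)
qed

lemma rows_value_rotate_absent:
  assumes "0 < r"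
  shows "absent_zero r Plus p \<Longrightarrow> 0 \<notin> snd ` set rws \<Longrightarrow> snd ` set rws \<subseteq> {..<r} \<Longrightarrow>
    rows_value t (interval_sites r (A - 1) (B - 1)) (map (apsnd (rot_color r)) rws) (rot_config r p) =
    rows_value t (interval_sites r A B) rws p"
proof (induction rws arbitrary: p)
  case Nil
  have "rot_config r p = (\<lambda>_. None) \<longleftrightarrow> p = (\<lambda>_. None)"
  proof
    assume *: "rot_config r p = (\<lambda>_. None)"
    have "p g = None" for g
    proof (cases "g = 0 \<or> r \<le> g")
      case True
      then show ?thesis using Nil by (auto simp: absent_zero_def)
    next
      case False
      then show ?thesis using fun_cong[OF *, of "g - 1"] by (auto simp: rot_config_def split: if_splits)
    qed
    then show "p = (\<lambda>_. None)" by auto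
  next
    assume "p = (\<lambda>_. None)"
    then show "rot_config r p = (\<lambda>_. None)" by (auto simp: rot_config_def)
  qed
  then show ?case by simp
next
  case (Cons row rws)
  obtain x d where row: "row = (x, d)" by force
  have d: "d < r" "d \<noteq> 0" using Cons.prems row by auto
  let ?f' = "exit_right (rot_color r d) (rows_value t (interval_sites r (A - 1) (B - 1)) (map (apsnd (rot_color r)) rws))"
  let ?f = "exit_right d (rows_value t (interval_sites r A B) rws)"
  have "?f' (relabel (rot_color r) a) (rot_config r p) = ?f a p"
    if "absent_zero r a p" for a p
  proof (cases a)
    case (Color h)
    have "absent_zero r Plus p" "h < r" using that Color by (auto simp: absent_zero_def)
    then show ?thesis
      using Cons.IH[of p] Cons.prems Color d rot_color_eq[of h r d] by (simp add: exit_right_def relabel_def)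
  qed (simp add: exit_right_def relabel_def)
  from absent_zero_sweep[where a = Plus and p = p and r = r and f = ?f and f' = ?f', OF this \<open>0 < r\<close> Cons.prems(1)] show ?case
    by (simp add: row relabel_def)
qed

text \<open>When color 0 exits, the colors of all later rows lie to its left, which accounts for
  \<open>t ^ length rws\<close>; dividing by x removes the factor that
  \<open>rotation_related\<close> attaches to color 0 on the edge.\<close>

fun rotation_factor :: "complex \<Rightarrow> (complex \<times> nat) list \<Rightarrow> complex" where
  "rotation_factor t [] = 1"
| "rotation_factor t ((x, d) # rws) = (if d = 0 then t ^ length rws / x else rotation_factor t rws)"

lemma rows_value_rotate:
  assumes "A - 1 \<le> B"
  shows "state_on (snd ` set rws) A r Plus p \<Longrightarrow> distinct (map snd rws) \<Longrightarrow> snd ` set rws \<subseteq> {..<r} \<Longrightarrow>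
    0 \<in> snd ` set rws \<Longrightarrow> (\<And>x d. (x, d) \<in> set rws \<Longrightarrow> x \<noteq> 0) \<Longrightarrow>
    rows_value t (interval_sites r (A - 1) (B - 1)) (map (apsnd (rot_color r)) rws) (rot_config r p) *
      t ^ card (ahead r B Plus p) =
    rotation_factor t rws * rows_value t (interval_sites r A B) rws p"
proof (induction rws arbitrary: p)
  case (Cons row rws)
  obtain x d where row: "row = (x, d)" by force
  let ?Q = "insert d (snd ` set rws)"
  have d: "d < r" "x \<noteq> 0" "d \<notin> snd ` set rws" using Cons.prems row by auto
  have Q: "?Q \<subseteq> {..<r}" "0 \<in> ?Q" using Cons.prems row by auto
  let ?f = "rows_value t (interval_sites r A B) rws"
  let ?f' = "rows_value t (interval_sites r (A - 1) (B - 1)) (map (apsnd (rot_color r)) rws)"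
  let ?c = "rotation_factor t ((x, d) # rws)"
  have "rotation_related ?Q A r t x ?c (A - 1) (exit_right d ?f) (exit_right (rot_color r d) ?f')"
    unfolding rotation_related_def
  proof (intro allI impI)
    fix a p assume st: "state_on ?Q A r a p"
    show "exit_right (rot_color r d) ?f' (relabel (rot_color r) a) (rot_config r p) * t ^ card (ahead r (A - 1) a p) =
       ?c * (if a = Color 0 then x else 1) * exit_right d ?f a p"
    proof (cases "a = Color d")
      case False
      have "h < r" if "a = Color h" for h
      proof -
        have "h \<in> ?Q" using st that unfolding state_on_def by blast
        then show ?thesis using Q by blast
      qed
      then have "relabel (rot_color r) a \<noteq> Color (rot_color r d)"
        using False d rot_color_eq[of _ r d] by (cases a) (auto simp: relabel_def)
      then show ?thesis using False by (simp add: exit_right_def)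
    next
      case True
      have "insert d {g. p g \<noteq> None} = insert d (snd ` set rws)" "p d = None"
        using st True by (auto simp: state_on_def)
      then have pQ: "{g. p g \<noteq> None} = snd ` set rws"
        using d by (subst (asm) insert_ident) auto
      have rng: "p g = Some j \<Longrightarrow> A \<le> j * int r + int g" for g j
        using st by (auto simp: state_on_def)
      show ?thesis
      proof (cases "d = 0")
        case d0: True
        have pr: "g < r" if "p g = Some j" for g j
        proof -
          have "g \<in> {g. p g \<noteq> None}" using that by simp
          then show ?thesis using pQ Q by auto
        qed
        have p0: "p 0 = None" using pQ d d0 by auto
        have "g \<in> ahead r (A - 1) a p \<longleftrightarrow> p g \<noteq> None" for g
        proof (cases "p g")
          case None
          then show ?thesis using True d0 by (simp add: ahead_def)
        next
          case (Some j)
          have "g \<noteq> 0" using Some p0 by (cases "g = 0") auto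
          then have "g < r" "g \<noteq> 0" "A - 1 < j * int r + int g" using Some pr rng[of g j] by auto
          then show ?thesis using True d0 Some by (simp add: ahead_def)
        qed
        \<comment> \<open>Color 0 stands at the right end, so every color that remains is to its
          left.\<close>
        then have "ahead r (A - 1) a p = {g. p g \<noteq> None}" by blast
        then have "card (ahead r (A - 1) a p) = card (set (map snd rws))"
          using pQ by simp
        also have "\<dots> = length rws"
          using Cons.prems(2) row by (subst distinct_card) auto
        finally have "card (ahead r (A - 1) a p) = length rws" .
        moreover have "?f' (rot_config r p) = ?f p"
        proof (rule rows_value_rotate_absent)
          have "p g = None" if "r \<le> g" for g
            using pr[of g] that by (cases "p g") auto
          then show "absent_zero r Plus p" using p0 by (simp add: absent_zero_def)
        qed (use d d0 Q in auto)
        ultimately show ?thesis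
          using True d0 d(2) by (simp add: exit_right_def relabel_def)
      next
        case d0: False
        \<comment> \<open>No occupied site lies below A, so the exiting color d is not to the left
          of color 0 and drops out of the count on both sides.\<close>
        have "ahead r (A - 1) a p = ahead r B Plus p"
        proof -
          have "p d = None" using st True by (auto simp: state_on_def)
          moreover have "\<not> i * int r \<le> A - 1" if "p 0 = Some i" for i
            using rng[OF that] by simp
          ultimately show ?thesis
            using True d0 by (auto simp: ahead_def)
        qed
        moreover have "state_on (snd ` set rws) A r Plus p"
          using pQ rng by (auto simp: state_on_def)
        moreover have "0 \<in> snd ` set rws" using Q d0 by auto
        ultimately show ?thesis
          using Cons.IH[of p] Cons.prems True d0 row by (auto simp: exit_right_def relabel_def)
      qed
    qed
  qed
  from rotation_related_sites[OF this Q d(2) assms]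
  have "rotation_related ?Q A r t x ?c B (sweep x t (interval_sites r A B) (exit_right d ?f))
    (sweep x t (interval_sites r (A - 1) (B - 1)) (exit_right (rot_color r d) ?f'))" .
  then show ?case
    unfolding rotation_related_def using Cons.prems(1) by (auto simp: row relabel_def dest!: spec[of _ Plus])
qed simp

section \<open>Reduction of the partition function to proper configurations\<close>

definition occupants :: "config \<Rightarrow> int \<Rightarrow> nat set" where
  "occupants p j = {k. p k = Some j}"

text \<open>Vertical spins are sets of colors: over a proper flag, multiplicities above 1 do not
  occur in a state of nonzero weight (see \<open>state_counts\<close>).\<close>

definition mono_op :: "weight_kind \<Rightarrow> nat \<Rightarrow> complex \<Rightarrow> complex \<Rightarrow> int \<times> nat \<Rightarrow>
    (spin \<Rightarrow> (int \<Rightarrow> nat set) \<Rightarrow> complex) \<Rightarrow> spin \<Rightarrow> (int \<Rightarrow> nat set) \<Rightarrow> complex" where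
  "mono_op kind r x t s F a v = (case s of (j, k) \<Rightarrow>
     \<Sum>c\<in>hspins r. \<Sum>e\<in>UNIV. mono_weight kind x t k a (of_bool (k \<in> v j)) c (of_bool e) *
       F c (v(j := if e then insert k (v j) else v j - {k})))"

definition column_op :: "weight_kind \<Rightarrow> nat \<Rightarrow> complex \<Rightarrow> complex \<Rightarrow> int \<Rightarrow>
    (spin \<Rightarrow> (int \<Rightarrow> nat set) \<Rightarrow> complex) \<Rightarrow> spin \<Rightarrow> (int \<Rightarrow> nat set) \<Rightarrow> complex" where
  "column_op kind r x t j F a v = (\<Sum>c\<in>hspins r. \<Sum>D\<in>Pow {..<r}.
     colored_weight kind r x t a (mset_set (v j)) c (mset_set D) * F c (v(j := D)))"

text \<open>The weight of the m rightmost monochrome vertices of a fused vertex, those of color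
  index below m. This allows the leftmost vertex to be split off in an induction on m.\<close>

definition partial_weight :: "weight_kind \<Rightarrow> nat \<Rightarrow> complex \<Rightarrow> complex \<Rightarrow> nat \<Rightarrow> spin \<Rightarrow> (nat \<Rightarrow> nat) \<Rightarrow> spin \<Rightarrow> (nat \<Rightarrow> nat) \<Rightarrow> complex"
  where
  "partial_weight kind r x t m a b c d =
     (\<Sum>s \<in> {s \<in> {0..m} \<rightarrow>\<^sub>E hspins r. s m = a \<and> s 0 = c}.
        \<Prod>k<m. mono_weight kind x t k (s (Suc k)) (b k) (s k) (d k))"

lemma finite_hspins [simp]: "finite (hspins r)"
  by (simp add: hspins_def)

lemma partial_weight_0:
  assumes "a \<in> hspins r"
  shows "partial_weight kind r x t 0 a b c d = (if a = c then 1 else 0)"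
proof -
  have "{s \<in> {0..0::nat} \<rightarrow>\<^sub>E hspins r. s 0 = a \<and> s 0 = c} = (if a = c then {\<lambda>i\<in>{0..0}. a} else {})"
    using assms by (auto simp: PiE_iff extensional_def fun_eq_iff)
  then show ?thesis by (simp add: partial_weight_def)
qed

lemma partial_weight_Suc:
  assumes "a \<in> hspins r"
  shows "partial_weight kind r x t (Suc m) a b c d =
    (\<Sum>e\<in>hspins r. mono_weight kind x t m a (b m) e (d m) * partial_weight kind r x t m e b c d)"
proof -
  let ?W = "\<lambda>s. \<Prod>k<m. mono_weight kind x t k (s (Suc k)) (b k) (s k) (d k)"
  let ?S = "{s \<in> {0..m} \<rightarrow>\<^sub>E hspins r. s 0 = c}"
  have fin: "finite ?S" by (rule finite_subset[of _ "{0..m} \<rightarrow>\<^sub>E hspins r"]) (auto intro: finite_PiE)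
  have "partial_weight kind r x t (Suc m) a b c d =
     (\<Sum>s\<in>?S. mono_weight kind x t m a (b m) (s m) (d m) * ?W s)"
    unfolding partial_weight_def
  proof (rule sum.reindex_bij_witness[where i = "\<lambda>s. s(Suc m := a)" and j = "\<lambda>s. s(Suc m := undefined)"])
    fix s assume s: "s \<in> {s \<in> {0..Suc m} \<rightarrow>\<^sub>E hspins r. s (Suc m) = a \<and> s 0 = c}"
    then show "s(Suc m := undefined, Suc m := a) = s" by auto
    show "s(Suc m := undefined) \<in> ?S" using s by (auto simp: PiE_iff extensional_def)
    have "(\<Prod>k<m. mono_weight kind x t k (s (Suc k)) (b k) (s k) (d k)) = ?W (s(Suc m := undefined))"
      by (intro prod.cong) auto
    then show "mono_weight kind x t m a (b m) ((s(Suc m := undefined)) m) (d m) * ?W (s(Suc m := undefined)) =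
      (\<Prod>k<Suc m. mono_weight kind x t k (s (Suc k)) (b k) (s k) (d k))"
      using s by simp
  next
    fix s assume s: "s \<in> ?S"
    then show "s(Suc m := a, Suc m := undefined) = s" by (auto simp: PiE_iff extensional_def)
    show "s(Suc m := a) \<in> {s \<in> {0..Suc m} \<rightarrow>\<^sub>E hspins r. s (Suc m) = a \<and> s 0 = c}"
      using s assms by (auto simp: PiE_iff extensional_def)
  qed
  also have "\<dots> = (\<Sum>e\<in>hspins r. \<Sum>s\<in>{s\<in>?S. s m = e}. mono_weight kind x t m a (b m) (s m) (d m) * ?W s)"
    by (rule sum.group[symmetric]) (use fin in \<open>auto simp: PiE_iff\<close>)
  also have "\<dots> = (\<Sum>e\<in>hspins r. mono_weight kind x t m a (b m) e (d m) * partial_weight kind r x t m e b c d)"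
    unfolding partial_weight_def sum_distrib_left by (intro sum.cong refl) auto
  finally show ?thesis .
qed

lemma partial_weight_cong:
  "(\<And>k. k < m \<Longrightarrow> b k = b' k) \<Longrightarrow> (\<And>k. k < m \<Longrightarrow> d k = d' k) \<Longrightarrow>
   partial_weight kind r x t m a b c d = partial_weight kind r x t m a b' c d'"
  unfolding partial_weight_def by (intro sum.cong prod.cong refl) auto

lemma sum_Pow_lessThan_Suc:
  fixes f :: "nat set \<Rightarrow> 'b::comm_monoid_add"
  shows "sum f (Pow {..<Suc m}) = (\<Sum>D\<in>Pow {..<m}. \<Sum>e\<in>UNIV. f (if e then insert m D else D))"
proof -
  have "sum f (Pow {..<Suc m}) = sum f (Pow {..<m} \<union> insert m ` Pow {..<m})"
    by (simp add: lessThan_Suc Pow_insert)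
  also have "\<dots> = sum f (Pow {..<m}) + sum f (insert m ` Pow {..<m})"
    by (rule sum.union_disjoint) auto
  also have "sum f (insert m ` Pow {..<m}) = (\<Sum>D\<in>Pow {..<m}. f (insert m D))"
  proof (rule sum.reindex_cong[of "insert m"])
    show "inj_on (insert m) (Pow {..<m})"
    proof (rule inj_onI)
      fix D E assume "D \<in> Pow {..<m}" "E \<in> Pow {..<m}" "insert m D = insert m E"
      moreover from this have "m \<notin> D" "m \<notin> E" by auto
      ultimately show "D = E" by (metis insert_ident)
    qed
  qed auto
  finally show ?thesis by (simp add: UNIV_bool sum.distrib add.commute)
qed

lemma sum_rotate4:
  fixes f :: "'a \<Rightarrow> 'b \<Rightarrow> 'c \<Rightarrow> 'd \<Rightarrow> 'e::comm_monoid_add"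
  shows "(\<Sum>a\<in>A. \<Sum>b\<in>B. \<Sum>c\<in>C. \<Sum>d\<in>D. f a b c d) = (\<Sum>c\<in>C. \<Sum>d\<in>D. \<Sum>b\<in>B. \<Sum>a\<in>A. f a b c d)"
proof -
  have "(\<Sum>a\<in>A. \<Sum>b\<in>B. \<Sum>p\<in>C \<times> D. g a b p) = (\<Sum>p\<in>C \<times> D. \<Sum>b\<in>B. \<Sum>a\<in>A. g a b p)" for g :: "'a \<Rightarrow> 'b \<Rightarrow> 'c \<times> 'd \<Rightarrow> 'e"
  proof -
    have "(\<Sum>a\<in>A. \<Sum>b\<in>B. \<Sum>p\<in>C \<times> D. g a b p) = (\<Sum>b\<in>B. \<Sum>a\<in>A. \<Sum>p\<in>C \<times> D. g a b p)" by (rule sum.swap)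
    also have "\<dots> = (\<Sum>b\<in>B. \<Sum>p\<in>C \<times> D. \<Sum>a\<in>A. g a b p)" by (intro sum.cong refl sum.swap)
    also have "\<dots> = (\<Sum>p\<in>C \<times> D. \<Sum>b\<in>B. \<Sum>a\<in>A. g a b p)" by (rule sum.swap)
    finally show ?thesis .
  qed
  from this[of "\<lambda>a b (c, d). f a b c d"] show ?thesis
    by (simp add: sum.cartesian_product[symmetric] split_def sum.cartesian_product')
qed

text \<open>Colors of index at least m keep their top spins, whence the part
  \<open>v j - {..<m}\<close> in the updated set.\<close>

lemma mono_ops_partial:
  assumes "a \<in> hspins r" "m \<le> r"
  shows "foldr (mono_op kind r x t) (map (Pair j) (rev [0..<m])) F a v =
    (\<Sum>c\<in>hspins r. \<Sum>D\<in>Pow {..<m}. partial_weight kind r x t m a (\<lambda>k. of_bool (k \<in> v j)) c (\<lambda>k. of_bool (k \<in> D)) *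
       F c (v(j := D \<union> (v j - {..<m}))))"
  using assms
proof (induction m arbitrary: a v)
  case 0
  then show ?case by (simp add: partial_weight_0 if_distrib[of "\<lambda>u. u * _"] cong: if_cong)
next
  case (Suc m)
  let ?b = "\<lambda>v k. of_bool (k \<in> v j) :: nat" and ?d = "\<lambda>D k. of_bool (k \<in> D) :: nat"
  let ?u = "\<lambda>e. v(j := if e then insert m (v j) else v j - {m})"
  let ?pw = "\<lambda>m. partial_weight kind r x t m"
  have "foldr (mono_op kind r x t) (map (Pair j) (rev [0..<Suc m])) F a v =
    (\<Sum>c\<in>hspins r. \<Sum>e\<in>UNIV. mono_weight kind x t m a (?b v m) c (of_bool e) *
      (\<Sum>c'\<in>hspins r. \<Sum>D\<in>Pow {..<m}. ?pw m c (?b (?u e)) c' (?d D) * F c' ((?u e)(j := D \<union> (?u e j - {..<m})))))"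
  proof -
    have IH: "foldr (mono_op kind r x t) (map (Pair j) (rev [0..<m])) F c u =
       (\<Sum>c'\<in>hspins r. \<Sum>D\<in>Pow {..<m}. ?pw m c (?b u) c' (?d D) * F c' (u(j := D \<union> (u j - {..<m}))))"
      if "c \<in> hspins r" for c u
      by (rule Suc.IH) (use that Suc.prems in auto)
    have "foldr (mono_op kind r x t) (map (Pair j) (rev [0..<Suc m])) F a v =
      mono_op kind r x t (j, m) (foldr (mono_op kind r x t) (map (Pair j) (rev [0..<m])) F) a v" by simp
    then show ?thesis
      by (simp only: mono_op_def prod.case IH cong: sum.cong)
  qed
  also have "\<dots> = (\<Sum>c\<in>hspins r. \<Sum>e\<in>UNIV. \<Sum>c'\<in>hspins r. \<Sum>D\<in>Pow {..<m}.
      mono_weight kind x t m a (?b v m) c (of_bool e) * ?pw m c (?b v) c' (?d D) *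
      F c' (v(j := (if e then insert m D else D) \<union> (v j - {..<Suc m}))))"
    unfolding sum_distrib_left
  proof (intro sum.cong refl)
    fix c c' e D assume D: "D \<in> Pow {..<m}"
    have 1: "?pw m c (?b (?u e)) c' (?d D) = ?pw m c (?b v) c' (?d D)"
      by (rule partial_weight_cong) auto
    have "D \<union> (?u e j - {..<m}) = (if e then insert m D else D) \<union> (v j - {..<Suc m})"
      by auto
    then have 2: "(?u e)(j := D \<union> (?u e j - {..<m})) = v(j := (if e then insert m D else D) \<union> (v j - {..<Suc m}))"
      by (simp only: fun_upd_upd)
    show "mono_weight kind x t m a (?b v m) c (of_bool e) *
      (?pw m c (?b (?u e)) c' (?d D) * F c' ((?u e)(j := D \<union> (?u e j - {..<m})))) =
      mono_weight kind x t m a (?b v m) c (of_bool e) * ?pw m c (?b v) c' (?d D) *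
      F c' (v(j := (if e then insert m D else D) \<union> (v j - {..<Suc m})))"
      unfolding 1 2 by (simp only: mult.assoc)
  qed
  also have "\<dots> = (\<Sum>c'\<in>hspins r. \<Sum>D\<in>Pow {..<m}. \<Sum>e\<in>UNIV. \<Sum>c\<in>hspins r.
      mono_weight kind x t m a (?b v m) c (of_bool e) * ?pw m c (?b v) c' (?d D) *
      F c' (v(j := (if e then insert m D else D) \<union> (v j - {..<Suc m}))))"
    by (rule sum_rotate4)
  also have "\<dots> = (\<Sum>c'\<in>hspins r. \<Sum>D\<in>Pow {..<m}. \<Sum>e\<in>UNIV.
      ?pw (Suc m) a (?b v) c' (?d (if e then insert m D else D)) *
      F c' (v(j := (if e then insert m D else D) \<union> (v j - {..<Suc m}))))"
  proof (intro sum.cong refl)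
    fix c' e D assume D: "D \<in> Pow {..<m}"
    let ?D = "if e then insert m D else D"
    have "?pw (Suc m) a (?b v) c' (?d ?D) = (\<Sum>c\<in>hspins r. mono_weight kind x t m a (?b v m) c (?d ?D m) * ?pw m c (?b v) c' (?d ?D))"
      by (rule partial_weight_Suc) (use Suc.prems in auto)
    also have "\<dots> = (\<Sum>c\<in>hspins r. mono_weight kind x t m a (?b v m) c (of_bool e) * ?pw m c (?b v) c' (?d D))"
    proof (intro sum.cong refl)
      fix c
      have "?d ?D m = of_bool e" using D by auto
      moreover have "?pw m c (?b v) c' (?d ?D) = ?pw m c (?b v) c' (?d D)"
        by (rule partial_weight_cong) auto
      ultimately show "mono_weight kind x t m a (?b v m) c (?d ?D m) * ?pw m c (?b v) c' (?d ?D) =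
        mono_weight kind x t m a (?b v m) c (of_bool e) * ?pw m c (?b v) c' (?d D)" by simp
    qed
    finally show "(\<Sum>c\<in>hspins r. mono_weight kind x t m a (?b v m) c (of_bool e) * ?pw m c (?b v) c' (?d D) *
        F c' (v(j := ?D \<union> (v j - {..<Suc m})))) =
      ?pw (Suc m) a (?b v) c' (?d ?D) * F c' (v(j := ?D \<union> (v j - {..<Suc m})))"
      by (simp add: sum_distrib_right)
  qed
  finally show ?case by (simp only: sum_Pow_lessThan_Suc)
qed

lemma column_op_eq:
  assumes "a \<in> hspins r" "v j \<subseteq> {..<r}"
  shows "column_op kind r x t j F a v = foldr (mono_op kind r x t) (column_sites r j) F a v"
proof -
  have "colored_weight kind r x t a (mset_set (v j)) c (mset_set D) =
    partial_weight kind r x t r a (\<lambda>k. of_bool (k \<in> v j)) c (\<lambda>k. of_bool (k \<in> D))" if "D \<in> Pow {..<r}" for c D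
  proof -
    have "finite (v j)" "finite D" using assms that by (auto intro: finite_subset)
    then show ?thesis
      unfolding colored_weight_def partial_weight_def by (intro sum.cong prod.cong refl) (auto simp: count_mset_set')
  qed
  moreover have "D \<union> (v j - {..<r}) = D" for D using assms by auto
  ultimately show ?thesis
    unfolding column_sites_def column_op_def mono_ops_partial[OF assms(1) order_refl]
    by (intro sum.cong refl) (simp only:)
qed

section \<open>One monochrome vertex and the distribution of the factors x\<close>

lemma mono_weight_nonzero:
  assumes "mono_weight kind x t k a b c d \<noteq> 0"
  shows "c = Plus \<or> c = a \<or> c = Color k"
  using assms by (auto simp: mono_weight_def split: spin.splits if_splits)

text \<open>For multiplicities 0 and 1 the P-weights and the R-weights coincide: x (1 - t) when a
  color leaves the edge, 1 when it enters. The latter uses t \<noteq> 1 to cancel (1 - t) / (1 -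
  t).\<close>

lemma mono_op_vstep:
  assumes g: "g < r" and t: "t \<noteq> 1" and a: "\<And>h. a = Color h \<Longrightarrow> h < r \<and> p h = None"
  shows "mono_op kind r x t (j, g) F a (occupants p) =
    (case a of Plus \<Rightarrow> F Plus (occupants p) + (if p g = Some j then F (Color g) (occupants (p(g := None))) else 0)
     | Color h \<Rightarrow> if h = g then x * F a (occupants p) + x * (1 - t) * F Plus (occupants (p(g := Some j)))
          else (if p g = Some j \<and> g < h then t else 1) * F a (occupants p))"
proof -
  let ?v = "occupants p"
  let ?G = "\<lambda>c. \<Sum>e\<in>UNIV. mono_weight kind x t g a (of_bool (g \<in> ?v j)) c (of_bool e) *
       F c (?v(j := if e then insert g (?v j) else ?v j - {g}))"
  let ?C = "insert Plus (insert (Color g) (case a of Plus \<Rightarrow> {} | Color h \<Rightarrow> {Color h}))"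
  have "mono_op kind r x t (j, g) F a ?v = sum ?G (hspins r)" by (simp add: mono_op_def)
  also have "\<dots> = sum ?G ?C"
  proof (rule sum.mono_neutral_right)
    show "?C \<subseteq> hspins r" using a g by (auto simp: hspins_def split: spin.splits)
    have "mono_weight kind x t g a b c d = 0" if "c \<in> hspins r - ?C" for b c d
      using mono_weight_nonzero[of kind x t g a b c d] that by (auto split: spin.splits)
    then show "\<forall>c\<in>hspins r - ?C. ?G c = 0" by simp
  qed simp
  finally have eq: "mono_op kind r x t (j, g) F a ?v = sum ?G ?C" .
  have in_v: "g \<in> ?v j \<longleftrightarrow> p g = Some j" by (simp add: occupants_def)
  have triv: "?v(j := insert g (?v j)) = ?v" if "p g = Some j"
    using that by (auto simp: occupants_def fun_eq_iff)
  have triv': "?v(j := ?v j - {g}) = ?v" if "p g \<noteq> Some j"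
    using that by (auto simp: occupants_def fun_eq_iff)
  have rem: "?v(j := ?v j - {g}) = occupants (p(g := None))" if "p g = Some j"
    using that by (auto simp: occupants_def fun_eq_iff)
  have add: "?v(j := insert g (?v j)) = occupants (p(g := Some j))" if "p g = None"
    using that by (auto simp: occupants_def fun_eq_iff)
  show ?thesis
  proof (cases a)
    case Plus
    then show ?thesis
      unfolding eq using t triv triv' rem
      by (auto simp: UNIV_bool mono_weight_def in_v split: weight_kind.splits)
  next
    case (Color h)
    show ?thesis
    proof (cases "h = g")
      case True
      then have "p g = None" using a Color by auto
      then show ?thesis
        unfolding eq using Color True triv' add
        by (cases kind) (auto simp: UNIV_bool mono_weight_def in_v)
    next
      case False
      then show ?thesis
        unfolding eq using Color triv triv'
        by (auto simp: UNIV_bool mono_weight_def in_v)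
    qed
  qed
qed

text \<open>
  The discrepancy between the factors x charged by \<open>vstep\<close> and by the monochrome weights when the
  sites down to T have still to be visited.
\<close>

definition spin_gauge :: "nat \<Rightarrow> complex \<Rightarrow> int \<Rightarrow> int \<Rightarrow> spin \<Rightarrow> complex" where
  "spin_gauge r x M T a = (case a of Plus \<Rightarrow> x powi M | Color h \<Rightarrow> x powi (M - 1 - (T - int h) div int r))"

definition legal :: "nat \<Rightarrow> spin \<Rightarrow> config \<Rightarrow> bool" where
  "legal r a p \<longleftrightarrow> (\<forall>h. a = Color h \<longrightarrow> h < r \<and> p h = None) \<and> (\<forall>g\<ge>r. p g = None)"

text \<open>\<open>(T - int h) div int r\<close> is the column of the first site of color h met from
  T on. Comparing the two formulas, it drops by one exactly when T itself is a site of color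
  h.\<close>

lemma div_site_step:
  assumes "site_of r T = (j, g)" "h < r"
  shows "(T - int h) div int r = (if h \<le> g then j else j - 1)"
    and "(T - 1 - int h) div int r = (if h < g then j else j - 1)"
proof -
  have "0 < r" using assms by auto
  note T = site_ofD[OF assms(1) this]
  have div: "u div int r = q" if "u = int r * q + s" "0 \<le> s" "s < int r" for u q s
    using int_div_pos_eq that by blast
  show "(T - int h) div int r = (if h \<le> g then j else j - 1)"
    using T assms(2) div[of "T - int h" j "int g - int h"] div[of "T - int h" "j - 1" "int g - int h + int r"]
    by (auto simp: algebra_simps)
  show "(T - 1 - int h) div int r = (if h < g then j else j - 1)"
    using T assms(2) div[of "T - 1 - int h" j "int g - int h - 1"] div[of "T - 1 - int h" "j - 1" "int g - int h - 1 + int r"]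
    by (auto simp: algebra_simps)
qed

text \<open>A color crossing a site of its own costs a factor x in the monochrome weights and
  nothing in \<open>vstep\<close>, and the gauge changes by exactly this factor. At sites of other
  colors the gauge of the color on the edge is constant.\<close>

lemma gauge_sites:
  assumes fin: "\<And>a p. legal r a p \<Longrightarrow> Fv a (occupants p) * spin_gauge r x M (M * int r - 1) a = Fp a p"
    and x: "x \<noteq> 0" and t: "t \<noteq> 1" and "0 < r"
  shows "M * int r - 1 \<le> T \<Longrightarrow> legal r a p \<Longrightarrow>
    foldr (mono_op kind r x t) (interval_sites r (M * int r) T) Fv a (occupants p) * spin_gauge r x M T a =
    sweep x t (interval_sites r (M * int r) T) Fp a p"
proof (induction T arbitrary: a p rule: int_ge_induct)
  case base
  then show ?case using fin by (simp add: interval_sites_empty)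
next
  case (step T')
  define T where "T = T' + 1"
  obtain j g where site: "site_of r T = (j, g)" by force
  note T = site_ofD[OF site \<open>0 < r\<close>]
  let ?F = "foldr (mono_op kind r x t) (interval_sites r (M * int r) (T - 1)) Fv"
  let ?G = "sweep x t (interval_sites r (M * int r) (T - 1)) Fp"
  have IH: "?F a (occupants p) * spin_gauge r x M (T - 1) a = ?G a p" if "legal r a p" for a p
    using step.IH[OF that] by (simp add: T_def)
  have m: "mono_op kind r x t (j, g) ?F a (occupants p) =
     (case a of Plus \<Rightarrow> ?F Plus (occupants p) + (if p g = Some j then ?F (Color g) (occupants (p(g := None))) else 0)
     | Color h \<Rightarrow> if h = g then x * ?F a (occupants p) + x * (1 - t) * ?F Plus (occupants (p(g := Some j)))
          else (if p g = Some j \<and> g < h then t else 1) * ?F a (occupants p))"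
    by (rule mono_op_vstep) (use T t step.prems in \<open>auto simp: legal_def\<close>)
  have "mono_op kind r x t (j, g) ?F a (occupants p) * spin_gauge r x M T a = vstep x t (j, g) ?G a p"
  proof (cases a)
    case Plus
    have IH0: "?F Plus (occupants p) * x powi M = ?G Plus p"
      using IH[OF step.prems] Plus by (simp add: spin_gauge_def)
    show ?thesis
    proof (cases "p g = Some j")
      case True
      have "legal r (Color g) (p(g := None))" using step.prems T by (auto simp: legal_def)
      from IH[OF this] have IH1: "?F (Color g) (occupants (p(g := None))) * x powi (M - j) = ?G (Color g) (p(g := None))"
        using div_site_step(2)[OF site T(2)] by (simp add: spin_gauge_def)
      \<comment> \<open>After entering in column j, color g still has j - M sites of its own to
        pass. Together with the prefactor \<open>x powi M\<close> of the row this is the charge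
        \<open>x powi j\<close> of \<open>vstep\<close>.\<close>
      have "x powi M = x powi (M - j) * x powi j" using x by (simp flip: power_int_add)
      then show ?thesis
        unfolding m using Plus True IH0 IH1[symmetric] by (simp add: vstep_def spin_gauge_def algebra_simps)
    next
      case False
      then show ?thesis
        unfolding m using IH0 Plus by (simp add: vstep_def spin_gauge_def)
    qed
  next
    case (Color h)
    then have h: "h < r" "p h = None" using step.prems by (auto simp: legal_def)
    show ?thesis
    proof (cases "h = g")
      case True
      have IH0: "?F a (occupants p) * x powi (M - j) = ?G a p"
        using IH[OF step.prems] div_site_step(2)[OF site h(1)] Color True by (simp add: spin_gauge_def)
      have "legal r Plus (p(g := Some j))" using step.prems T by (auto simp: legal_def)
      from IH[OF this] have IH1: "?F Plus (occupants (p(g := Some j))) * x powi M = ?G Plus (p(g := Some j))"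
        by (simp add: spin_gauge_def)
      have g: "spin_gauge r x M T a = x powi (M - 1 - j)"
        using Color True div_site_step(1)[OF site h(1)] by (simp add: spin_gauge_def)
      have 1: "x * x powi (M - 1 - j) = x powi (M - j)" "x * x powi (M - 1 - j) = x powi M * x powi (- j)"
        using x power_int_add[of x 1 "M - 1 - j"] power_int_add[of x M "- j"] by simp_all
      have "mono_op kind r x t (j, g) ?F a (occupants p) * spin_gauge r x M T a =
        ?F a (occupants p) * (x * x powi (M - 1 - j)) + (1 - t) * ?F Plus (occupants (p(g := Some j))) * (x * x powi (M - 1 - j))"
        unfolding m g using Color True by (simp add: algebra_simps)
      also have "\<dots> = ?F a (occupants p) * x powi (M - j) + (1 - t) * (?F Plus (occupants (p(g := Some j))) * x powi M) * x powi (- j)"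
        using 1 by (metis (no_types, lifting) mult.assoc)
      finally show ?thesis
        unfolding IH0 IH1 using Color True by (simp add: vstep_def algebra_simps)
    next
      case False
      have "spin_gauge r x M T a = spin_gauge r x M (T - 1) a"
        using Color False div_site_step[OF site h(1)] by (auto simp: spin_gauge_def)
      then show ?thesis
        unfolding m using IH[OF step.prems] Color False by (simp add: vstep_def mult.assoc)
    qed
  qed
  moreover have "interval_sites r (M * int r) (T' + 1) = (j, g) # interval_sites r (M * int r) T'"
    using step.hyps site T_def interval_sites_rec[of "M * int r" "T' + 1" r] by simp
  ultimately show ?case by (simp add: T_def)
qed

text \<open>The prefactor of the partition function, the M-th power of the product of all
  parameters, is distributed over the rows. This is what makes each row match the charges of
  \<open>vstep\<close>.\<close>

fun row_ops :: "weight_kind \<Rightarrow> nat \<Rightarrow> complex \<Rightarrow> int \<Rightarrow> int \<Rightarrow> (complex \<times> nat) list \<Rightarrow> (int \<Rightarrow> nat set) \<Rightarrow> complex" where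
  "row_ops kind r t M N [] v = (if v = (\<lambda>_. {}) then 1 else 0)"
| "row_ops kind r t M N ((x, d) # rws) v = x powi M *
     foldr (column_op kind r x t) (rev [M..N]) (\<lambda>a v. if a = Color d then row_ops kind r t M N rws v else 0) Plus v"

lemma column_op_cong:
  assumes "\<And>c D. c \<in> hspins r \<Longrightarrow> D \<subseteq> {..<r} \<Longrightarrow> F c (v(j := D)) = G c (v(j := D))"
  shows "column_op kind r x t j F a v = column_op kind r x t j G a v"
  unfolding column_op_def by (intro sum.cong refl) (use assms in auto)

lemma column_ops_eq:
  "a \<in> hspins r \<Longrightarrow> (\<And>j. v j \<subseteq> {..<r}) \<Longrightarrow>
   foldr (column_op kind r x t) js F a v = foldr (mono_op kind r x t) (concat (map (column_sites r) js)) F a v"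
proof (induction js arbitrary: a v)
  case (Cons j js)
  have "column_op kind r x t j (foldr (column_op kind r x t) js F) a v =
     column_op kind r x t j (foldr (mono_op kind r x t) (concat (map (column_sites r) js)) F) a v"
    by (rule column_op_cong, rule Cons.IH) (use Cons.prems in auto)
  also have "\<dots> = foldr (mono_op kind r x t) (column_sites r j) (foldr (mono_op kind r x t) (concat (map (column_sites r) js)) F) a v"
    by (rule column_op_eq) (use Cons.prems in auto)
  finally show ?case by simp
qed simp

lemma row_ops_rows_value:
  assumes t: "t \<noteq> 1" and "0 < r" and MN: "M \<le> N"
  shows "(\<And>x d. (x, d) \<in> set rws \<Longrightarrow> x \<noteq> 0 \<and> d < r) \<Longrightarrow> legal r Plus p \<Longrightarrow>
    row_ops kind r t M N rws (occupants p) = rows_value t (site_list r M N) rws p"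
proof (induction rws arbitrary: p)
  case Nil
  have "occupants p = (\<lambda>_. {}) \<longleftrightarrow> p = (\<lambda>_. None)"
  proof
    assume "occupants p = (\<lambda>_. {})"
    then have "p k \<noteq> Some j" for k j by (auto simp: occupants_def fun_eq_iff)
    then have "p k = None" for k by (cases "p k") auto
    then show "p = (\<lambda>_. None)" by auto
  qed (auto simp: occupants_def)
  then show ?case by simp
next
  case (Cons row rws)
  obtain x d where row: "row = (x, d)" by force
  then have x: "x \<noteq> 0" "d < r" using Cons.prems by auto
  let ?A = "M * int r" and ?B = "N * int r + int r - 1"
  let ?Fv = "\<lambda>a v. if a = Color d then row_ops kind r t M N rws v else 0"
  let ?Fp = "exit_right d (rows_value t (site_list r M N) rws)"
  have sl: "site_list r M N = interval_sites r ?A ?B" using site_list_conv[OF \<open>0 < r\<close>] MN by simp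
  have AB: "?A - 1 \<le> ?B"
  proof -
    have "M * int r \<le> N * int r" using MN by (intro mult_right_mono) auto
    then show ?thesis using \<open>0 < r\<close> by linarith
  qed
  have fin: "?Fv a (occupants p) * spin_gauge r x M (?A - 1) a = ?Fp a p" if "legal r a p" for a p
  proof (cases "a = Color d")
    case True
    \<comment> \<open>To the right of column M no site is left to cross, so the gauge of the exiting
      color is 1.\<close>
    have "site_of r (?A - 1) = (M - 1, r - 1)"
      using site_of_eq[of "r - 1" r "M - 1"] \<open>0 < r\<close> by (simp add: algebra_simps of_nat_diff)
    from div_site_step(1)[OF this \<open>d < r\<close>] have "spin_gauge r x M (?A - 1) a = 1"
      using True x by (simp add: spin_gauge_def)
    moreover have lg: "legal r Plus p" using that by (auto simp: legal_def)
    have "row_ops kind r t M N rws (occupants p) = rows_value t (site_list r M N) rws p"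
      by (rule Cons.IH[OF _ lg]) (use Cons.prems in auto)
    ultimately show ?thesis using True by (simp add: exit_right_def)
  qed (simp add: exit_right_def)
  have "row_ops kind r t M N (row # rws) (occupants p) =
    foldr (mono_op kind r x t) (interval_sites r ?A ?B) ?Fv Plus (occupants p) * x powi M"
  proof -
    have "foldr (column_op kind r x t) (rev [M..N]) ?Fv Plus (occupants p) =
      foldr (mono_op kind r x t) (site_list r M N) ?Fv Plus (occupants p)"
      unfolding site_list_def
    proof (rule column_ops_eq)
      show "occupants p j \<subseteq> {..<r}" for j
      proof
        fix k assume "k \<in> occupants p j"
        then show "k \<in> {..<r}" using Cons.prems(2) by (cases "k < r") (auto simp: occupants_def legal_def)
      qed
    qed (simp add: hspins_def)
    then show ?thesis by (simp add: row sl)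
  qed
  also have "\<dots> = sweep x t (interval_sites r ?A ?B) ?Fp Plus p"
    using gauge_sites[of r ?Fv x M ?Fp t ?B Plus p, OF fin x(1) t \<open>0 < r\<close> AB Cons.prems(2)] by (simp add: spin_gauge_def)
  finally show ?case by (simp add: row sl)
qed

section \<open>Summation over the columns of one row\<close>

lemma sum_PiE_insert:
  fixes f :: "('a \<Rightarrow> 'b) \<Rightarrow> 'c::comm_monoid_add"
  assumes "i \<notin> A"
  shows "sum f (insert i A \<rightarrow>\<^sub>E P) = (\<Sum>b\<in>P. \<Sum>g\<in>A \<rightarrow>\<^sub>E P. f (g(i := b)))"
proof -
  have "sum f (insert i A \<rightarrow>\<^sub>E P) = (\<Sum>(b, g)\<in>P \<times> (A \<rightarrow>\<^sub>E P). f (g(i := b)))"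
    by (rule sum.reindex_bij_witness[where i = "\<lambda>(b, g). g(i := b)" and j = "\<lambda>h. (h i, h(i := undefined))"])
       (use assms in \<open>auto simp: PiE_iff extensional_def fun_upd_idem_iff\<close>)
  then show ?thesis by (simp add: sum.cartesian_product)
qed

text \<open>Splitting off the leftmost column changes the left spin and the vertical data of the
  remaining ones, so the induction is carried out for all \<open>a\<close> and
  \<open>v\<close>.\<close>

lemma row_sum:
  assumes "M - 1 \<le> J" "c0 \<in> hspins r"
  shows "a \<in> hspins r \<Longrightarrow>
    (\<Sum>v'\<in>{M..J} \<rightarrow>\<^sub>E Pow {..<r}. \<Sum>h\<in>{h \<in> {M..J+1} \<rightarrow>\<^sub>E hspins r. h (J + 1) = a \<and> h M = c0}.
       (\<Prod>j\<in>{M..J}. colored_weight kind r x t (h (j + 1)) (mset_set (v j)) (h j) (mset_set (v' j))) *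
       G (\<lambda>j. if j \<in> {M..J} then v' j else v j)) =
    foldr (column_op kind r x t) (rev [M..J]) (\<lambda>a v. if a = c0 then G v else 0) a v"
  using assms(1)
proof (induction J arbitrary: a v rule: int_ge_induct)
  case base
  have "{h \<in> {M..M - 1 + 1} \<rightarrow>\<^sub>E hspins r. h (M - 1 + 1) = a \<and> h M = c0} = (if a = c0 then {\<lambda>i\<in>{M..M}. a} else {})"
    using base by (auto simp: PiE_iff extensional_def fun_eq_iff)
  then show ?case by (simp add: PiE_empty_domain)
next
  case (step J)
  let ?w = "\<lambda>v h v' j. colored_weight kind r x t (h (j + 1)) (mset_set (v j)) (h j) (mset_set (v' j))"
  let ?U = "\<lambda>J v v' j. if j \<in> {M..J} then v' j else v j"
  let ?Hs = "\<lambda>J a. {h \<in> {M..J+1} \<rightarrow>\<^sub>E hspins r. h (J + 1) = a \<and> h M = c0}"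
  have set_J: "{M..J+1} = insert (J + 1) {M..J}" "{M..J+1+1} = insert (J + 1 + 1) {M..J+1}" using step by auto
  have fin: "finite (?Hs J a)" for a
    by (rule finite_subset[of _ "{M..J+1} \<rightarrow>\<^sub>E hspins r"]) (auto intro: finite_PiE)
  have finS: "finite {h \<in> {M..J+1} \<rightarrow>\<^sub>E hspins r. h M = c0}"
    by (rule finite_subset[of _ "{M..J+1} \<rightarrow>\<^sub>E hspins r"]) (auto intro: finite_PiE)
  have h_split: "(\<Sum>h\<in>?Hs (J + 1) a. \<Phi> h) = (\<Sum>c\<in>hspins r. \<Sum>h\<in>?Hs J c. \<Phi> (h(J + 1 + 1 := a)))" for \<Phi> :: "(int \<Rightarrow> spin) \<Rightarrow> complex"
  proof -
    have "(\<Sum>h\<in>?Hs (J + 1) a. \<Phi> h) = (\<Sum>h\<in>{h \<in> {M..J+1} \<rightarrow>\<^sub>E hspins r. h M = c0}. \<Phi> (h(J + 1 + 1 := a)))"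
      by (rule sum.reindex_bij_witness[where i = "\<lambda>h. h(J + 1 + 1 := a)" and j = "\<lambda>h. h(J + 1 + 1 := undefined)"])
         (use step.hyps step.prems in \<open>auto simp: PiE_iff extensional_def\<close>)
    also have "\<dots> = (\<Sum>c\<in>hspins r. \<Sum>h\<in>{h \<in> {h \<in> {M..J+1} \<rightarrow>\<^sub>E hspins r. h M = c0}. h (J + 1) = c}. \<Phi> (h(J + 1 + 1 := a)))"
      by (rule sum.group[symmetric]) (use finS step.hyps in \<open>auto simp: PiE_iff\<close>)
    also have "\<dots> = (\<Sum>c\<in>hspins r. \<Sum>h\<in>?Hs J c. \<Phi> (h(J + 1 + 1 := a)))"
      by (intro sum.cong refl) auto
    finally show ?thesis .
  qed
  have v_split: "(\<Sum>v'\<in>{M..J+1} \<rightarrow>\<^sub>E Pow {..<r}. \<Phi> v') = (\<Sum>D\<in>Pow {..<r}. \<Sum>v'\<in>{M..J} \<rightarrow>\<^sub>E Pow {..<r}. \<Phi> (v'(J + 1 := D)))"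
    for \<Phi> :: "(int \<Rightarrow> nat set) \<Rightarrow> complex"
    unfolding set_J(1) by (rule sum_PiE_insert) simp
  have "(\<Sum>v'\<in>{M..J+1} \<rightarrow>\<^sub>E Pow {..<r}. \<Sum>h\<in>?Hs (J + 1) a. (\<Prod>j\<in>{M..J+1}. ?w v h v' j) * G (?U (J + 1) v v')) =
    (\<Sum>D\<in>Pow {..<r}. \<Sum>v'\<in>{M..J} \<rightarrow>\<^sub>E Pow {..<r}. \<Sum>c\<in>hspins r. \<Sum>h\<in>?Hs J c.
      (\<Prod>j\<in>{M..J+1}. ?w v (h(J + 1 + 1 := a)) (v'(J + 1 := D)) j) * G (?U (J + 1) v (v'(J + 1 := D))))"
    by (simp only: h_split v_split)
  also have "\<dots> = (\<Sum>D\<in>Pow {..<r}. \<Sum>v'\<in>{M..J} \<rightarrow>\<^sub>E Pow {..<r}. \<Sum>c\<in>hspins r. \<Sum>h\<in>?Hs J c.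
      colored_weight kind r x t a (mset_set (v (J + 1))) c (mset_set D) *
      ((\<Prod>j\<in>{M..J}. ?w (v(J + 1 := D)) h v' j) * G (?U J (v(J + 1 := D)) v')))"
  proof (intro sum.cong refl)
    fix D v' c h assume h: "h \<in> ?Hs J c"
    have "(\<Prod>j\<in>{M..J+1}. ?w v (h(J + 1 + 1 := a)) (v'(J + 1 := D)) j) =
       ?w v (h(J + 1 + 1 := a)) (v'(J + 1 := D)) (J + 1) * (\<Prod>j\<in>{M..J}. ?w v (h(J + 1 + 1 := a)) (v'(J + 1 := D)) j)"
      unfolding set_J(1) by (rule prod.insert) auto
    also have "(\<Prod>j\<in>{M..J}. ?w v (h(J + 1 + 1 := a)) (v'(J + 1 := D)) j) = (\<Prod>j\<in>{M..J}. ?w (v(J + 1 := D)) h v' j)"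
      by (intro prod.cong refl) auto
    also have "?w v (h(J + 1 + 1 := a)) (v'(J + 1 := D)) (J + 1) = colored_weight kind r x t a (mset_set (v (J + 1))) c (mset_set D)"
      using h by auto
    moreover have "?U (J + 1) v (v'(J + 1 := D)) = ?U J (v(J + 1 := D)) v'"
      using step.hyps by (auto simp: fun_eq_iff)
    ultimately show "(\<Prod>j\<in>{M..J+1}. ?w v (h(J + 1 + 1 := a)) (v'(J + 1 := D)) j) * G (?U (J + 1) v (v'(J + 1 := D))) =
      colored_weight kind r x t a (mset_set (v (J + 1))) c (mset_set D) *
      ((\<Prod>j\<in>{M..J}. ?w (v(J + 1 := D)) h v' j) * G (?U J (v(J + 1 := D)) v'))"
      by (simp only: mult.assoc)
  qed
  also have "\<dots> = (\<Sum>D\<in>Pow {..<r}. \<Sum>c\<in>hspins r.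
      colored_weight kind r x t a (mset_set (v (J + 1))) c (mset_set D) *
      (\<Sum>v'\<in>{M..J} \<rightarrow>\<^sub>E Pow {..<r}. \<Sum>h\<in>?Hs J c. (\<Prod>j\<in>{M..J}. ?w (v(J + 1 := D)) h v' j) * G (?U J (v(J + 1 := D)) v')))"
    unfolding sum_distrib_left by (intro sum.cong refl) (rule sum.swap)
  also have "\<dots> = (\<Sum>c\<in>hspins r. \<Sum>D\<in>Pow {..<r}.
      colored_weight kind r x t a (mset_set (v (J + 1))) c (mset_set D) *
      foldr (column_op kind r x t) (rev [M..J]) (\<lambda>a v. if a = c0 then G v else 0) c (v(J + 1 := D)))"
    by (subst sum.swap) (intro sum.cong refl, simp only: step.IH)
  also have "\<dots> = foldr (column_op kind r x t) (rev [M..J + 1]) (\<lambda>a v. if a = c0 then G v else 0) a v"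
    using step.hyps by (simp add: upto_rec2 column_op_def)
  finally show ?case .
qed

section \<open>Conservation of colors\<close>

definition carries :: "nat \<Rightarrow> spin \<Rightarrow> nat" where
  "carries k a = (if a = Color k then 1 else 0)"

lemma mono_weight_conserves:
  assumes "mono_weight kind x t l a b c d \<noteq> 0"
  shows "carries k a + (if l = k then b else 0) = carries k c + (if l = k then d else 0)"
proof (cases a)
  case Plus
  then show ?thesis using assms by (cases c) (simp_all add: carries_def mono_weight_def split: if_splits)
next
  case (Color h)
  then show ?thesis using assms by (cases c) (simp_all add: carries_def mono_weight_def split: if_splits)
qed

lemma colored_weight_conserves:
  assumes nz: "colored_weight kind r x t a b c d \<noteq> 0" and "k < r"
  shows "carries k a + count b k = carries k c + count d k"
proof -
  from sum.not_neutral_contains_not_neutral[OF nz[unfolded colored_weight_def]]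
  obtain s where s: "s r = a" "s 0 = c"
    and "(\<Prod>l<r. mono_weight kind x t l (s (Suc l)) (count b l) (s l) (count d l)) \<noteq> 0" by blast
  then have l: "mono_weight kind x t l (s (Suc l)) (count b l) (s l) (count d l) \<noteq> 0" if "l < r" for l
    using that by auto
  define X where "X m = carries k (s m)" for m
  have step: "X (Suc m) + (if m = k then count b m else 0) = X m + (if m = k then count d m else 0)" if "m < r" for m
    using mono_weight_conserves[OF l[OF that], of k] by (simp only: X_def)
  \<comment> \<open>The horizontal contributions telescope, and color k meets vertical edges only at
    its own vertex.\<close>
  have "m \<le> r \<Longrightarrow> X m + (if k < m then count b k else 0) = X 0 + (if k < m then count d k else 0)" for m
  proof (induction m)
    case (Suc m)
    then show ?case
      using step[of m] by (cases k m rule: linorder_cases) simp_all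
  qed simp
  from this[of r] show ?thesis using \<open>k < r\<close> s by (simp add: X_def)
qed

definition state_weight where
  "state_weight kind r M N x t H V = (\<Prod>i<r. \<Prod>j\<in>{M..N}.
     colored_weight kind r (x i) t (H (i, j + 1)) (V (i, j)) (H (i, j)) (V (Suc i, j)))"

text \<open>No color enters from the left, so by conservation a row can only lower the multiplicity
  of a color; at the top it is at most 1 because c is injective.\<close>

lemma state_counts:
  assumes st: "(H, V) \<in> states r M N \<mu> c d" and nz: "state_weight kind r M N x t H V \<noteq> 0"
    and c: "inj_on c {..<r}" and MN: "M \<le> N" and k: "k < r"
  shows "i \<le> r \<Longrightarrow> (\<Sum>j\<in>{M..N}. count (V (i, j)) k) \<le> 1"
proof (induction i)
  case 0
  have "count (top_boundary r \<mu> c j) k = card {i. i < r \<and> \<mu> i = j \<and> c i = k}" for j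
  proof -
    let ?A = "{i. i < r \<and> \<mu> i = j}"
    have "count (top_boundary r \<mu> c j) k = (\<Sum>i\<in>c -` {k} \<inter> ?A. count (mset_set ?A) i)"
      by (simp add: top_boundary_def count_image_mset)
    also have "\<dots> = (\<Sum>i\<in>c -` {k} \<inter> ?A. 1)" by (intro sum.cong refl) auto
    also have "\<dots> = card (c -` {k} \<inter> ?A)" by simp
    also have "c -` {k} \<inter> ?A = {i. i < r \<and> \<mu> i = j \<and> c i = k}" by auto
    finally show ?thesis .
  qed
  then have "(\<Sum>j\<in>{M..N}. count (V (0, j)) k) = (\<Sum>j\<in>{M..N}. card {i. i < r \<and> \<mu> i = j \<and> c i = k})"
    using st by (auto simp: states_def)
  also have "\<dots> = card (\<Union>j\<in>{M..N}. {i. i < r \<and> \<mu> i = j \<and> c i = k})"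
    by (rule card_UN_disjoint[symmetric]) auto
  also have "\<dots> \<le> card {i. i < r \<and> c i = k}" by (intro card_mono) auto
  also have "\<dots> \<le> 1"
    unfolding One_nat_def by (subst card_le_Suc0_iff_eq) (use c in \<open>auto simp: inj_on_def\<close>)
  finally show ?case .
next
  case (Suc i)
  have cons: "carries k (H (i, j + 1)) + count (V (i, j)) k = carries k (H (i, j)) + count (V (Suc i, j)) k"
    if "j \<in> {M..N}" for j
    by (rule colored_weight_conserves[of kind r "x i" t, OF _ k]) (use nz Suc.prems that in \<open>auto simp: state_weight_def\<close>)
  \<comment> \<open>Conservation is summed over the columns, so that only the outermost horizontal
    edges survive.\<close>
  have "M - 1 \<le> J \<Longrightarrow> J \<le> N \<Longrightarrow> carries k (H (i, J + 1)) + (\<Sum>j\<in>{M..J}. count (V (i, j)) k) =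
     carries k (H (i, M)) + (\<Sum>j\<in>{M..J}. count (V (Suc i, j)) k)" for J
  proof (induction J rule: int_ge_induct)
    case (step J)
    have "{M..J + 1} = insert (J + 1) {M..J}" using step.hyps by auto
    then show ?case using step.IH step.prems step.hyps cons[of "J + 1"] by simp
  qed simp
  from this[of N] have "(\<Sum>j\<in>{M..N}. count (V (Suc i, j)) k) \<le> (\<Sum>j\<in>{M..N}. count (V (i, j)) k)"
    using st Suc.prems MN by (auto simp: states_def carries_def)
  then show ?case using Suc by simp
qed

text \<open>States are defined on the window only, whereas the row operators act on families indexed
  by all columns; outside the window no color is present.\<close>

definition zero_extend :: "int \<Rightarrow> int \<Rightarrow> (int \<Rightarrow> nat set) \<Rightarrow> int \<Rightarrow> nat set" where
  "zero_extend M N v = (\<lambda>j. if j \<in> {M..N} then v j else {})"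

definition row_weight where
  "row_weight kind r M N x t d v v' =
     (\<Sum>h\<in>{h \<in> {M..N+1} \<rightarrow>\<^sub>E hspins r. h (N + 1) = Plus \<and> h M = Color d}.
       \<Prod>j\<in>{M..N}. colored_weight kind r x t (h (j + 1)) (mset_set (v j)) (h j) (mset_set (v' j)))"

lemma row_weight_cong:
  assumes "\<And>j. M \<le> j \<Longrightarrow> j \<le> N \<Longrightarrow> v j = u j" "\<And>j. M \<le> j \<Longrightarrow> j \<le> N \<Longrightarrow> v' j = u' j"
  shows "row_weight kind r M N x t d v v' = row_weight kind r M N x t d u u'"
  unfolding row_weight_def by (intro sum.cong prod.cong refl) (use assms in auto)

lemma row_ops_Cons:
  assumes "d < r" "M \<le> N"
  shows "row_ops kind r t M N ((x, d) # rws) (zero_extend M N v) =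
    (\<Sum>v'\<in>{M..N} \<rightarrow>\<^sub>E Pow {..<r}. x powi M * row_weight kind r M N x t d v v' * row_ops kind r t M N rws (zero_extend M N v'))"
proof -
  let ?v = "zero_extend M N v"
  have 1: "(\<Sum>v'\<in>{M..N} \<rightarrow>\<^sub>E Pow {..<r}. \<Sum>h\<in>{h \<in> {M..N+1} \<rightarrow>\<^sub>E hspins r. h (N + 1) = Plus \<and> h M = Color d}.
       (\<Prod>j\<in>{M..N}. colored_weight kind r x t (h (j + 1)) (mset_set (?v j)) (h j) (mset_set (v' j))) *
       row_ops kind r t M N rws (\<lambda>j. if j \<in> {M..N} then v' j else ?v j)) =
     foldr (column_op kind r x t) (rev [M..N]) (\<lambda>a v. if a = Color d then row_ops kind r t M N rws v else 0) Plus ?v"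
    by (rule row_sum) (use assms in \<open>auto simp: hspins_def\<close>)
  have 2: "(\<lambda>j. if j \<in> {M..N} then v' j else ?v j) = zero_extend M N v'" for v'
    by (auto simp: zero_extend_def fun_eq_iff)
  have 3: "row_weight kind r M N x t d ?v v' = row_weight kind r M N x t d v v'" for v'
    by (rule row_weight_cong) (auto simp: zero_extend_def)
  have eq: "(\<Sum>v'\<in>{M..N} \<rightarrow>\<^sub>E Pow {..<r}. row_weight kind r M N x t d v v' * row_ops kind r t M N rws (zero_extend M N v')) =
      foldr (column_op kind r x t) (rev [M..N]) (\<lambda>a v. if a = Color d then row_ops kind r t M N rws v else 0) Plus ?v"
    (is "?L = ?R")
  proof -
    have "?L = (\<Sum>v'\<in>{M..N} \<rightarrow>\<^sub>E Pow {..<r}. row_weight kind r M N x t d ?v v' * row_ops kind r t M N rws (\<lambda>j. if j \<in> {M..N} then v' j else ?v j))"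
      by (intro sum.cong refl) (simp only: 2 3)
    also have "\<dots> = ?R"
      unfolding row_weight_def sum_distrib_right by (rule 1)
    finally show ?thesis .
  qed
  show ?thesis
    unfolding row_ops.simps eq[symmetric] sum_distrib_left mult.assoc by (rule refl)
qed

text \<open>Composing the row operators amounts to summing over the vertical spins below level m.
  The spins at level m are given, hence the case distinction, and the empty bottom boundary enters
  as a factor 0 or 1.\<close>

lemma row_ops_chain:
  assumes d: "\<And>i. i < r \<Longrightarrow> d i < r" and MN: "M \<le> N"
  shows "m \<le> n \<Longrightarrow> n \<le> r \<Longrightarrow>
    (\<Sum>V\<in>{m<..n} \<rightarrow>\<^sub>E ({M..N} \<rightarrow>\<^sub>E Pow {..<r}).
       (\<Prod>i\<in>{m..<n}. x i powi M * row_weight kind r M N (x i) t (d i) (if i = m then v else V i) (V (Suc i))) *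
       of_bool (zero_extend M N (if m = n then v else V n) = (\<lambda>_. {}))) =
    row_ops kind r t M N (map (\<lambda>i. (x i, d i)) [m..<n]) (zero_extend M N v)"
proof (induction m arbitrary: v rule: inc_induct)
  case base
  then show ?case by simp
next
  case (step m)
  let ?P = "{M..N} \<rightarrow>\<^sub>E Pow {..<r}"
  let ?R = "\<lambda>i v v'. x i powi M * row_weight kind r M N (x i) t (d i) v v'"
  let ?z = "\<lambda>v. of_bool (zero_extend M N v = (\<lambda>_. {})) :: complex"
  have set: "{m<..n} = insert (Suc m) {Suc m<..n}" using step.hyps by auto
  have ivl: "{m..<n} = insert m {Suc m..<n}" using step.hyps by auto
  have "(\<Sum>V\<in>{m<..n} \<rightarrow>\<^sub>E ?P. (\<Prod>i\<in>{m..<n}. ?R i (if i = m then v else V i) (V (Suc i))) * ?z (if m = n then v else V n)) =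
    (\<Sum>v'\<in>?P. \<Sum>V\<in>{Suc m<..n} \<rightarrow>\<^sub>E ?P. ?R m v v' *
      ((\<Prod>i\<in>{Suc m..<n}. ?R i (if i = Suc m then v' else V i) (V (Suc i))) * ?z (if Suc m = n then v' else V n)))"
    unfolding set sum_PiE_insert[of "Suc m" "{Suc m<..n}", simplified]
  proof (intro sum.cong refl)
    fix v' and V :: "nat \<Rightarrow> int \<Rightarrow> nat set"
    let ?V = "V(Suc m := v')"
    have "(\<Prod>i\<in>{m..<n}. ?R i (if i = m then v else ?V i) (?V (Suc i))) =
       ?R m v v' * (\<Prod>i\<in>{Suc m..<n}. ?R i (if i = m then v else ?V i) (?V (Suc i)))"
      unfolding ivl by (subst prod.insert) auto
    also have "(\<Prod>i\<in>{Suc m..<n}. ?R i (if i = m then v else ?V i) (?V (Suc i))) =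
      (\<Prod>i\<in>{Suc m..<n}. ?R i (if i = Suc m then v' else V i) (V (Suc i)))"
      by (intro prod.cong refl) auto
    finally show "(\<Prod>i\<in>{m..<n}. ?R i (if i = m then v else ?V i) (?V (Suc i))) * ?z (if m = n then v else ?V n) =
      ?R m v v' * ((\<Prod>i\<in>{Suc m..<n}. ?R i (if i = Suc m then v' else V i) (V (Suc i))) * ?z (if Suc m = n then v' else V n))"
      using step.hyps by (simp only: mult.assoc) simp
  qed
  also have "\<dots> = (\<Sum>v'\<in>?P. ?R m v v' * row_ops kind r t M N (map (\<lambda>i. (x i, d i)) [Suc m..<n]) (zero_extend M N v'))"
    unfolding sum_distrib_left[symmetric] by (intro sum.cong refl arg_cong[where f = "\<lambda>u. _ * u"] step.IH step.prems)
  also have "\<dots> = row_ops kind r t M N (map (\<lambda>i. (x i, d i)) [m..<n]) (zero_extend M N v)"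
    using step.hyps step.prems row_ops_Cons[OF d MN, of m kind t "x m" "map (\<lambda>i. (x i, d i)) [Suc m..<n]" v]
    by (simp add: upt_conv_Cons)
  finally show ?case .
qed

lemma mset_set_of_count_le_1:
  assumes "\<And>k. count B k \<le> 1"
  shows "mset_set (set_mset B) = B"
proof (rule multiset_eqI)
  fix k
  show "count (mset_set (set_mset B)) k = count B k"
    using assms[of k] by (cases "k \<in># B") (auto simp: count_mset_set' count_eq_zero_iff le_Suc_eq)
qed

definition top_set :: "nat \<Rightarrow> (nat \<Rightarrow> int) \<Rightarrow> (nat \<Rightarrow> nat) \<Rightarrow> int \<Rightarrow> nat set" where
  "top_set r \<mu> c j = c ` {i. i < r \<and> \<mu> i = j}"

text \<open>States of nonzero weight have sets as vertical spins. There are finitely many of these,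
  and each amounts to a choice of sets at the levels below the top together with a word of
  horizontal spins for each row, so the sum factors into row weights.\<close>

lemma partition_function_row_ops:
  assumes "0 < r" "M \<le> N" and c: "inj_on c {..<r}" "\<And>i. i < r \<Longrightarrow> c i < r" and d: "\<And>i. i < r \<Longrightarrow> d i < r"
  shows "partition_function kind r M N \<mu> c d x t =
    row_ops kind r t M N (map (\<lambda>i. (x i, d i)) [0..<r]) (zero_extend M N (top_set r \<mu> c))"
proof -
  let ?T = "top_set r \<mu> c"
  let ?P = "{M..N} \<rightarrow>\<^sub>E Pow {..<r}"
  let ?Hs = "\<lambda>i. {h \<in> {M..N+1} \<rightarrow>\<^sub>E hspins r. h (N + 1) = Plus \<and> h M = Color (d i)}"
  let ?Vs = "{V \<in> {0<..r} \<rightarrow>\<^sub>E ?P. zero_extend M N (V r) = (\<lambda>_. {})}"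
  let ?W = "state_weight kind r M N x t"
  define S where "S = {(H, V) \<in> states r M N \<mu> c d. \<forall>i\<le>r. \<forall>j\<in>{M..N}. mset_set (set_mset (V (i, j))) = V (i, j)}"
  \<comment> \<open>The top level is prescribed by the boundary, so \<open>Vf\<close> records the
    levels 1, ..., r only.\<close>
  define low where "low = (\<lambda>V i. if i = (0::nat) then ?T else V i)"
  define enc :: "(nat \<Rightarrow> int \<Rightarrow> nat set) \<times> (nat \<Rightarrow> int \<Rightarrow> spin) \<Rightarrow> (nat \<times> int \<Rightarrow> spin) \<times> (nat \<times> int \<Rightarrow> nat multiset)"
    where "enc = (\<lambda>(Vf, Hf). (\<lambda>(i, j)\<in>{..<r} \<times> {M..N+1}. Hf i j, \<lambda>(i, j)\<in>{..r} \<times> {M..N}. mset_set (low Vf i j)))"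
  define dec :: "(nat \<times> int \<Rightarrow> spin) \<times> (nat \<times> int \<Rightarrow> nat multiset) \<Rightarrow> _" where "dec = (\<lambda>(H, V). (\<lambda>i\<in>{0<..r}. \<lambda>j\<in>{M..N}. set_mset (V (i, j)), \<lambda>i\<in>{..<r}. \<lambda>j\<in>{M..N+1}. H (i, j)))"
  have finHs: "finite (?Hs i)" for i
    by (rule finite_subset[of _ "{M..N+1} \<rightarrow>\<^sub>E hspins r"]) (auto intro: finite_PiE)
  have finVs: "finite ?Vs"
    by (rule finite_subset[of _ "{0<..r} \<rightarrow>\<^sub>E ?P"]) (auto intro!: finite_PiE)
  have top: "top_boundary r \<mu> c j = mset_set (?T j)" for j
    unfolding top_boundary_def top_set_def
    by (rule image_mset_mset_set) (rule inj_on_subset[OF c(1)], auto)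
  have T: "?T j \<subseteq> {..<r}" "finite (?T j)" for j using c(2) by (auto simp: top_set_def)
  have finV: "finite (V i j)" if "V \<in> ?Vs" "i \<in> {0<..r}" "j \<in> {M..N}" for V i j
  proof -
    have "V i j \<in> Pow {..<r}" using that by (auto simp: PiE_iff)
    then show ?thesis by (auto intro: finite_subset)
  qed
  have V_zero: "Vf r j = {}" if "Vf \<in> ?Vs" "j \<in> {M..N}" for Vf j
  proof -
    have "zero_extend M N (Vf r) j = {}" using that by simp
    then show ?thesis using that by (simp add: zero_extend_def)
  qed
  define D where "D = ?Vs \<times> PiE {..<r} ?Hs"
  define w where "w = (\<lambda>(H, V). ?W H V)"
  have 1: "enc s \<in> S" "dec (enc s) = s" if "s \<in> D" for s
  proof -
    obtain Vf Hf where s: "s = (Vf, Hf)" by force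
    then have V: "Vf \<in> ?Vs" and H: "Hf \<in> PiE {..<r} ?Hs" using that by (auto simp: D_def)
    have Vsub: "Vf i j \<subseteq> {..<r}" if "i \<in> {0<..r}" "j \<in> {M..N}" for i j
      using V that by (auto simp: PiE_iff)
    have lw: "low Vf i j \<subseteq> {..<r}" "finite (low Vf i j)" if "i \<le> r" "j \<in> {M..N}" for i j
      using Vsub[of i j] finV[OF V, of i j] T[of j] that by (auto simp: low_def)
    have 11: "(\<lambda>(i, j)\<in>{..<r} \<times> {M..N+1}. Hf i j) \<in> {..<r} \<times> {M..N + 1} \<rightarrow>\<^sub>E hspins r"
      using H by (auto simp: PiE_iff)
    have 12: "(\<lambda>(i, j)\<in>{..r} \<times> {M..N}. mset_set (low Vf i j)) \<in> {..r} \<times> {M..N} \<rightarrow>\<^sub>E vspins r"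
    proof -
      have "mset_set (low Vf i j) \<in> vspins r" if "i \<le> r" "j \<in> {M..N}" for i j
        using lw[OF that] by (simp add: vspins_def)
      then show ?thesis by auto
    qed
    have 13: "Hf i (N + 1) = Plus" "Hf i M = Color (d i)" if "i < r" for i
      using H that by (auto simp: PiE_iff)
    show "enc s \<in> S"
    proof -
      have "low Vf 0 j = ?T j" "j \<in> {M..N} \<Longrightarrow> low Vf r j = {}" for j
        using V_zero[OF V, of j] \<open>0 < r\<close> by (simp_all add: low_def)
      then have "enc s \<in> states r M N \<mu> c d"
        using 11 12 13 \<open>M \<le> N\<close> unfolding s states_def by (simp add: top enc_def)
      moreover have "mset_set (set_mset (mset_set (low Vf i j))) = mset_set (low Vf i j)"
        if "i \<le> r" "j \<in> {M..N}" for i j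
        using lw[OF that] by simp
      ultimately show ?thesis unfolding s by (simp add: S_def enc_def)
    qed
    have "(\<lambda>i\<in>{..<r}. \<lambda>j\<in>{M..N+1}. Hf i j) = Hf"
      using H by (auto simp: PiE_iff extensional_def fun_eq_iff)
    moreover have "(\<lambda>i\<in>{0<..r}. \<lambda>j\<in>{M..N}. set_mset (mset_set (low Vf i j))) = Vf"
    proof -
      have "set_mset (mset_set (low Vf i j)) = Vf i j" if "i \<in> {0<..r}" "j \<in> {M..N}" for i j
        using lw[of i j] that by (simp add: low_def)
      then have "(\<lambda>j\<in>{M..N}. set_mset (mset_set (low Vf i j))) = Vf i" if "i \<in> {0<..r}" for i
        using V that by (auto simp: PiE_iff extensional_def fun_eq_iff)
      then show ?thesis using V by (auto simp: PiE_iff extensional_def fun_eq_iff)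
    qed
    moreover have "dec (enc s) = (\<lambda>i\<in>{0<..r}. \<lambda>j\<in>{M..N}. set_mset (mset_set (low Vf i j)), \<lambda>i\<in>{..<r}. \<lambda>j\<in>{M..N+1}. Hf i j)"
      unfolding s by (auto simp: fun_eq_iff enc_def dec_def)
    ultimately show "dec (enc s) = s" unfolding s by (simp only:)
  qed
  have 2: "dec s \<in> D" "enc (dec s) = s" if "s \<in> S" for s
  proof -
    obtain H V where s: "s = (H, V)" by force
    then have st: "(H, V) \<in> states r M N \<mu> c d" and V: "\<And>i j. i \<le> r \<Longrightarrow> j \<in> {M..N} \<Longrightarrow> mset_set (set_mset (V (i, j))) = V (i, j)"
      using that by (auto simp: S_def)
    have H1: "H \<in> {..<r} \<times> {M..N + 1} \<rightarrow>\<^sub>E hspins r" and V1: "V \<in> {..r} \<times> {M..N} \<rightarrow>\<^sub>E vspins r"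
      and B: "\<And>i. i < r \<Longrightarrow> H (i, N + 1) = Plus \<and> H (i, M) = Color (d i)"
        "\<And>j. j \<in> {M..N} \<Longrightarrow> V (0, j) = top_boundary r \<mu> c j \<and> V (r, j) = {#}"
      using st by (auto simp: states_def)
    have "set_mset (V (i, j)) \<subseteq> {..<r}" if "i \<le> r" "j \<in> {M..N}" for i j
      using V1 that by (auto simp: PiE_iff vspins_def)
    then have "(\<lambda>i\<in>{0<..r}. \<lambda>j\<in>{M..N}. set_mset (V (i, j))) \<in> ?Vs"
      using B(2) \<open>0 < r\<close> by (auto simp: zero_extend_def fun_eq_iff)
    moreover have "(\<lambda>i\<in>{..<r}. \<lambda>j\<in>{M..N+1}. H (i, j)) \<in> PiE {..<r} ?Hs"
      using H1 B(1) \<open>M \<le> N\<close> by (auto simp: PiE_iff)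
    ultimately show "dec s \<in> D" by (simp add: s dec_def D_def)
    have "(\<lambda>(i, j)\<in>{..<r} \<times> {M..N+1}. H (i, j)) = H"
      using PiE_arb[OF H1] by (auto simp: fun_eq_iff)
    moreover have "(\<lambda>(i, j)\<in>{..r} \<times> {M..N}. mset_set (low (\<lambda>i j. set_mset (V (i, j))) i j)) = V"
    proof
      fix ij
      show "(\<lambda>(i, j)\<in>{..r} \<times> {M..N}. mset_set (low (\<lambda>i j. set_mset (V (i, j))) i j)) ij = V ij"
      proof (cases "ij \<in> {..r} \<times> {M..N}")
        case True
        then obtain i j where "ij = (i, j)" "i \<le> r" "j \<in> {M..N}" by auto
        then show ?thesis using V[of i j] B(2)[of j] by (simp add: low_def top)
      next
        case False
        then show ?thesis using PiE_arb[OF V1 False] by simp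
      qed
    qed
    moreover have "enc (dec s) = (\<lambda>(i, j)\<in>{..<r} \<times> {M..N+1}. H (i, j),
        \<lambda>(i, j)\<in>{..r} \<times> {M..N}. mset_set (low (\<lambda>i j. set_mset (V (i, j))) i j))"
      unfolding s by (auto simp: fun_eq_iff low_def enc_def dec_def)
    ultimately show "enc (dec s) = s" unfolding s by (simp only:)
  qed

  have bij: "sum w S = (\<Sum>s\<in>D. w (enc s))"
  proof (rule sum.reindex_bij_witness[where i = enc and j = dec])
    show "w (enc (dec s)) = w s" if "s \<in> S" for s by (simp only: 2(2)[OF that])
  qed (fact 1 2)+
  have finD: "finite D"
    unfolding D_def by (intro finite_cartesian_product finVs finite_PiE finHs finite_lessThan)
  have "S \<subseteq> enc ` D"
  proof
    fix s assume s: "s \<in> S"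
    from 2(2)[OF this] have "s = enc (dec s)" by simp
    then show "s \<in> enc ` D" using 2(1)[OF s] by (rule image_eqI)
  qed
  then have fin_S: "finite S"
    by (rule finite_subset) (intro finite_imageI finD)
  have "infsum w (states r M N \<mu> c d) = infsum w S"
  proof (rule infsum_cong_neutral)
    fix s assume s: "s \<in> states r M N \<mu> c d - S"
    obtain H V where HV: "s = (H, V)" by force
    \<comment> \<open>Outside \<open>S\<close> some color occurs more than once on an edge, which
      conservation of colors excludes for nonzero weight.\<close>
    have "?W H V = 0"
    proof (rule ccontr)
      assume nz: "?W H V \<noteq> 0"
      have st: "(H, V) \<in> states r M N \<mu> c d" using s HV by auto
      have "mset_set (set_mset (V (i, j))) = V (i, j)" if "i \<le> r" "j \<in> {M..N}" for i j
      proof (rule mset_set_of_count_le_1)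
        fix k
        show "count (V (i, j)) k \<le> 1"
        proof (cases "k < r")
          case True
          have "count (V (i, j)) k \<le> (\<Sum>j\<in>{M..N}. count (V (i, j)) k)"
            by (rule member_le_sum[of j "{M..N}" "\<lambda>j. count (V (i, j)) k"]) (use that in auto)
          also have "\<dots> \<le> 1" by (rule state_counts[OF st nz c(1) \<open>M \<le> N\<close> True \<open>i \<le> r\<close>])
          finally show ?thesis .
        next
          case False
          have "set_mset (V (i, j)) \<subseteq> {..<r}" using st that by (auto simp: states_def PiE_iff vspins_def)
          then have "k \<notin># V (i, j)" using False by auto
          then show ?thesis by (simp add: not_in_iff)
        qed
      qed
      then show False using s HV by (auto simp: S_def)
    qed
    then show "w s = 0" using HV by (simp add: w_def)
  qed (auto simp: S_def)
  also have "\<dots> = (\<Sum>s\<in>D. w (enc s))"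
    using fin_S bij by simp
  also have "\<dots> = (\<Sum>Vf\<in>?Vs. \<Sum>Hf\<in>PiE {..<r} ?Hs. \<Prod>i<r. \<Prod>j\<in>{M..N}.
      colored_weight kind r (x i) t (Hf i (j + 1)) (mset_set (low Vf i j)) (Hf i j) (mset_set (Vf (Suc i) j)))"
    unfolding sum.cartesian_product D_def
  proof (intro sum.cong refl)
    fix s :: "(nat \<Rightarrow> int \<Rightarrow> nat set) \<times> (nat \<Rightarrow> int \<Rightarrow> spin)"
    obtain Vf Hf where s: "s = (Vf, Hf)" by force
    show "w (enc s) = (case s of (Vf, Hf) \<Rightarrow> \<Prod>i<r. \<Prod>j\<in>{M..N}.
        colored_weight kind r (x i) t (Hf i (j + 1)) (mset_set (low Vf i j)) (Hf i j) (mset_set (Vf (Suc i) j)))"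
      unfolding s w_def state_weight_def by (simp add: enc_def, intro prod.cong refl) (auto simp: low_def)
  qed
  \<comment> \<open>For fixed vertical spins the horizontal spins of different rows are independent,
    so summing over them gives a product.\<close>
  also have "\<dots> = (\<Sum>Vf\<in>?Vs. \<Prod>i<r. row_weight kind r M N (x i) t (d i) (low Vf i) (Vf (Suc i)))"
    unfolding row_weight_def by (intro sum.cong refl prod_sum_PiE[symmetric] finHs finite_lessThan)
  finally have "partition_function kind r M N \<mu> c d x t = (\<Prod>i<r. x i) powi M *
      (\<Sum>Vf\<in>?Vs. \<Prod>i<r. row_weight kind r M N (x i) t (d i) (low Vf i) (Vf (Suc i)))"
    by (simp add: partition_function_def state_weight_def w_def)
  also have "\<dots> = (\<Sum>Vf\<in>?Vs. \<Prod>i<r. x i powi M * row_weight kind r M N (x i) t (d i) (low Vf i) (Vf (Suc i)))"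
  proof -
    have "(\<Prod>i\<in>A. x i) powi M = (\<Prod>i\<in>A. x i powi M)" if "finite A" for A
      using that by induction (simp_all add: power_int_mult_distrib)
    then show ?thesis by (simp add: sum_distrib_left prod.distrib)
  qed
  \<comment> \<open>The condition that the bottom edges be empty moves from the range of summation
    into a factor, the form required by \<open>row_ops_chain\<close>.\<close>
  also have "\<dots> = (\<Sum>Vf\<in>{0<..r} \<rightarrow>\<^sub>E ?P.
       (\<Prod>i\<in>{0..<r}. x i powi M * row_weight kind r M N (x i) t (d i) (if i = 0 then ?T else Vf i) (Vf (Suc i))) *
       of_bool (zero_extend M N (if 0 = r then ?T else Vf r) = (\<lambda>_. {})))"
    by (rule sum.mono_neutral_cong_left) (use \<open>0 < r\<close> in \<open>auto intro!: finite_PiE simp: atLeast0LessThan low_def\<close>)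
  also have "\<dots> = row_ops kind r t M N (map (\<lambda>i. (x i, d i)) [0..<r]) (zero_extend M N ?T)"
    by (rule row_ops_chain) (use d \<open>M \<le> N\<close> in auto)
  finally show ?thesis .
qed

section \<open>Recursions for the partition function\<close>

text \<open>The top boundary without reference to \<open>y\<close>: entry i of the flag has color r
  - 1 - m and \<open>\<mu>\<close> has the value \<open>- lam m\<close> there, both for the same m,
  the preimage of i under \<open>y\<close>.\<close>

definition color_config :: "nat \<Rightarrow> (nat \<Rightarrow> int) \<Rightarrow> config" where
  "color_config r lam g = (if g < r then Some (- lam (r - 1 - g)) else None)"

definition row_data :: "nat \<Rightarrow> (nat \<Rightarrow> complex) \<Rightarrow> (nat \<Rightarrow> nat) \<Rightarrow> (complex \<times> nat) list" where
  "row_data r z w = map (\<lambda>i. (inverse (z i), r - 1 - inv_into UNIV w i)) [0..<r]"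

definition lattice_value :: "nat \<Rightarrow> complex \<Rightarrow> (nat \<Rightarrow> complex) \<Rightarrow> (nat \<Rightarrow> int) \<Rightarrow> (nat \<Rightarrow> nat) \<Rightarrow> complex" where
  "lattice_value r t z lam w =
     rows_value t (site_list r (- (\<Sum>i<r. \<bar>lam i\<bar>)) (\<Sum>i<r. \<bar>lam i\<bar>)) (row_data r z w) (color_config r lam)"

lemma color_config_window:
  assumes "0 < r" "\<And>i. i < r \<Longrightarrow> M \<le> - lam i \<and> - lam i \<le> N"
  shows "in_window r (M * int r) (N * int r + int r - 1) (color_config r lam)"
  unfolding in_window_def
proof (intro allI impI)
  fix g j assume "color_config r lam g = Some j"
  then have g: "g < r" "j = - lam (r - 1 - g)" by (auto simp: color_config_def split: if_splits)
  then have "M \<le> j" "j \<le> N" using assms by auto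
  then have "M * int r \<le> j * int r" "j * int r \<le> N * int r" by (auto intro: mult_right_mono)
  then show "g < r \<and> M * int r \<le> j * int r + int g \<and> j * int r + int g \<le> N * int r + int r - 1"
    using g by linarith
qed

lemma lattice_value_window:
  assumes r: "0 < r" and MN: "\<And>i. i < r \<Longrightarrow> M \<le> - lam i \<and> - lam i \<le> N"
  shows "rows_value t (site_list r M N) (row_data r z w) (color_config r lam) = lattice_value r t z lam w"
proof -
  define b where "b = (\<Sum>i<r. \<bar>lam i\<bar>)"
  have b: "- b \<le> - lam i \<and> - lam i \<le> b" if "i < r" for i
    using member_le_sum[of i "{..<r}" "\<lambda>i. \<bar>lam i\<bar>"] that by (auto simp: b_def)
  \<comment> \<open>Both windows are compared with their intersection, which still contains every
    occupied column.\<close>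
  define M' N' where "M' = max M (- b)" and "N' = min N b"
  have MN': "M' \<le> - lam i \<and> - lam i \<le> N'" if "i < r" for i using MN[OF that] b[OF that] by (auto simp: M'_def N'_def)
  have le: "M' \<le> N'" using MN'[OF r] by linarith
  have w: "in_window r (M' * int r) (N' * int r + int r - 1) (color_config r lam)"
    by (rule color_config_window[OF r MN'])
  have AB: "M' * int r \<le> N' * int r + int r - 1"
  proof -
    have "M' * int r \<le> N' * int r" using le by (intro mult_right_mono) auto
    then show ?thesis using r by linarith
  qed
  have eq: "rows_value t (site_list r M1 N1) (row_data r z w) (color_config r lam) =
      rows_value t (interval_sites r (M' * int r) (N' * int r + int r - 1)) (row_data r z w) (color_config r lam)"
    if "M1 \<le> M'" "N' \<le> N1" for M1 N1
  proof -
    have "M1 * int r \<le> M' * int r" "N' * int r \<le> N1 * int r" using that by (auto intro: mult_right_mono)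
    then show ?thesis
      using site_list_conv[OF r, of M1 N1] that le rows_value_window[OF w r, of "M1 * int r" "N1 * int r + int r - 1" t "row_data r z w"] AB
      by simp
  qed
  show ?thesis
    unfolding lattice_value_def b_def[symmetric]
    using eq[of M N] eq[of "- b" b] by (simp add: M'_def N'_def)
qed

lemma partition_function_lattice_value:
  assumes r: "0 < r" and t: "t \<noteq> 1" and z: "\<And>i. i < r \<Longrightarrow> z i \<noteq> 0"
    and y: "y permutes {..<r}" and anti: "antidominant r (act y lam)" and w: "w permutes {..<r}"
    and M: "M \<le> - act y lam (r - 1)" and N: "- act y lam 0 \<le> N"
  shows "partition_function kind r M N (\<lambda>i. - act y lam i) (act (y \<circ> longest_element r) standard_flag)
    (act (w \<circ> longest_element r) standard_flag) (\<lambda>i. inverse (z i)) t = lattice_value r t z lam w"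
proof -
  have lp: "longest_element r permutes {..<r}"
    by (rule bij_imp_permutes, rule bij_betwI[where g = "longest_element r"]) (auto simp: longest_element_def)
  have flag: "act (v \<circ> longest_element r) standard_flag i = r - 1 - inv_into UNIV v i" if "v permutes {..<r}" "i < r" for v i
  proof -
    have vi: "inv_into UNIV v i < r" using permutes_in_image[OF permutes_inv[OF that(1)], of i] that(2) by simp
    then have "(v \<circ> longest_element r) (r - 1 - inv_into UNIV v i) = i"
      by (simp add: longest_element_def permutes_inverses[OF that(1)])
    moreover have "v \<circ> longest_element r permutes {..<r}" by (rule permutes_compose[OF lp that(1)])
    ultimately have "inv_into UNIV (v \<circ> longest_element r) i = r - 1 - inv_into UNIV v i"
      by (simp add: permutes_inv_eq)
    then show ?thesis by (simp add: act_def standard_flag_def)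
  qed
  let ?c = "act (y \<circ> longest_element r) standard_flag" and ?d = "act (w \<circ> longest_element r) standard_flag"
  let ?\<mu> = "\<lambda>i. - act y lam i"
  have yi: "inv_into UNIV y i < r" if "i < r" for i using permutes_in_image[OF permutes_inv[OF y], of i] that by simp
  have b: "M \<le> - lam i \<and> - lam i \<le> N" if i: "i < r" for i
  proof -
    have yr: "y i < r" using permutes_in_image[OF y, of i] i by simp
    have "act y lam (y i) = lam i" by (simp add: act_def permutes_inverses[OF y])
    then show ?thesis using anti M N yr unfolding antidominant_def dominant_def
      by (metis (no_types, lifting) One_nat_def Suc_pred bot_nat_0.extremum less_Suc_eq_le neg_le_iff_le order_trans r lessI)
  qed
  have MN: "M \<le> N" using b[OF r] by linarith
  have inj: "inj_on ?c {..<r}"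
  proof (rule inj_onI)
    fix i j assume ij: "i \<in> {..<r}" "j \<in> {..<r}" "?c i = ?c j"
    then have "r - 1 - inv_into UNIV y i = r - 1 - inv_into UNIV y j" using flag[OF y] by simp
    then have "inv_into UNIV y i = inv_into UNIV y j" using yi[of i] yi[of j] ij by simp
    then show "i = j" using permutes_inj[OF permutes_inv[OF y]] by (simp add: inj_eq)
  qed
  have "partition_function kind r M N ?\<mu> ?c ?d (\<lambda>i. inverse (z i)) t =
    row_ops kind r t M N (map (\<lambda>i. (inverse (z i), ?d i)) [0..<r]) (zero_extend M N (top_set r ?\<mu> ?c))"
    by (rule partition_function_row_ops[OF r MN inj]) (use flag[OF y] flag[OF w] r in auto)
  also have "map (\<lambda>i. (inverse (z i), ?d i)) [0..<r] = row_data r z w"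
    unfolding row_data_def using flag[OF w] by simp
  \<comment> \<open>Here \<open>y\<close> disappears, because it permutes the parts of the weight
    and the entries of the flag simultaneously.\<close>
  also have "zero_extend M N (top_set r ?\<mu> ?c) = occupants (color_config r lam)"
  proof
    fix j
    have "g \<in> zero_extend M N (top_set r ?\<mu> ?c) j \<longleftrightarrow> g \<in> occupants (color_config r lam) j" for g
    proof
      assume "g \<in> zero_extend M N (top_set r ?\<mu> ?c) j"
      then obtain i where "i < r" "- act y lam i = j" "g = ?c i" by (auto simp: zero_extend_def top_set_def split: if_splits)
      then show "g \<in> occupants (color_config r lam) j"
        using flag[OF y, of i] yi[of i] by (auto simp: occupants_def color_config_def act_def)
    next
      assume "g \<in> occupants (color_config r lam) j"
      then have g: "g < r" "j = - lam (r - 1 - g)" by (auto simp: occupants_def color_config_def split: if_splits)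
      define i where "i = y (r - 1 - g)"
      have i: "i < r" "inv_into UNIV y i = r - 1 - g"
        using permutes_in_image[OF y, of "r - 1 - g"] g by (auto simp: i_def permutes_inverses[OF y])
      then have "- act y lam i = j" "?c i = g" using flag[OF y i(1)] g by (auto simp: act_def)
      moreover have "j \<in> {M..N}" using b[of "r - 1 - g"] g by auto
      ultimately show "g \<in> zero_extend M N (top_set r ?\<mu> ?c) j"
        using i(1) by (auto simp: zero_extend_def top_set_def)
    qed
    then show "zero_extend M N (top_set r ?\<mu> ?c) j = occupants (color_config r lam) j" by blast
  qed
  also have "row_ops kind r t M N (row_data r z w) (occupants (color_config r lam)) =
    rows_value t (site_list r M N) (row_data r z w) (color_config r lam)"
    by (rule row_ops_rows_value[OF t r MN]) (use z r in \<open>auto simp: row_data_def legal_def color_config_def\<close>)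
  also have "\<dots> = lattice_value r t z lam w" by (rule lattice_value_window[OF r b])
  finally show ?thesis .
qed

section \<open>The adjacent recursion\<close>

lemma exits_first_nth:
  "(\<And>n. n < length rws \<Longrightarrow> snd (rws ! n) = k \<Longrightarrow> \<exists>m<n. snd (rws ! m) = Suc k) \<Longrightarrow> exits_first k rws"
proof (induction rws)
  case (Cons row rws)
  obtain x d where row: "row = (x, d)" by force
  show ?case
  proof (cases "d = Suc k")
    case False
    have "d \<noteq> k" using Cons.prems[of 0] row by auto
    moreover have "exits_first k rws"
    proof (rule Cons.IH)
      fix n assume "n < length rws" "snd (rws ! n) = k"
      then obtain m where m: "m < Suc n" "snd ((row # rws) ! m) = Suc k" using Cons.prems[of "Suc n"] by auto
      then show "\<exists>m<n. snd (rws ! m) = Suc k" using False row by (cases m) auto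
    qed
    ultimately show ?thesis by (simp add: row)
  qed (simp add: row)
qed simp

text \<open>Entry i of the weight belongs to color r - 1 - i, so entries i and i + 1 belong to
  colors k + 1 and k with k = r - 2 - i. Color k + 1 exits in row \<open>w i\<close>, above the row
  \<open>w (Suc i)\<close> of color k, and \<open>lam (Suc i) \<le> lam i\<close> says that k starts
  in the same column as k + 1 or to its left.\<close>

lemma lattice_value_swap:
  assumes z: "\<And>i. i < r \<Longrightarrow> z i \<noteq> 0" and i: "Suc i < r" and w: "w permutes {..<r}"
    and lam: "lam (Suc i) \<le> lam i" and lt: "w i < w (Suc i)"
  shows "lattice_value r t z (lam \<circ> adj i) w = t * lattice_value r t z lam (w \<circ> adj i)"
    and "lattice_value r t z (lam \<circ> adj i) (w \<circ> adj i) =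
      lattice_value r t z lam w + (1 - t) * lattice_value r t z lam (w \<circ> adj i)"
proof -
  define k where "k = r - 2 - i"
  have k: "Suc k < r" "r - 1 - k = Suc i" "r - 1 - Suc k = i" using i by (auto simp: k_def)
  have r: "0 < r" using i by simp
  define b where "b = (\<Sum>i<r. \<bar>lam i\<bar>)"
  have b: "- b \<le> - lam j \<and> - lam j \<le> b" if "j < r" for j
    using member_le_sum[of j "{..<r}" "\<lambda>j. \<bar>lam j\<bar>"] that by (auto simp: b_def)
  have adj_lt: "adj i j < r" if "j < r" for j using i that by (auto simp: Transposition.transpose_def)
  have b': "- b \<le> - (lam \<circ> adj i) j \<and> - (lam \<circ> adj i) j \<le> b" if "j < r" for j
    using b[OF adj_lt[OF that]] by simp
  have adj_k: "adj k (r - 1 - m) = r - 1 - adj i m" if "m < r" for m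
    using that i by (auto simp: Transposition.transpose_def k_def)
  have conf: "color_config r (lam \<circ> adj i) = color_config r lam \<circ> adj k"
  proof
    fix g
    show "color_config r (lam \<circ> adj i) g = (color_config r lam \<circ> adj k) g"
    proof (cases "g < r")
      case True
      have "r - 1 - adj k g = adj i (r - 1 - g)"
        using adj_k[of "r - 1 - g"] True adj_lt[of "r - 1 - g"] by simp
      moreover have "adj k g < r" using True k by (auto simp: Transposition.transpose_def)
      ultimately show ?thesis using True by (simp add: color_config_def)
    next
      case False
      then show ?thesis using k by (auto simp: color_config_def Transposition.transpose_def)
    qed
  qed
  have inv_lt: "inv_into UNIV w j < r" if "j < r" for j using permutes_in_image[OF permutes_inv[OF w], of j] that by simp
  have s: "adj i permutes {..<r}" by (rule permutes_swap_id) (use i in auto)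
  have rd: "row_data r z (w \<circ> adj i) = map (apsnd (adj k)) (row_data r z w)"
  proof -
    have "inv_into UNIV (w \<circ> adj i) j = adj i (inv_into UNIV w j)" for j
      by (subst permutes_inv_eq[OF permutes_compose[OF s w]]) (simp add: permutes_inverses[OF w])
    then show ?thesis using adj_k inv_lt by (simp add: row_data_def)
  qed
  have ef: "exits_first k (row_data r z w)"
  proof (rule exits_first_nth)
    fix n assume n: "n < length (row_data r z w)" "snd (row_data r z w ! n) = k"
    then have "n < r" "r - 1 - inv_into UNIV w n = k" by (auto simp: row_data_def)
    then have "inv_into UNIV w n = Suc i" using inv_lt[of n] k by simp
    then have n': "n = w (Suc i)" by (simp add: permutes_inv_eq[OF w])
    have "w i < r" using lt n' \<open>n < r\<close> by simp
    then have "snd (row_data r z w ! w i) = Suc k" using k i by (simp add: row_data_def permutes_inverses[OF w])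
    then show "\<exists>m<n. snd (row_data r z w ! m) = Suc k" using lt n' by blast
  qed
  have win: "rows_value t (site_list r (- b) b) (row_data r z v) (color_config r lam) = lattice_value r t z lam v" for v
    by (rule lattice_value_window[OF r]) (rule b)
  have win': "rows_value t (site_list r (- b) b) (row_data r z v) (color_config r (lam \<circ> adj i)) =
    lattice_value r t z (lam \<circ> adj i) v" for v
    by (rule lattice_value_window[OF r]) (rule b')
  note v = rows_value_swap[OF k(1), of "- b" b "row_data r z w" "color_config r lam" "- lam (Suc i)" "- lam i" t]
  have "rows_value t (site_list r (- b) b) (row_data r z w) (color_config r lam \<circ> adj k) =
      t * rows_value t (site_list r (- b) b) (map (apsnd (adj k)) (row_data r z w)) (color_config r lam) \<and>
    rows_value t (site_list r (- b) b) (map (apsnd (adj k)) (row_data r z w)) (color_config r lam \<circ> adj k) =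
      rows_value t (site_list r (- b) b) (row_data r z w) (color_config r lam) +
      (1 - t) * rows_value t (site_list r (- b) b) (map (apsnd (adj k)) (row_data r z w)) (color_config r lam)"
  proof (rule v[OF _ ef])
    show "- b \<le> b" using b[OF r] by linarith
    show "x \<noteq> 0" if "(x, d) \<in> set (row_data r z w)" for x d using that z by (auto simp: row_data_def)
    show "color_config r lam k = Some (- lam (Suc i))" "color_config r lam (Suc k) = Some (- lam i)"
      using k by (auto simp: color_config_def)
    show "- lam i \<le> - lam (Suc i)" using lam by simp
    show "- b \<le> j" if "color_config r lam g = Some j" for g j
      using that b[of "r - 1 - g"] by (auto simp: color_config_def split: if_splits)
  qed
  then have eqs: "lattice_value r t z (lam \<circ> adj i) w = t * lattice_value r t z lam (w \<circ> adj i) \<and>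
    lattice_value r t z (lam \<circ> adj i) (w \<circ> adj i) =
      lattice_value r t z lam w + (1 - t) * lattice_value r t z lam (w \<circ> adj i)"
    unfolding conf[symmetric] rd[symmetric] win win' by simp
  show "lattice_value r t z (lam \<circ> adj i) w = t * lattice_value r t z lam (w \<circ> adj i)"
    using eqs ..
  show "lattice_value r t z (lam \<circ> adj i) (w \<circ> adj i) =
      lattice_value r t z lam w + (1 - t) * lattice_value r t z lam (w \<circ> adj i)"
    using eqs ..
qed

section \<open>The rotation recursion\<close>

definition cycle_down :: "nat \<Rightarrow> nat \<Rightarrow> nat" where
  "cycle_down r i = (if i = 0 then r - 1 else if i < r then i - 1 else i)"

lemma cycle_down_permutes: "0 < r \<Longrightarrow> cycle_down r permutes {..<r}"
proof (rule bij_imp_permutes)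
  assume "0 < r"
  have "cycle_down r ` {..<r} = {..<r}"
  proof
    show "cycle_down r ` {..<r} \<subseteq> {..<r}" using \<open>0 < r\<close> by (auto simp: cycle_down_def)
    show "{..<r} \<subseteq> cycle_down r ` {..<r}"
    proof
      fix j assume j: "j \<in> {..<r}"
      show "j \<in> cycle_down r ` {..<r}"
      proof (cases "j = r - 1")
        case True
        then show ?thesis using \<open>0 < r\<close> by (intro image_eqI[of _ _ 0]) (auto simp: cycle_down_def)
      next
        case False
        then show ?thesis using j by (intro image_eqI[of _ _ "Suc j"]) (auto simp: cycle_down_def)
      qed
    qed
  qed
  then show "bij_betw (cycle_down r) {..<r} {..<r}" by (auto simp: bij_betw_def intro: eq_card_imp_inj_on)
qed (auto simp: cycle_down_def)

definition rotate_weight :: "nat \<Rightarrow> (nat \<Rightarrow> int) \<Rightarrow> nat \<Rightarrow> int" where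
  "rotate_weight r lam = (\<lambda>i. lam (if i = 0 then r - 1 else if i < r then i - 1 else i) + (if i = 0 then 1 else 0))"

lemma rotation_factor_map:
  "rotation_factor t (map f [a..<n]) =
    (case find (\<lambda>i. snd (f i) = 0) [a..<n] of None \<Rightarrow> 1 | Some i \<Rightarrow> t ^ (n - 1 - i) / fst (f i))"
proof (induction "n - a" arbitrary: a)
  case (Suc m)
  then have a: "a < n" "m = n - Suc a" by auto
  obtain x d where f: "f a = (x, d)" by force
  show ?case using Suc.hyps(1)[OF a(2)] a f by (simp add: upt_conv_Cons)
qed simp

text \<open>Color 0 belongs to the last entry of \<open>lam\<close> and exits in row
  \<open>v (r - 1) = w 0\<close>. That row has parameter 1/z and \<open>r - 1 - w 0\<close> rows
  below it, which gives the right-hand factor; the count on the left is the initial value of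
  \<open>ahead\<close>.\<close>

lemma lattice_value_rotate:
  assumes r: "0 < r" and z: "\<And>i. i < r \<Longrightarrow> z i \<noteq> 0" and w: "w permutes {..<r}" and v: "v permutes {..<r}"
    and wv: "\<And>m. m < r \<Longrightarrow> w (if Suc m = r then 0 else Suc m) = v m"
  shows "lattice_value r t z (rotate_weight r lam) w * t ^ card {m. m < r - 1 \<and> lam m \<le> lam (r - 1)} =
    t ^ (r - 1 - w 0) * z (w 0) * lattice_value r t z lam v"
proof -
  \<comment> \<open>The additional 1 leaves room for the entry \<open>lam (r - 1) + 1\<close> of the
    rotated weight.\<close>
  define b where "b = (\<Sum>i<r. \<bar>lam i\<bar>) + 1"
  have b: "- b < - lam j \<and> - lam j < b" if "j < r" for j
    using member_le_sum[of j "{..<r}" "\<lambda>j. \<bar>lam j\<bar>"] that by (auto simp: b_def)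
  have b1: "- b \<le> - lam j \<and> - lam j \<le> b" if "j < r" for j using b[OF that] by linarith
  have b2: "- b \<le> - rotate_weight r lam j \<and> - rotate_weight r lam j \<le> b" if "j < r" for j
  proof (cases "j = 0")
    case True
    then show ?thesis using b[of "r - 1"] r by (simp add: rotate_weight_def)
  next
    case False
    then have "rotate_weight r lam j = lam (j - 1)" using that by (simp add: rotate_weight_def)
    then show ?thesis using b1[of "j - 1"] that by simp
  qed
  \<comment> \<open>Column - b is left out, so that the window shifted by one site begins with the
    last site of that column.\<close>
  let ?A = "(- b + 1) * int r" and ?B = "b * int r + int r - 1"
  have b3: "- b + 1 \<le> - lam j \<and> - lam j \<le> b" if "j < r" for j using b[OF that] by linarith
  have vi: "inv_into UNIV v j < r" if "j < r" for j using permutes_in_image[OF permutes_inv[OF v], of j] that by simp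
  have bpos: "- b + 1 \<le> b" using b3[OF r] by linarith
  have "(- b + 1) * int r \<le> b * int r" using bpos by (intro mult_right_mono) auto
  then have AB: "?A - 1 \<le> ?B" using r by linarith
  have inv_w: "inv_into UNIV w j = (if Suc (inv_into UNIV v j) = r then 0 else Suc (inv_into UNIV v j))" if "j < r" for j
    using wv[OF vi[OF that]] by (subst permutes_inv_eq[OF w]) (simp add: permutes_inverses[OF v])
  have rd: "map (apsnd (rot_color r)) (row_data r z v) = row_data r z w"
  proof -
    have "rot_color r (r - 1 - inv_into UNIV v j) = r - 1 - inv_into UNIV w j" if "j < r" for j
      using vi[OF that] inv_w[OF that] by (auto simp: rot_color_def)
    then show ?thesis by (simp add: row_data_def)
  qed
  have rc: "rot_config r (color_config r lam) = color_config r (rotate_weight r lam)"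
  proof
    fix g
    have "r - 1 - Suc g = r - 1 - g - 1" by simp
    then show "rot_config r (color_config r lam) g = color_config r (rotate_weight r lam) g"
      using r by (auto simp: rot_config_def color_config_def rotate_weight_def)
  qed
  have set_rd: "snd ` set (row_data r z v) = {..<r}"
  proof
    show "snd ` set (row_data r z v) \<subseteq> {..<r}" using r by (auto simp: row_data_def)
    show "{..<r} \<subseteq> snd ` set (row_data r z v)"
    proof
      fix g assume "g \<in> {..<r}"
      then have "v (r - 1 - g) < r" "g = r - 1 - inv_into UNIV v (v (r - 1 - g))"
        using permutes_in_image[OF v, of "r - 1 - g"] by (auto simp: permutes_inverses[OF v])
      then show "g \<in> snd ` set (row_data r z v)" by (force simp: row_data_def)
    qed
  qed
  have dist: "distinct (map snd (row_data r z v))"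
  proof -
    have "i = j" if "i < r" "j < r" "r - 1 - inv_into UNIV v i = r - 1 - inv_into UNIV v j" for i j
    proof -
      have "inv_into UNIV v i = inv_into UNIV v j" using vi[OF that(1)] vi[OF that(2)] that(3) by linarith
      then show ?thesis using permutes_inj[OF permutes_inv[OF v]] by (simp add: inj_eq)
    qed
    then have "inj_on (\<lambda>i. r - 1 - inv_into UNIV v i) {..<r}" unfolding inj_on_def by blast
    then have "distinct (map (\<lambda>i. r - 1 - inv_into UNIV v i) [0..<r])"
      unfolding distinct_map by (simp add: atLeast0LessThan)
    moreover have "map snd (row_data r z v) = map (\<lambda>i. r - 1 - inv_into UNIV v i) [0..<r]"
      by (simp add: row_data_def comp_def)
    ultimately show ?thesis by (simp only:)
  qed
  have st: "state_on (snd ` set (row_data r z v)) ?A r Plus (color_config r lam)"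
  proof -
    have "in_window r ?A ?B (color_config r lam)" using r b3 by (rule color_config_window)
    then show ?thesis unfolding state_on_def set_rd by (auto simp: in_window_def color_config_def split: if_splits)
  qed
  \<comment> \<open>Columns are negatives of the entries, so a color in a column at or to the left
    of that of color 0 has an entry at most \<open>lam (r - 1)\<close>.\<close>
  have ah: "card (ahead r ?B Plus (color_config r lam)) = card {m. m < r - 1 \<and> lam m \<le> lam (r - 1)}"
  proof (rule bij_betw_same_card[of "\<lambda>g. r - 1 - g"], rule bij_betwI[where g = "\<lambda>g. r - 1 - g"])
    show "(\<lambda>g. r - 1 - g) \<in> ahead r ?B Plus (color_config r lam) \<rightarrow> {m. m < r - 1 \<and> lam m \<le> lam (r - 1)}"
      using r by (auto simp: ahead_def color_config_def)
    show "(\<lambda>g. r - 1 - g) \<in> {m. m < r - 1 \<and> lam m \<le> lam (r - 1)} \<rightarrow> ahead r ?B Plus (color_config r lam)"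
      using r by (auto simp: ahead_def color_config_def)
  qed (auto simp: ahead_def)
  have w0: "w 0 = v (r - 1)" using wv[of "r - 1"] r by simp
  have rf: "rotation_factor t (row_data r z v) = t ^ (r - 1 - w 0) * z (w 0)"
  proof -
    have zero_iff: "r - 1 - inv_into UNIV v i = 0 \<longleftrightarrow> i = w 0" if "i < r" for i
    proof -
      have "r - 1 - inv_into UNIV v i = 0 \<longleftrightarrow> inv_into UNIV v i = r - 1" using vi[OF that] by auto
      then show ?thesis unfolding permutes_inv_eq[OF v] w0 by auto
    qed
    have "w 0 < r" using permutes_in_image[OF w, of 0] r by simp
    have "find (\<lambda>i. r - 1 - inv_into UNIV v i = 0) [0..<r] = Some (w 0)"
      unfolding find_Some_iff using zero_iff \<open>w 0 < r\<close> by (intro exI[of _ "w 0"]) auto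
    then show ?thesis unfolding row_data_def rotation_factor_map by (simp add: field_simps)
  qed
  have main: "rows_value t (interval_sites r (?A - 1) (?B - 1)) (row_data r z w) (color_config r (rotate_weight r lam)) *
      t ^ card {m. m < r - 1 \<and> lam m \<le> lam (r - 1)} =
    t ^ (r - 1 - w 0) * z (w 0) * rows_value t (interval_sites r ?A ?B) (row_data r z v) (color_config r lam)"
  proof -
    have "x \<noteq> 0" if "(x, d) \<in> set (row_data r z v)" for x d using that z by (auto simp: row_data_def)
    moreover have "0 \<in> snd ` set (row_data r z v)" using r by (simp add: set_rd)
    ultimately show ?thesis
      using rows_value_rotate[OF AB st dist, of t] unfolding rd rc ah rf unfolding set_rd by blast
  qed
  have 1: "rows_value t (interval_sites r ?A ?B) (row_data r z v) (color_config r lam) = lattice_value r t z lam v"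
  proof -
    have "rows_value t (site_list r (- b + 1) b) (row_data r z v) (color_config r lam) = lattice_value r t z lam v"
      by (rule lattice_value_window[OF r]) (rule b3)
    then show ?thesis using site_list_conv[OF r, of "- b + 1" b] bpos by simp
  qed
  have win: "in_window r (?A - 1) (?B - 1) (color_config r (rotate_weight r lam))"
    unfolding in_window_def
  proof (intro allI impI)
    fix g j assume c: "color_config r (rotate_weight r lam) g = Some j"
    then have g: "g < r" by (auto simp: color_config_def split: if_splits)
    have j: "j = - rotate_weight r lam (r - 1 - g)" using c g by (simp add: color_config_def)
    show "g < r \<and> ?A - 1 \<le> j * int r + int g \<and> j * int r + int g \<le> ?B - 1"
    proof (cases "g = r - 1")
      case True
      then have "j = - lam (r - 1) - 1" using j by (simp add: rotate_weight_def)
      then have "- b \<le> j" "j \<le> b - 1" using b3[of "r - 1"] r by auto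
      then have "(- b) * int r \<le> j * int r" "j * int r \<le> (b - 1) * int r" by (intro mult_right_mono; simp)+
      then show ?thesis using True g by (simp add: algebra_simps of_nat_diff)
    next
      case False
      then have "j = - lam (r - 1 - g - 1)" using j g by (simp add: rotate_weight_def)
      then have "- b + 1 \<le> j" "j \<le> b" using b3[of "r - 1 - g - 1"] g by auto
      then have "?A \<le> j * int r" "j * int r \<le> b * int r" by (intro mult_right_mono; simp)+
      moreover have "int g + 2 \<le> int r" using False g by linarith
      ultimately show ?thesis using g by linarith
    qed
  qed
  have "rows_value t (interval_sites r (- b * int r) ?B) (row_data r z w) (color_config r (rotate_weight r lam)) =
     rows_value t (interval_sites r (?A - 1) (?B - 1)) (row_data r z w) (color_config r (rotate_weight r lam))"
  proof (rule rows_value_window[OF win r])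
    have "?A = - b * int r + int r" by (simp add: algebra_simps)
    then show "- b * int r \<le> ?A - 1" using r by linarith
    show "?A - 1 \<le> ?B - 1"
    proof -
      have "?A \<le> b * int r" using bpos by (intro mult_right_mono) auto
      then show ?thesis using r by linarith
    qed
  qed simp
  moreover have "rows_value t (site_list r (- b) b) (row_data r z w) (color_config r (rotate_weight r lam)) =
      lattice_value r t z (rotate_weight r lam) w"
    by (rule lattice_value_window[OF r]) (rule b2)
  moreover have "- b - 1 \<le> b" using bpos by linarith
  ultimately have 2: "rows_value t (interval_sites r (?A - 1) (?B - 1)) (row_data r z w) (color_config r (rotate_weight r lam)) =
     lattice_value r t z (rotate_weight r lam) w"
    using site_list_conv[OF r, of "- b" b] by simp
  show ?thesis using main unfolding 1 2 .
qed

text \<open>The state is forced. All colors start in column 0, and each row releases the color of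
  largest index still present, say d, which crosses the d colors of smaller index with weight t
  each. The total exponent is 0 + 1 + ... + (r - 1).\<close>

lemma lattice_value_zero:
  assumes r: "0 < r"
  shows "lattice_value r t z (\<lambda>_. 0) id = t ^ (r * (r - 1) div 2)"
proof -
  let ?p = "\<lambda>n g. if g < n then Some 0 else None :: int option"
  \<comment> \<open>A color whose sites have all been passed cannot enter the edge any more. This
    forces color d to enter at its own site.\<close>
  have dead: "sweep x t (map (Pair 0) gs) (exit_right d F) a p = 0" if "d \<notin> set gs" "a \<noteq> Color d" for gs d F a p and x :: complex
    using that by (induction gs arbitrary: a p) (auto simp: exit_right_def vstep_def split: spin.split)
  have carry: "sweep x t (map (Pair 0) (rev [0..<m])) (exit_right d F) (Color d) (?p d) = t ^ m * F (?p d)"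
    if "m \<le> d" for m d F and x :: complex
    using that by (induction m) (auto simp: exit_right_def vstep_def)
  have skip: "sweep x t (map (Pair 0) (rev [Suc d..<Suc d + m])) f Plus (?p (Suc d)) = f Plus (?p (Suc d))" for x :: complex and d m f
    by (induction m) (auto simp: vstep_def)
  have col: "sweep x t (column_sites r 0) (exit_right d F) Plus (?p (Suc d)) = t ^ d * F (?p d)" if "d < r" for x :: complex and d F
  proof -
    have "[0..<r] = [0..<d] @ d # [Suc d..<Suc d + (r - Suc d)]"
      using that upt_add_eq_append[of 0 d "r - d"] upt_conv_Cons[of d r] by simp
    then have "column_sites r 0 = map (Pair 0) (rev [Suc d..<Suc d + (r - Suc d)]) @ (0, d) # map (Pair 0) (rev [0..<d])"
      by (simp add: column_sites_def)
    then have "sweep x t (column_sites r 0) (exit_right d F) Plus (?p (Suc d)) =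
      vstep x t (0, d) (sweep x t (map (Pair 0) (rev [0..<d])) (exit_right d F)) Plus (?p (Suc d))"
      by (simp only: sweep_simps skip)
    also have "(?p (Suc d))(d := None) = ?p d" by auto
    then have "vstep x t (0, d) (sweep x t (map (Pair 0) (rev [0..<d])) (exit_right d F)) Plus (?p (Suc d)) = t ^ d * F (?p d)"
      using dead[of d "rev [0..<d]" Plus x F] carry[of d d x F] by (simp add: vstep_def)
    finally show ?thesis .
  qed
  have "n \<le> r \<Longrightarrow> rows_value t (column_sites r 0) (map (\<lambda>i. (inverse (z i), r - 1 - i)) [r - n..<r]) (?p n) = t ^ (\<Sum>k<n. k)" for n
  proof (induction n)
    case (Suc n)
    then have u: "[r - Suc n..<r] = (r - Suc n) # [r - n..<r]" by (subst upt_conv_Cons) (auto simp: Suc_diff_Suc)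
    have "r - 1 - (r - Suc n) = n" using Suc by simp
    then show ?case using Suc col[of n "inverse (z (r - Suc n))"] by (simp add: u power_add)
  qed simp
  from this[of r] have "rows_value t (column_sites r 0) (map (\<lambda>i. (inverse (z i), r - 1 - i)) [0..<r]) (?p r) = t ^ (\<Sum>k<r. k)" by simp
  moreover have "color_config r (\<lambda>_. 0) = ?p r" by (auto simp: color_config_def)
  moreover have "(\<Sum>k<r. k) = r * (r - 1) div 2"
  proof (cases r)
    case (Suc n)
    then show ?thesis using gauss_sum_nat[of n] by (simp add: lessThan_Suc_atMost atMost_atLeast0 mult.commute)
  qed simp
  ultimately show ?thesis
    by (simp add: lattice_value_def row_data_def site_list_def)
qed

section \<open>The Iwahori decomposition of the general linear group\<close>

lemma mat_mult_entry:
  assumes "A \<in> carrier_mat r r" "B \<in> carrier_mat r r" "i < r" "j < r"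
  shows "(A * B) $$ (i, j) = (\<Sum>l<r. A $$ (i, l) * B $$ (l, j))"
  using assms by (simp add: scalar_prod_def atLeast0LessThan)

lemma mat_assoc:
  assumes "A \<in> carrier_mat r r" "B \<in> carrier_mat r r" "C \<in> carrier_mat r r"
  shows "A * B * C = A * (B * C)"
  using assms by (rule assoc_mult_mat)

lemma mat_mult_closed [simp]:
  "A \<in> carrier_mat r r \<Longrightarrow> B \<in> carrier_mat r r \<Longrightarrow> A * B \<in> carrier_mat r r"
  by (rule mult_carrier_mat)

text \<open>Descending induction on the row. In the product \<open>A * A'\<close> at (i, j) with j
  at most i, every term except the one with l = i lies in I: for l < i because of A, for l > i by
  the induction hypothesis on A'. It serves for the Borel subgroup with I = {0} and for the Iwahori
  subgroup with the maximal ideal.\<close>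

lemma inverse_lower_entries:
  fixes A A' :: "'a::comm_ring_1 mat" and I R :: "'a set"
  assumes A: "A \<in> carrier_mat r r" "A' \<in> carrier_mat r r" "A * A' = 1\<^sub>m r"
    and I: "0 \<in> I" "\<And>x y. x \<in> I \<Longrightarrow> y \<in> I \<Longrightarrow> x + y \<in> I" "\<And>c x. c \<in> R \<Longrightarrow> x \<in> I \<Longrightarrow> c * x \<in> I"
      "\<And>x. x \<in> I \<Longrightarrow> - x \<in> I"
    and R: "\<And>i j. i < r \<Longrightarrow> j < r \<Longrightarrow> A $$ (i, j) \<in> R" "\<And>i j. i < r \<Longrightarrow> j < r \<Longrightarrow> A' $$ (i, j) \<in> R"
    and low: "\<And>i j. i < r \<Longrightarrow> j < i \<Longrightarrow> A $$ (i, j) \<in> I"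
  shows "i < r \<Longrightarrow> (\<forall>j<i. A' $$ (i, j) \<in> I) \<and> A $$ (i, i) * A' $$ (i, i) - 1 \<in> I"
proof (induction "r - i" arbitrary: i rule: less_induct)
  case less
  have sumI: "(\<Sum>l\<in>S. f l) \<in> I" if "finite S" "\<And>l. l \<in> S \<Longrightarrow> f l \<in> I" for S :: "nat set" and f
    using that by (induction S rule: finite_induct) (auto intro: I)
  have e: "A $$ (i, i) * A' $$ (i, j) - (if i = j then 1 else 0) \<in> I" if "j \<le> i" for j
  proof -
    have j: "j < r" using that less.prems by simp
    have "(\<Sum>l<r. A $$ (i, l) * A' $$ (l, j)) = (if i = j then 1 else 0)"
      using mat_mult_entry[OF A(1,2) less.prems j] A(3) less.prems j by simp
    moreover have "(\<Sum>l<r. A $$ (i, l) * A' $$ (l, j)) =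
      A $$ (i, i) * A' $$ (i, j) + (\<Sum>l\<in>{..<r} - {i}. A $$ (i, l) * A' $$ (l, j))"
      using less.prems by (subst sum.remove[of _ i]) auto
    ultimately have eq: "A $$ (i, i) * A' $$ (i, j) - (if i = j then 1 else 0) =
      - (\<Sum>l\<in>{..<r} - {i}. A $$ (i, l) * A' $$ (l, j))"
      by (simp add: algebra_simps)
    have "(\<Sum>l\<in>{..<r} - {i}. A $$ (i, l) * A' $$ (l, j)) \<in> I"
    proof (rule sumI)
      fix l assume l: "l \<in> {..<r} - {i}"
      show "A $$ (i, l) * A' $$ (l, j) \<in> I"
      proof (cases "l < i")
        case True
        then have "A' $$ (l, j) * A $$ (i, l) \<in> I" using I(3) low R l j less.prems by auto
        then show ?thesis by (simp add: mult.commute)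
      next
        case False
        then have "i < l" "l < r" using l by auto
        then have "A' $$ (l, j) \<in> I" using less.hyps[of l] that by auto
        then show ?thesis using I(3) R less.prems \<open>l < r\<close> by auto
      qed
    qed simp
    then show ?thesis unfolding eq by (rule I(4))
  qed
  have u: "A $$ (i, i) * A' $$ (i, i) - 1 \<in> I" using e[of i] by simp
  moreover have "A' $$ (i, j) \<in> I" if "j < i" for j
  proof -
    have 1: "A $$ (i, i) * A' $$ (i, j) \<in> I" using e[of j] that by simp
    have r: "A' $$ (i, i) \<in> R" "A' $$ (i, j) \<in> R" using R less.prems that by auto
    \<comment> \<open>This combination is equal to \<open>A' $$ (i, j)\<close>: the diagonal entry
      of A is inverted modulo I.\<close>
    have "A' $$ (i, i) * (A $$ (i, i) * A' $$ (i, j)) + - (A' $$ (i, j) * (A $$ (i, i) * A' $$ (i, i) - 1)) \<in> I"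
      by (intro I(2) I(4) I(3) r 1 u)
    then show ?thesis by (simp add: algebra_simps)
  qed
  ultimately show ?case by blast
qed

text \<open>Multiplied from the right it adds \<open>v j\<close> times column m to column j, for all
  j other than m at once, so that a whole row can be cleared with one pivot.\<close>

definition elim :: "nat \<Rightarrow> nat \<Rightarrow> (nat \<Rightarrow> 'a) \<Rightarrow> 'a::field mat" where
  "elim r m v = Matrix.mat r r (\<lambda>(i, j). if i = j then 1 else if i = m then v j else 0)"

lemma elim_carrier [simp]: "elim r m v \<in> carrier_mat r r"
  by (simp add: elim_def)

lemma elim_entry: "i < r \<Longrightarrow> j < r \<Longrightarrow> elim r m v $$ (i, j) = (if i = j then 1 else if i = m then v j else 0)"
  by (simp add: elim_def)

lemma mult_elim_entry:
  assumes "A \<in> carrier_mat r r" "i < r" "j < r" "m < r"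
  shows "(A * elim r m v) $$ (i, j) = A $$ (i, j) + (if j = m then 0 else A $$ (i, m) * v j)"
proof -
  have "(A * elim r m v) $$ (i, j) = (\<Sum>l<r. A $$ (i, l) * elim r m v $$ (l, j))"
    by (rule mat_mult_entry) (use assms in auto)
  also have "\<dots> = (\<Sum>l<r. (if l = j then A $$ (i, l) else 0) + (if l = m then (if j = m then 0 else A $$ (i, l) * v j) else 0))"
    using assms by (intro sum.cong) (auto simp: elim_entry)
  also have "\<dots> = A $$ (i, j) + (if j = m then 0 else A $$ (i, m) * v j)"
    using assms by (simp add: sum.distrib)
  finally show ?thesis .
qed

lemma elim_mult_entry:
  assumes "A \<in> carrier_mat r r" "i < r" "j < r" "m < r"
  shows "(elim r m v * A) $$ (i, j) = A $$ (i, j) + (if i = m then \<Sum>l\<in>{..<r} - {m}. v l * A $$ (l, j) else 0)"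
proof -
  have "(elim r m v * A) $$ (i, j) = (\<Sum>l<r. elim r m v $$ (i, l) * A $$ (l, j))"
    by (rule mat_mult_entry) (use assms in auto)
  also have "\<dots> = elim r m v $$ (i, i) * A $$ (i, j) + (\<Sum>l\<in>{..<r} - {i}. elim r m v $$ (i, l) * A $$ (l, j))"
    using assms by (subst sum.remove[of _ i]) auto
  also have "(\<Sum>l\<in>{..<r} - {i}. elim r m v $$ (i, l) * A $$ (l, j)) =
     (\<Sum>l\<in>{..<r} - {i}. if i = m then v l * A $$ (l, j) else 0)"
    using assms by (intro sum.cong) (auto simp: elim_entry)
  finally show ?thesis using assms by (simp add: elim_entry)
qed

lemma elim_inverse: "m < r \<Longrightarrow> elim r m v * elim r m (\<lambda>j. - v j) = 1\<^sub>m r"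
  by (rule eq_matI) (auto simp: mult_elim_entry elim_entry simp del: index_mult_mat, auto simp: elim_def)

lemma elim_inverse': "m < r \<Longrightarrow> elim r m (\<lambda>j. - v j) * elim r m v = 1\<^sub>m r"
  using elim_inverse[of m r "\<lambda>j. - v j"] by simp

lemma perm_mat_carrier [simp]: "perm_mat r w \<in> carrier_mat r r"
  by (simp add: perm_mat_def)

lemma mult_perm_mat_entry:
  assumes "A \<in> carrier_mat r r" "w permutes {..<r}" "i < r" "j < r"
  shows "(A * perm_mat r w) $$ (i, j) = A $$ (i, w j)"
proof -
  have "w j < r" using permutes_in_image[OF assms(2), of j] assms(4) by simp
  have "(A * perm_mat r w) $$ (i, j) = (\<Sum>l<r. A $$ (i, l) * perm_mat r w $$ (l, j))"
    by (rule mat_mult_entry) (use assms in auto)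
  also have "\<dots> = (\<Sum>l<r. if l = w j then A $$ (i, l) else 0)"
    using assms by (intro sum.cong) (auto simp: perm_mat_def)
  finally show ?thesis using \<open>w j < r\<close> by simp
qed

lemma perm_mat_mult_entry:
  assumes "A \<in> carrier_mat r r" "w permutes {..<r}" "i < r" "j < r"
  shows "(perm_mat r w * A) $$ (w i, j) = A $$ (i, j)"
proof -
  have "w i < r" using permutes_in_image[OF assms(2), of i] assms(3) by simp
  have "(perm_mat r w * A) $$ (w i, j) = (\<Sum>l<r. perm_mat r w $$ (w i, l) * A $$ (l, j))"
    by (rule mat_mult_entry) (use assms \<open>w i < r\<close> in auto)
  also have "\<dots> = (\<Sum>l<r. if l = i then A $$ (l, j) else 0)"
    using assms \<open>w i < r\<close> by (intro sum.cong) (auto simp: perm_mat_def dest: permutes_inj[THEN injD])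
  finally show ?thesis using assms by simp
qed

lemma perm_mat_comp:
  assumes "v permutes {..<r}" "w permutes {..<r}"
  shows "perm_mat r v * perm_mat r w = (perm_mat r (v \<circ> w) :: 'a::field mat)"
proof (rule eq_matI)
  fix i j assume "i < dim_row (perm_mat r (v \<circ> w) :: 'a mat)" "j < dim_col (perm_mat r (v \<circ> w) :: 'a mat)"
  then have ij: "i < r" "j < r" by (simp_all add: perm_mat_def)
  have "w j < r" using permutes_in_image[OF assms(2), of j] ij by simp
  then show "(perm_mat r v * perm_mat r w) $$ (i, j) = (perm_mat r (v \<circ> w) :: 'a mat) $$ (i, j)"
    using ij by (subst mult_perm_mat_entry) (use assms in \<open>auto simp: perm_mat_def\<close>)
qed (simp_all add: perm_mat_def)

lemma perm_mat_id: "perm_mat r id = 1\<^sub>m r"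
  by (rule eq_matI) (auto simp: perm_mat_def)

lemma perm_mat_inverse:
  assumes "w permutes {..<r}"
  shows "perm_mat r w * perm_mat r (inv_into UNIV w) = 1\<^sub>m r" "perm_mat r (inv_into UNIV w) * perm_mat r w = 1\<^sub>m r"
  using perm_mat_comp[OF assms permutes_inv[OF assms]] perm_mat_comp[OF permutes_inv[OF assms] assms]
  by (simp_all add: permutes_inv_o[OF assms] perm_mat_id)

section \<open>The general linear group and its Borel subgroup\<close>

lemma GL_I:
  assumes "A \<in> carrier_mat r r" "B \<in> carrier_mat r r" "A * B = 1\<^sub>m r" "B * A = 1\<^sub>m r"
  shows "A \<in> GL r"
  using assms unfolding GL_def invertible_mat_def inverts_mat_def by fastforce

lemma GL_E:
  assumes "A \<in> GL r"
  obtains B where "A \<in> carrier_mat r r" "B \<in> carrier_mat r r" "A * B = 1\<^sub>m r" "B * A = 1\<^sub>m r"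
proof -
  from assms obtain B where A: "A \<in> carrier_mat r r" and B: "A * B = 1\<^sub>m r" "B * A = 1\<^sub>m (dim_row B)"
    unfolding GL_def invertible_mat_def inverts_mat_def by auto
  have "dim_col B = r" using arg_cong[OF B(1), of dim_col] by simp
  moreover have "dim_row B = r" using arg_cong[OF B(2), of dim_col] A by simp
  ultimately show ?thesis using that[of B] A B by auto
qed

lemma GL_mult:
  fixes A B :: "'a::field mat"
  assumes "A \<in> GL r" "B \<in> GL r"
  shows "A * B \<in> GL r"
proof -
  obtain A' where A: "A \<in> carrier_mat r r" "A' \<in> carrier_mat r r" "A * A' = 1\<^sub>m r" "A' * A = 1\<^sub>m r"
    using assms(1) by (rule GL_E)
  obtain B' where B: "B \<in> carrier_mat r r" "B' \<in> carrier_mat r r" "B * B' = 1\<^sub>m r" "B' * B = 1\<^sub>m r"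
    using assms(2) by (rule GL_E)
  have m: "X * Y * (Y' * X') = 1\<^sub>m r"
    if "X \<in> carrier_mat r r" "X' \<in> carrier_mat r r" "Y \<in> carrier_mat r r" "Y' \<in> carrier_mat r r"
      "X * X' = 1\<^sub>m r" "Y * Y' = 1\<^sub>m r" for X X' Y Y' :: "'a mat"
  proof -
    have "X * Y * (Y' * X') = X * (Y * (Y' * X'))" using that by (intro assoc_mult_mat) auto
    also have "Y * (Y' * X') = Y * Y' * X'" using that by (intro assoc_mult_mat[symmetric]) auto
    finally show ?thesis using that by simp
  qed
  have "(A * B) * (B' * A') = 1\<^sub>m r" "(B' * A') * (A * B) = 1\<^sub>m r" using A B by (auto intro: m)
  then show ?thesis using A B by (intro GL_I[of _ _ "B' * A'"]) auto
qed

lemma GL_carrier: "A \<in> GL r \<Longrightarrow> A \<in> carrier_mat r r"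
  by (simp add: GL_def)

lemma perm_mat_GL: "w permutes {..<r} \<Longrightarrow> perm_mat r w \<in> GL r"
  using perm_mat_inverse by (intro GL_I[of _ _ "perm_mat r (inv_into UNIV w)"]) auto

lemma borel_subgroupE:
  assumes "b \<in> borel_subgroup r"
  obtains b' where "b' \<in> borel_subgroup r" "b * b' = 1\<^sub>m r" "b' * b = 1\<^sub>m r"
proof -
  obtain b' where b: "b \<in> carrier_mat r r" "b' \<in> carrier_mat r r" "b * b' = 1\<^sub>m r" "b' * b = 1\<^sub>m r"
    using assms GL_E by (auto simp: borel_subgroup_def)
  have "b' $$ (i, j) \<in> {0}" if "i < r" "j < i" for i j
  proof -
    have "upper_triangular b" using assms by (simp add: borel_subgroup_def)
    then have low: "b $$ (i, j) \<in> {0}" if "i < r" "j < i" for i j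
      using b that by auto
    show ?thesis
      using inverse_lower_entries[OF b(1-3), of "{0}" UNIV, OF _ _ _ _ _ _ low \<open>i < r\<close>] \<open>j < i\<close> by auto
  qed
  then have "upper_triangular b'" using b by auto
  then have "b' \<in> borel_subgroup r" using b by (auto simp: borel_subgroup_def intro: GL_I)
  then show ?thesis using that b by blast
qed

lemma borel_mult_diag:
  assumes "b \<in> borel_subgroup r" "b' \<in> borel_subgroup r" "i < r"
  shows "(b * b') $$ (i, i) = b $$ (i, i) * b' $$ (i, i)"
proof -
  have c: "b \<in> carrier_mat r r" "b' \<in> carrier_mat r r" "upper_triangular b" "upper_triangular b'"
    using assms by (auto simp: borel_subgroup_def GL_def)
  have "(b * b') $$ (i, i) = (\<Sum>l<r. b $$ (i, l) * b' $$ (l, i))"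
    by (rule mat_mult_entry) (use c assms in auto)
  also have "\<dots> = (\<Sum>l<r. if l = i then b $$ (i, i) * b' $$ (i, i) else 0)"
  proof (intro sum.cong refl)
    fix l assume "l \<in> {..<r}"
    then show "b $$ (i, l) * b' $$ (l, i) = (if l = i then b $$ (i, i) * b' $$ (i, i) else 0)"
      using c assms upper_triangularD[OF c(3), of l i] upper_triangularD[OF c(4), of i l]
      by (cases l i rule: linorder_cases) auto
  qed
  finally show ?thesis using assms by simp
qed

lemma borel_subgroup_mult:
  assumes "b \<in> borel_subgroup r" "b' \<in> borel_subgroup r"
  shows "b * b' \<in> borel_subgroup r"
proof -
  have c: "b \<in> carrier_mat r r" "b' \<in> carrier_mat r r" "upper_triangular b" "upper_triangular b'"
    using assms by (auto simp: borel_subgroup_def GL_def)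
  have "(b * b') $$ (i, j) = 0" if "i < r" "j < i" for i j
  proof -
    have "(b * b') $$ (i, j) = (\<Sum>l<r. b $$ (i, l) * b' $$ (l, j))"
      by (rule mat_mult_entry) (use c that in auto)
    also have "\<dots> = 0"
    proof (intro sum.neutral ballI)
      fix l assume "l \<in> {..<r}"
      then show "b $$ (i, l) * b' $$ (l, j) = 0" using c that upper_triangularD[OF c(3), of l i] upper_triangularD[OF c(4), of j l]
        by (cases "l < i") auto
    qed
    finally show ?thesis .
  qed
  then have "upper_triangular (b * b')" using c by auto
  then show ?thesis using assms GL_mult by (auto simp: borel_subgroup_def)
qed

lemma borel_diag_nonzero:
  assumes "b \<in> borel_subgroup r" "i < r"
  shows "b $$ (i, i) \<noteq> 0"
proof -
  obtain b' where b': "b' \<in> borel_subgroup r" "b * b' = 1\<^sub>m r" using assms(1) by (rule borel_subgroupE)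
  have "b $$ (i, i) * b' $$ (i, i) = 1" using borel_mult_diag[OF assms(1) b'(1) assms(2)] b'(2) assms(2) by simp
  then show ?thesis by auto
qed

lemma borel_one: "1\<^sub>m r \<in> borel_subgroup r"
  by (auto simp: borel_subgroup_def intro!: GL_I[of _ _ "1\<^sub>m r"])

lemma borel_elim:
  assumes "m < r" "\<And>l. l < m \<Longrightarrow> v l = 0"
  shows "elim r m v \<in> borel_subgroup r" "i < r \<Longrightarrow> elim r m v $$ (i, i) = 1"
proof -
  have "elim r m v \<in> GL r" using elim_inverse[OF assms(1)] elim_inverse'[OF assms(1)] by (intro GL_I[of _ _ "elim r m (\<lambda>j. - v j)"]) auto
  moreover have "upper_triangular (elim r m v)" using assms(2) by (auto simp: elim_def)
  ultimately show "elim r m v \<in> borel_subgroup r" by (simp add: borel_subgroup_def)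
qed (simp add: elim_entry)

section \<open>Valuations, integral matrices and the Iwahori subgroup\<close>

context nonarch_local_field
begin

abbreviation frac :: "int \<Rightarrow> 'a set" where "frac n \<equiv> fractional_ideal ord n"

lemma frac_iff: "x \<in> frac n \<longleftrightarrow> x = 0 \<or> n \<le> ord x"
  by (simp add: fractional_ideal_def)

lemma frac_zero [simp]: "0 \<in> frac n"
  by (simp add: frac_iff)

lemma ord_one [simp]: "ord 1 = 0"
  using ord_mult[of 1 1] by simp

lemma ord_minus: "x \<noteq> 0 \<Longrightarrow> ord (- x) = ord x"
  using ord_mult[of "-1" "-1"] ord_mult[of "-1" x] by simp

lemma ord_inverse: "x \<noteq> 0 \<Longrightarrow> ord (inverse x) = - ord x"
  using ord_mult[of x "inverse x"] by simp

lemma ord_divide: "x \<noteq> 0 \<Longrightarrow> y \<noteq> 0 \<Longrightarrow> ord (x / y) = ord x - ord y"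
  using ord_mult[of x "inverse y"] ord_inverse[of y] by (simp add: divide_inverse)

lemma frac_one [simp]: "1 \<in> frac 0"
  by (simp add: frac_iff)

lemma frac_add: "x \<in> frac n \<Longrightarrow> y \<in> frac n \<Longrightarrow> x + y \<in> frac n"
  using ord_add[of x y] by (cases "x = 0"; cases "y = 0"; cases "x + y = 0") (auto simp: frac_iff)

lemma frac_minus: "x \<in> frac n \<Longrightarrow> - x \<in> frac n"
  by (cases "x = 0") (auto simp: frac_iff ord_minus)

lemma frac_diff: "x \<in> frac n \<Longrightarrow> y \<in> frac n \<Longrightarrow> x - y \<in> frac n"
  using frac_add[of x n "- y"] frac_minus by simp

lemma frac_mult: "x \<in> frac m \<Longrightarrow> y \<in> frac n \<Longrightarrow> x * y \<in> frac (m + n)"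
  by (cases "x = 0"; cases "y = 0") (auto simp: frac_iff ord_mult)

lemma frac_mult0: "x \<in> frac 0 \<Longrightarrow> y \<in> frac n \<Longrightarrow> x * y \<in> frac n"
  using frac_mult[of x 0 y n] by simp

lemma frac_mult0': "x \<in> frac n \<Longrightarrow> y \<in> frac 0 \<Longrightarrow> x * y \<in> frac n"
  using frac_mult[of x n y 0] by simp

lemma frac_mono: "x \<in> frac n \<Longrightarrow> m \<le> n \<Longrightarrow> x \<in> frac m"
  by (auto simp: frac_iff)

lemma frac_sum: "(\<And>l. l \<in> S \<Longrightarrow> f l \<in> frac n) \<Longrightarrow> (\<Sum>l\<in>S. f l) \<in> frac n"
  by (induction S rule: infinite_finite_induct) (auto intro: frac_add)

lemma one_notin_frac1: "1 \<notin> frac 1"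
  by (simp add: frac_iff)

lemma unit_iff: "x \<in> frac 0 \<Longrightarrow> x \<notin> frac 1 \<longleftrightarrow> x \<noteq> 0 \<and> ord x = 0"
  by (auto simp: frac_iff)

lemma divide_unit: "x \<in> frac n \<Longrightarrow> y \<in> frac 0 \<Longrightarrow> y \<notin> frac 1 \<Longrightarrow> x / y \<in> frac n"
  using unit_iff[of y] by (cases "x = 0") (auto simp: frac_iff ord_divide)

lemma unit_of_near_one: "x * y - 1 \<in> frac 1 \<Longrightarrow> x \<in> frac 0 \<Longrightarrow> y \<in> frac 0 \<Longrightarrow> x \<notin> frac 1"
proof
  assume *: "x * y - 1 \<in> frac 1" "y \<in> frac 0" "x \<in> frac 1"
  have "1 = x * y - (x * y - 1)" by simp
  also have "\<dots> \<in> frac 1" by (intro frac_diff frac_mult0' *)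
  finally show False using one_notin_frac1 by simp
qed

lemma entry_mult:
  assumes "A \<in> carrier_mat r r" "B \<in> carrier_mat r r" "i < r" "j < r"
    "\<And>i j. i < r \<Longrightarrow> j < r \<Longrightarrow> A $$ (i, j) \<in> frac m" "\<And>i j. i < r \<Longrightarrow> j < r \<Longrightarrow> B $$ (i, j) \<in> frac n"
  shows "(A * B) $$ (i, j) \<in> frac (m + n)"
  using assms by (subst mat_mult_entry[of A r B]) (auto intro!: frac_sum frac_mult)

abbreviation K :: "nat \<Rightarrow> 'a mat set" where "K r \<equiv> GL_integers ord r"
abbreviation J :: "nat \<Rightarrow> 'a mat set" where "J r \<equiv> iwahori ord r"

lemma K_entry: "k \<in> K r \<Longrightarrow> i < r \<Longrightarrow> j < r \<Longrightarrow> k $$ (i, j) \<in> frac 0"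
  by (simp add: GL_integers_def integral_mat_def)

lemma K_carrier: "k \<in> K r \<Longrightarrow> k \<in> carrier_mat r r"
  by (simp add: GL_integers_def integral_mat_def)

lemma K_inverse:
  assumes "k \<in> K r"
  obtains k' where "k' \<in> K r" "k * k' = 1\<^sub>m r" "k' * k = 1\<^sub>m r"
  using assms unfolding GL_integers_def by blast

lemma K_GL: "k \<in> K r \<Longrightarrow> k \<in> GL r"
  by (metis GL_I K_carrier K_inverse)

lemma integral_mat_mult: "integral_mat ord r A \<Longrightarrow> integral_mat ord r B \<Longrightarrow> integral_mat ord r (A * B)"
  using entry_mult[of A r B _ _ 0 0] by (auto simp: integral_mat_def)

lemma mult_inverse_pair:
  fixes A :: "'b::field mat"
  assumes "A \<in> carrier_mat r r" "A' \<in> carrier_mat r r" "B \<in> carrier_mat r r" "B' \<in> carrier_mat r r"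
    "A * A' = 1\<^sub>m r" "B * B' = 1\<^sub>m r"
  shows "A * B * (B' * A') = 1\<^sub>m r"
proof -
  have "A * B * (B' * A') = A * (B * (B' * A'))" using assms by (intro mat_assoc[of _ r]) auto
  also have "B * (B' * A') = B * B' * A'" using assms by (intro mat_assoc[of _ r, symmetric]) auto
  finally show ?thesis using assms by simp
qed

lemma K_mult:
  assumes "k \<in> K r" "l \<in> K r"
  shows "k * l \<in> K r"
proof -
  obtain k' where k': "k' \<in> K r" "k * k' = 1\<^sub>m r" "k' * k = 1\<^sub>m r" using assms(1) by (rule K_inverse)
  obtain l' where l': "l' \<in> K r" "l * l' = 1\<^sub>m r" "l' * l = 1\<^sub>m r" using assms(2) by (rule K_inverse)
  note c = assms[THEN K_carrier] k'(1)[THEN K_carrier] l'(1)[THEN K_carrier]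
  have "k * l * (l' * k') = 1\<^sub>m r" "l' * k' * (k * l) = 1\<^sub>m r"
    by (rule mult_inverse_pair; use c k' l' in simp)+
  moreover have "integral_mat ord r (k * l)" "integral_mat ord r (l' * k')"
    using assms k' l' by (auto intro!: integral_mat_mult simp: GL_integers_def)
  ultimately show ?thesis unfolding GL_integers_def by blast
qed

lemma K_one: "1\<^sub>m r \<in> K r"
  unfolding GL_integers_def integral_mat_def by (auto intro!: exI[of _ "1\<^sub>m r"])

lemma iwahori_iff: "k \<in> J r \<longleftrightarrow> k \<in> K r \<and> (\<forall>i<r. \<forall>j<i. k $$ (i, j) \<in> frac 1)"
  by (simp add: iwahori_def)

lemma iwahori_mult:
  assumes "k \<in> J r" "l \<in> J r"
  shows "k * l \<in> J r"
proof -
  have kl: "k \<in> K r" "l \<in> K r" using assms by (auto simp: iwahori_iff)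
  have "(k * l) $$ (i, j) \<in> frac 1" if "i < r" "j < i" for i j
  proof -
    have "(k * l) $$ (i, j) = (\<Sum>m<r. k $$ (i, m) * l $$ (m, j))"
      by (rule mat_mult_entry) (use kl K_carrier that in auto)
    also have "\<dots> \<in> frac 1"
    proof (rule frac_sum)
      fix m assume m: "m \<in> {..<r}"
      show "k $$ (i, m) * l $$ (m, j) \<in> frac 1"
      proof (cases "m < i")
        case True
        then show ?thesis using assms kl that m by (intro frac_mult0') (auto simp: iwahori_iff intro!: K_entry[of l])
      next
        case False
        then show ?thesis using assms kl that m by (intro frac_mult0) (auto simp: iwahori_iff intro!: K_entry[of k])
      qed
    qed
    finally show ?thesis .
  qed
  then show ?thesis using K_mult[OF kl] by (simp add: iwahori_iff)
qed

lemma iwahori_one: "1\<^sub>m r \<in> J r"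
  using K_one by (auto simp: iwahori_iff)

lemma iwahori_inverse_aux:
  assumes "k \<in> J r" "k' \<in> K r" "k * k' = 1\<^sub>m r" "i < r"
  shows "(\<forall>j<i. k' $$ (i, j) \<in> frac 1) \<and> k $$ (i, i) * k' $$ (i, i) - 1 \<in> frac 1"
  by (rule inverse_lower_entries[of k r k' "frac 1" "frac 0"])
     (use assms K_carrier in \<open>auto simp: iwahori_iff intro: frac_add frac_mult0 frac_minus K_entry\<close>)

lemma iwahori_inverse:
  assumes "k \<in> J r"
  obtains k' where "k' \<in> J r" "k * k' = 1\<^sub>m r" "k' * k = 1\<^sub>m r"
proof -
  obtain k' where k': "k' \<in> K r" "k * k' = 1\<^sub>m r" "k' * k = 1\<^sub>m r"
    using assms K_inverse by (auto simp: iwahori_iff)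
  then have "k' \<in> J r" using iwahori_inverse_aux[OF assms k'(1,2)] by (simp add: iwahori_iff)
  then show ?thesis using that k' by blast
qed

lemma iwahori_diag_unit:
  assumes "k \<in> J r" "i < r"
  shows "k $$ (i, i) \<notin> frac 1"
proof -
  obtain k' where k': "k' \<in> J r" "k * k' = 1\<^sub>m r" using assms(1) by (rule iwahori_inverse)
  then have K: "k \<in> K r" "k' \<in> K r" using assms by (auto simp: iwahori_iff)
  from iwahori_inverse_aux[OF assms(1) K(2) k'(2) assms(2)]
  show ?thesis using unit_of_near_one K_entry K assms(2) by blast
qed

lemma iwahori_K: "k \<in> J r \<Longrightarrow> k \<in> K r"
  by (simp add: iwahori_iff)

lemma elim_K:
  assumes "m < r" "\<And>l. l < r \<Longrightarrow> l \<noteq> m \<Longrightarrow> v l \<in> frac 0"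
  shows "elim r m v \<in> K r"
proof -
  have "integral_mat ord r (elim r m u)" if "\<And>l. l < r \<Longrightarrow> l \<noteq> m \<Longrightarrow> u l \<in> frac 0" for u
    using that by (simp add: integral_mat_def elim_entry)
  from this[of v] this[of "\<lambda>l. - v l"] have "integral_mat ord r (elim r m v)" "integral_mat ord r (elim r m (\<lambda>l. - v l))"
    using assms(2) frac_minus by blast+
  then show ?thesis
    unfolding GL_integers_def
    using elim_inverse[OF assms(1), of v] elim_inverse'[OF assms(1), of v] by blast
qed

lemma elim_J:
  assumes "m < r" "\<And>l. l < r \<Longrightarrow> l \<noteq> m \<Longrightarrow> v l \<in> frac 0" "\<And>l. l < m \<Longrightarrow> v l \<in> frac 1"
  shows "elim r m v \<in> J r"
  using elim_K[OF assms(1,2)] assms by (auto simp: iwahori_iff elim_entry)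

lemma perm_mat_K: "w permutes {..<r} \<Longrightarrow> perm_mat r w \<in> K r"
proof -
  assume w: "w permutes {..<r}"
  have "integral_mat ord r (perm_mat r v)" for v by (auto simp: integral_mat_def perm_mat_def)
  then show ?thesis
    unfolding GL_integers_def using perm_mat_inverse[OF w] by blast
qed

text \<open>The equation is rewritten as d w = w' m with d in the Borel subgroup and m in the
  Iwahori subgroup. The diagonal entries of m are units and occur in d at the positions (w' i, w i),
  which must lie on or above the diagonal.\<close>

lemma iwahori_decomposition_unique:
  assumes b: "b \<in> borel_subgroup r" "b' \<in> borel_subgroup r" and k: "k \<in> J r" "k' \<in> J r"
    and w: "w permutes {..<r}" "w' permutes {..<r}"
    and eq: "b * perm_mat r w * k = b' * perm_mat r w' * k'"
  shows "w = w'" "i < r \<Longrightarrow> ord (b $$ (i, i)) = ord (b' $$ (i, i))"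
proof -
  obtain c where c: "c \<in> borel_subgroup r" "b' * c = 1\<^sub>m r" "c * b' = 1\<^sub>m r" using b(2) by (rule borel_subgroupE)
  obtain l where l: "l \<in> J r" "k * l = 1\<^sub>m r" "l * k = 1\<^sub>m r" using k(1) by (rule iwahori_inverse)
  have cm: "b \<in> carrier_mat r r" "b' \<in> carrier_mat r r" "c \<in> carrier_mat r r"
    "k \<in> carrier_mat r r" "k' \<in> carrier_mat r r" "l \<in> carrier_mat r r"
    using b c k l K_carrier by (auto simp: borel_subgroup_def GL_def iwahori_iff)
  define d where "d = c * b"
  define m where "m = k' * l"
  have d: "d \<in> borel_subgroup r" using c b borel_subgroup_mult by (simp add: d_def)
  have m: "m \<in> J r" using k l iwahori_mult by (simp add: m_def)
  have cd: "d \<in> carrier_mat r r" "m \<in> carrier_mat r r" using cm by (simp_all add: d_def m_def)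
  have "d * perm_mat r w = c * (b * perm_mat r w * k) * l"
  proof -
    have "c * (b * perm_mat r w * k) * l = c * (b * perm_mat r w * k * l)"
      using cm by (intro mat_assoc[of _ r]) auto
    also have "b * perm_mat r w * k * l = b * perm_mat r w * (k * l)"
      using cm by (intro mat_assoc[of _ r]) auto
    also have "\<dots> = b * perm_mat r w"
      unfolding l(2) by (rule right_mult_one_mat[of _ r r]) (rule mult_carrier_mat[OF cm(1) perm_mat_carrier])
    also have "c * (b * perm_mat r w) = d * perm_mat r w"
      unfolding d_def using cm by (intro mat_assoc[of _ r, symmetric]) auto
    finally show ?thesis by simp
  qed
  also have "\<dots> = c * (b' * perm_mat r w' * k') * l" by (simp only: eq)
  also have "\<dots> = perm_mat r w' * m"
  proof -
    have "c * (b' * perm_mat r w' * k') * l = c * (b' * perm_mat r w' * k' * l)"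
      using cm by (intro mat_assoc[of _ r]) auto
    also have "b' * perm_mat r w' * k' * l = b' * perm_mat r w' * m"
      unfolding m_def using cm by (intro mat_assoc[of _ r]) auto
    also have "\<dots> = b' * (perm_mat r w' * m)" using cm cd by (intro mat_assoc[of _ r]) auto
    also have "c * \<dots> = c * b' * (perm_mat r w' * m)" using cm cd by (intro mat_assoc[of _ r, symmetric]) auto
    finally show ?thesis using c cd left_mult_one_mat[OF mat_mult_closed[OF perm_mat_carrier cd(2), of w']] by simp
  qed
  finally have dm: "d * perm_mat r w = perm_mat r w' * m" .
  have entry: "d $$ (w' i, w i) = m $$ (i, i)" if "i < r" for i
  proof -
    have "w' i < r" using permutes_in_image[OF w(2), of i] that by simp
    then show ?thesis
      using mult_perm_mat_entry[OF cd(1) w(1), of "w' i" i] perm_mat_mult_entry[OF cd(2) w(2) that that] that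
      by (simp add: dm)
  qed
  have le: "w' i \<le> w i" if "i < r" for i
  proof (rule ccontr)
    assume "\<not> w' i \<le> w i"
    moreover have "w' i < r" using permutes_in_image[OF w(2), of i] that by simp
    moreover have "upper_triangular d" using d by (simp add: borel_subgroup_def)
    ultimately have "d $$ (w' i, w i) = 0" using cd by auto
    then show False using entry[OF that] iwahori_diag_unit[OF m that] by simp
  qed
  \<comment> \<open>A permutation of an initial segment that never exceeds its argument is the
    identity.\<close>
  have "w' \<circ> inv_into UNIV w = id"
  proof (rule permutes_natset_le)
    show "w' \<circ> inv_into UNIV w permutes {..<r}" by (rule permutes_compose[OF permutes_inv[OF w(1)] w(2)])
    show "\<forall>i\<in>{..<r}. (w' \<circ> inv_into UNIV w) i \<le> i"
    proof
      fix i assume "i \<in> {..<r}"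
      then have "inv_into UNIV w i < r" using permutes_in_image[OF permutes_inv[OF w(1)], of i] by simp
      from le[OF this] show "(w' \<circ> inv_into UNIV w) i \<le> i" by (simp add: permutes_inverses[OF w(1)])
    qed
  qed
  then have "w' \<circ> inv_into UNIV w \<circ> w = w" by simp
  then show ww: "w = w'" by (simp add: comp_assoc permutes_inv_o[OF w(1)])
  show "ord (b $$ (i, i)) = ord (b' $$ (i, i))" if ir: "i < r"
  proof -
    obtain j where j: "j < r" "w j = i"
      using permutes_in_image[OF permutes_inv[OF w(1)], of i] permutes_inverses(1)[OF w(1), of i] ir by auto
    have "ord (d $$ (i, i)) = 0"
      using entry[OF j(1)] j ww unit_iff[of "m $$ (j, j)"] iwahori_diag_unit[OF m j(1)] m K_entry by (auto simp: iwahori_iff)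
    moreover have "b' * d = b"
    proof -
      have "b' * d = b' * c * b" unfolding d_def using cm by (intro mat_assoc[of _ r, symmetric]) auto
      then show ?thesis using c cm by simp
    qed
    then have "b $$ (i, i) = b' $$ (i, i) * d $$ (i, i)" using borel_mult_diag[OF b(2) d ir] by simp
    ultimately show ?thesis
      using ord_mult[of "b' $$ (i, i)" "d $$ (i, i)"] borel_diag_nonzero[OF b(2) ir] borel_diag_nonzero[OF d ir] by simp
  qed
qed

lemma iwahori_elimination:
  assumes g: "g \<in> carrier_mat r r"
  shows "n \<le> r \<Longrightarrow> \<exists>k\<in>J r. \<exists>\<pi>. inj_on \<pi> {r - n..<r} \<and> \<pi> ` {r - n..<r} \<subseteq> {..<r} \<and>
    (\<forall>i\<in>{r - n..<r}. \<forall>j<r. j \<notin> \<pi> ` {i..<r} \<longrightarrow> (g * k) $$ (i, j) = 0)"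
proof (induction n)
  case 0
  then show ?case using iwahori_one by auto
next
  case (Suc n)
  then obtain k \<pi> where k: "k \<in> J r" and inj: "inj_on \<pi> {r - n..<r}" and im: "\<pi> ` {r - n..<r} \<subseteq> {..<r}"
    and z: "\<And>i j. i \<in> {r - n..<r} \<Longrightarrow> j < r \<Longrightarrow> j \<notin> \<pi> ` {i..<r} \<Longrightarrow> (g * k) $$ (i, j) = 0" by auto
  have kc: "k \<in> carrier_mat r r" using k K_carrier by (auto simp: iwahori_iff)
  define h where "h = g * k"
  have hc: "h \<in> carrier_mat r r" using g kc by (simp add: h_def)
  define a where "a = r - Suc n"
  have a: "a < r" "r - n = Suc a" using Suc.prems by (auto simp: a_def)
  define U where "U = {..<r} - \<pi> ` {r - n..<r}"
  have "card (\<pi> ` {r - n..<r}) < card {..<r}" using card_image[OF inj] Suc.prems by auto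
  then have "U \<noteq> {}" unfolding U_def using im by (metis Diff_eq_empty_iff card_mono finite_lessThan finite_imageI finite_atLeastLessThan leD)
  define Z where "Z = {j \<in> U. h $$ (a, j) \<noteq> 0}"
  obtain p where p: "p \<in> U" and pmin: "\<And>j. j \<in> Z \<Longrightarrow> h $$ (a, p) \<noteq> 0 \<and>
      (if p < j then ord (h $$ (a, p)) \<le> ord (h $$ (a, j)) else j < p \<longrightarrow> ord (h $$ (a, p)) < ord (h $$ (a, j)))"
  proof (cases "Z = {}")
    case True
    then show ?thesis using that \<open>U \<noteq> {}\<close> by blast
  next
    case False
    have fin: "finite Z" by (simp add: Z_def U_def)
    define e where "e = Min ((\<lambda>j. ord (h $$ (a, j))) ` Z)"
    have e: "e \<le> ord (h $$ (a, j))" if "j \<in> Z" for j using fin that by (simp add: e_def)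
    define Y where "Y = {j \<in> Z. ord (h $$ (a, j)) = e}"
    have "Y \<noteq> {}"
    proof -
      have "e \<in> (\<lambda>j. ord (h $$ (a, j))) ` Z" unfolding e_def using fin False by (intro Min_in) auto
      then show ?thesis by (auto simp: Y_def)
    qed
    have finY: "finite Y" using fin by (simp add: Y_def)
    define p where "p = Min Y"
    have pY: "p \<in> Y" unfolding p_def using finY \<open>Y \<noteq> {}\<close> by (rule Min_in)
    show ?thesis
    proof (rule that[of p])
      show "p \<in> U" using pY by (simp add: Y_def Z_def)
      fix j assume j: "j \<in> Z"
      have "j \<notin> Y" if "j < p" using Min_le[OF finY, of j] that by (auto simp: p_def)
      then show "h $$ (a, p) \<noteq> 0 \<and>
        (if p < j then ord (h $$ (a, p)) \<le> ord (h $$ (a, j)) else j < p \<longrightarrow> ord (h $$ (a, p)) < ord (h $$ (a, j)))"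
        using pY e[OF j] j by (auto simp: Y_def Z_def)
    qed
  qed
  have pr: "p < r" using p by (simp add: U_def)
  define v where "v j = (if j \<in> U then - h $$ (a, j) / h $$ (a, p) else 0)" for j
  have v: "v j \<in> frac (if j < p then 1 else 0)" if "j \<noteq> p" for j
  proof (cases "j \<in> Z")
    case True
    then show ?thesis using pmin[OF True] that by (auto simp: v_def frac_iff Z_def ord_divide ord_minus)
  next
    case False
    then show ?thesis by (auto simp: v_def Z_def)
  qed
  define l where "l = elim r p v"
  have "l \<in> J r" unfolding l_def
  proof (rule elim_J[OF pr])
    show "v j \<in> frac 0" if "j \<noteq> p" for j using v[OF that] frac_mono by (auto split: if_splits)
    show "v j \<in> frac 1" if "j < p" for j using v[of j] that by auto
  qed
  then have kl: "k * l \<in> J r" using k iwahori_mult by blast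
  have lc: "l \<in> carrier_mat r r" by (simp add: l_def)
  have gkl: "g * (k * l) = h * l" unfolding h_def using g kc lc by (intro mat_assoc[of _ r, symmetric]) auto
  have hl: "(h * l) $$ (i, j) = h $$ (i, j) + (if j = p then 0 else h $$ (i, p) * v j)" if "i < r" "j < r" for i j
    unfolding l_def by (rule mult_elim_entry[OF hc that pr])
  define \<pi>' where "\<pi>' = \<pi>(a := p)"
  have \<pi>': "\<pi>' ` {i..<r} = \<pi> ` {i..<r}" if "a < i" for i
    using that by (auto simp: \<pi>'_def)
  have ivl: "{r - Suc n..<r} = insert a {r - n..<r}" using a by (auto simp: a_def)
  have \<pi>'a: "\<pi>' ` {a..<r} = insert p (\<pi> ` {r - n..<r})"
    using ivl a by (auto simp: \<pi>'_def a_def)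
  show ?case
  proof (intro bexI[OF _ kl] exI[of _ \<pi>'] conjI ballI allI impI)
    have "inj_on \<pi>' {r - n..<r}" using inj a by (auto simp: \<pi>'_def inj_on_def)
    moreover have "\<pi>' a \<notin> \<pi>' ` {r - n..<r}" using p a \<pi>'[of "r - n"] by (simp add: \<pi>'_def U_def)
    ultimately show "inj_on \<pi>' {r - Suc n..<r}" unfolding ivl by (subst inj_on_insert) auto
    show "\<pi>' ` {r - Suc n..<r} \<subseteq> {..<r}" using \<pi>'a im pr by (simp add: a_def)
    fix i j assume i: "i \<in> {r - Suc n..<r}" and j: "j < r" "j \<notin> \<pi>' ` {i..<r}"
    show "(g * (k * l)) $$ (i, j) = 0"
    proof (cases "i = a")
      case True
      then have jU: "j \<in> U" "j \<noteq> p" using j \<pi>'a by (auto simp: U_def)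
      show ?thesis
      proof (cases "j \<in> Z")
        case True
        then show ?thesis using hl[of i j] pmin[OF True] j \<open>i = a\<close> a jU gkl by (simp add: v_def)
      next
        case False
        then show ?thesis using hl[of i j] j \<open>i = a\<close> a jU gkl by (simp add: v_def Z_def)
      qed
    next
      case False
      then have i': "i \<in> {r - n..<r}" using i ivl by auto
      then have "a < i" using a by auto
      have 1: "h $$ (i, j) = 0" using z[OF i' j(1)] j(2) \<pi>'[OF \<open>a < i\<close>] by (simp add: h_def)
      have "p \<notin> \<pi> ` {i..<r}" using p i' by (auto simp: U_def)
      then have "h $$ (i, p) = 0" using z[OF i' pr] by (simp add: h_def)
      then show ?thesis using hl[of i j] i' j 1 gkl by simp
    qed
  qed
qed

lemma iwahori_decomposition:
  assumes g: "g \<in> GL r"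
  obtains b w k where "b \<in> borel_subgroup r" "w permutes {..<r}" "k \<in> J r" "g = b * perm_mat r w * k"
proof -
  have gc: "g \<in> carrier_mat r r" using g by (rule GL_carrier)
  from iwahori_elimination[OF gc order_refl]
  obtain k \<pi> where k: "k \<in> J r" and inj: "inj_on \<pi> {..<r}" and im: "\<pi> ` {..<r} \<subseteq> {..<r}"
    and z: "\<And>i j. i < r \<Longrightarrow> j < r \<Longrightarrow> j \<notin> \<pi> ` {i..<r} \<Longrightarrow> (g * k) $$ (i, j) = 0"
    by (auto simp: atLeast0LessThan)
  define p where "p i = (if i < r then \<pi> i else i)" for i
  have p: "p permutes {..<r}"
  proof (rule bij_imp_permutes)
    have "\<pi> ` {..<r} = {..<r}" using inj im by (simp add: endo_inj_surj)
    then show "bij_betw p {..<r} {..<r}" using inj by (auto simp: bij_betw_def p_def inj_on_def)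
  qed (simp add: p_def)
  define w where "w = inv_into UNIV p"
  have w: "w permutes {..<r}" unfolding w_def by (rule permutes_inv[OF p])
  have iw: "inv_into UNIV w = p" unfolding w_def by (rule inv_inv_eq[OF permutes_bij[OF p]])
  obtain l where l: "l \<in> J r" "k * l = 1\<^sub>m r" "l * k = 1\<^sub>m r" using k by (rule iwahori_inverse)
  have c: "k \<in> carrier_mat r r" "l \<in> carrier_mat r r" using k l K_carrier by (auto simp: iwahori_iff)
  \<comment> \<open>Row i of \<open>g * k\<close> is supported on the pivots of the rows i, i + 1,
    ..., so putting the columns in the order of their pivots yields a triangular matrix.\<close>
  define b where "b = g * k * perm_mat r p"
  have "b \<in> GL r" unfolding b_def using g k p by (intro GL_mult perm_mat_GL) (auto simp: iwahori_iff intro: K_GL)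
  moreover have "b $$ (i, j) = 0" if "i < r" "j < i" for i j
  proof -
    have "b $$ (i, j) = (g * k) $$ (i, p j)"
      unfolding b_def by (rule mult_perm_mat_entry) (use gc c p that in auto)
    moreover have "p j \<notin> \<pi> ` {i..<r}"
    proof
      assume "p j \<in> \<pi> ` {i..<r}"
      moreover have "p j = \<pi> j" using that by (simp add: p_def)
      ultimately obtain m where "m \<in> {i..<r}" "\<pi> j = \<pi> m" by auto
      then show False using inj_onD[OF inj, of j m] that by auto
    qed
    moreover have "p j < r" using permutes_in_image[OF p, of j] that by simp
    ultimately show ?thesis using z that by simp
  qed
  ultimately have "b \<in> borel_subgroup r"
    using GL_carrier[of b r] unfolding borel_subgroup_def upper_triangular_def by auto
  moreover have "b * perm_mat r w * l = g"
  proof -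
    have "b * perm_mat r w = g * k * (perm_mat r p * perm_mat r w)"
      unfolding b_def using gc c by (intro mat_assoc[of _ r]) auto
    also have "perm_mat r p * perm_mat r w = (1\<^sub>m r :: 'a mat)"
      unfolding w_def by (rule perm_mat_inverse[OF p])
    finally have "b * perm_mat r w = g * k" using gc c by simp
    moreover have "g * k * l = g * (k * l)" using gc c by (intro mat_assoc[of _ r]) auto
    ultimately show ?thesis using l gc by simp
  qed
  ultimately show ?thesis using that w l by blast
qed

end

section \<open>Iwahori fixed vectors\<close>

lemma torus_elt_carrier [simp]: "torus_elt p r e \<in> carrier_mat r r"
  by (simp add: torus_elt_def)

lemma torus_mult_entry:
  fixes A :: "'a::field mat"
  assumes "A \<in> carrier_mat r r" "i < r" "j < r"
  shows "(torus_elt p r e * A) $$ (i, j) = p powi e i * A $$ (i, j)"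
    and "(A * torus_elt p r e) $$ (i, j) = A $$ (i, j) * p powi e j"
proof -
  have "(torus_elt p r e * A) $$ (i, j) = (\<Sum>l<r. torus_elt p r e $$ (i, l) * A $$ (l, j))"
    by (rule mat_mult_entry) (use assms in auto)
  also have "\<dots> = (\<Sum>l<r. if l = i then p powi e i * A $$ (i, j) else 0)"
    using assms by (intro sum.cong) (auto simp: torus_elt_def)
  finally show "(torus_elt p r e * A) $$ (i, j) = p powi e i * A $$ (i, j)" using assms by simp
  have "(A * torus_elt p r e) $$ (i, j) = (\<Sum>l<r. A $$ (i, l) * torus_elt p r e $$ (l, j))"
    by (rule mat_mult_entry) (use assms in auto)
  also have "\<dots> = (\<Sum>l<r. if l = j then A $$ (i, j) * p powi e j else 0)"
    using assms by (intro sum.cong) (auto simp: torus_elt_def)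
  finally show "(A * torus_elt p r e) $$ (i, j) = A $$ (i, j) * p powi e j" using assms by simp
qed

lemma torus_entry: "i < r \<Longrightarrow> j < r \<Longrightarrow> torus_elt p r e $$ (i, j) = (if i = j then p powi e i else 0)"
  by (simp add: torus_elt_def)

lemma mat_eqI:
  assumes "A \<in> carrier_mat r r" "B \<in> carrier_mat r r" "\<And>i j. i < r \<Longrightarrow> j < r \<Longrightarrow> A $$ (i, j) = B $$ (i, j)"
  shows "A = B"
  by (rule eq_matI) (use assms in auto)

lemma torus_add:
  assumes "p \<noteq> (0::'a::field)"
  shows "torus_elt p r e * torus_elt p r f = torus_elt p r (\<lambda>i. e i + f i)"
  by (rule mat_eqI[where r = r]) (use assms in \<open>auto simp: torus_mult_entry torus_entry power_int_add simp del: index_mult_mat\<close>)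

lemma torus_zero: "torus_elt p r (\<lambda>_. 0) = 1\<^sub>m r"
  by (rule mat_eqI[where r = r]) (auto simp: torus_entry)

lemma torus_inverse:
  assumes "p \<noteq> (0::'a::field)"
  shows "torus_elt p r e * torus_elt p r (\<lambda>i. - e i) = 1\<^sub>m r" "torus_elt p r (\<lambda>i. - e i) * torus_elt p r e = 1\<^sub>m r"
  using torus_add[OF assms, of r e "\<lambda>i. - e i"] torus_add[OF assms, of r "\<lambda>i. - e i" e] torus_zero[of p r] by simp_all

lemma torus_borel:
  assumes "p \<noteq> (0::'a::field)"
  shows "torus_elt p r e \<in> borel_subgroup r"
proof -
  have "torus_elt p r e \<in> GL r" using torus_inverse[OF assms] by (intro GL_I[of _ _ "torus_elt p r (\<lambda>i. - e i)"]) auto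
  then show ?thesis by (auto simp: borel_subgroup_def upper_triangular_def torus_elt_def)
qed

lemma perm_torus:
  fixes p :: "'a::field"
  assumes w: "w permutes {..<r}"
  shows "perm_mat r w * torus_elt p r e = torus_elt p r (\<lambda>i. e (inv_into UNIV w i)) * perm_mat r w"
proof (rule mat_eqI[where r = r])
  fix i j assume "i < r" "j < r"
  define m where "m = inv_into UNIV w i"
  have m: "m < r" "i = w m"
    using permutes_in_image[OF permutes_inv[OF w], of i] permutes_inverses(1)[OF w, of i] \<open>i < r\<close> by (auto simp: m_def)
  have "w j < r" using permutes_in_image[OF w, of j] \<open>j < r\<close> by simp
  have "(perm_mat r w * torus_elt p r e) $$ (i, j) = (torus_elt p r e :: 'a mat) $$ (m, j)"
    unfolding m(2) by (rule perm_mat_mult_entry) (use w m \<open>j < r\<close> in auto)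
  moreover have "(torus_elt p r (\<lambda>i. e (inv_into UNIV w i)) * perm_mat r w) $$ (i, j) =
     torus_elt p r (\<lambda>i. e (inv_into UNIV w i)) $$ (i, w j)"
    by (rule mult_perm_mat_entry) (use w \<open>i < r\<close> \<open>j < r\<close> in auto)
  moreover have "i = w j \<longleftrightarrow> m = j" using m permutes_inj[OF w] by (auto dest: injD)
  ultimately show "(perm_mat r w * torus_elt p r e) $$ (i, j) =
     (torus_elt p r (\<lambda>i. e (inv_into UNIV w i)) * perm_mat r w) $$ (i, j)"
    using \<open>i < r\<close> \<open>j < r\<close> m(1) \<open>w j < r\<close> by (simp add: torus_entry m_def[symmetric])
qed auto

lemma perm_elim:
  fixes v :: "nat \<Rightarrow> 'a::field"
  assumes w: "w permutes {..<r}"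
  shows "perm_mat r w * elim r m v = elim r (w m) (\<lambda>i. v (inv_into UNIV w i)) * perm_mat r w"
proof (rule mat_eqI[where r = r])
  fix i j assume "i < r" "j < r"
  define l where "l = inv_into UNIV w i"
  have l: "l < r" "i = w l"
    using permutes_in_image[OF permutes_inv[OF w], of i] permutes_inverses(1)[OF w, of i] \<open>i < r\<close> by (auto simp: l_def)
  have "w j < r" using permutes_in_image[OF w, of j] \<open>j < r\<close> by simp
  have "(perm_mat r w * elim r m v) $$ (i, j) = elim r m v $$ (l, j)"
    unfolding l(2) by (rule perm_mat_mult_entry) (use w l \<open>j < r\<close> in auto)
  moreover have "(elim r (w m) (\<lambda>i. v (inv_into UNIV w i)) * perm_mat r w) $$ (i, j) =
     elim r (w m) (\<lambda>i. v (inv_into UNIV w i)) $$ (i, w j)"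
    by (rule mult_perm_mat_entry) (use w \<open>i < r\<close> \<open>j < r\<close> in auto)
  moreover have "i = w j \<longleftrightarrow> l = j" "i = w m \<longleftrightarrow> l = m" using l permutes_inj[OF w] by (auto dest: injD)
  ultimately show "(perm_mat r w * elim r m v) $$ (i, j) =
     (elim r (w m) (\<lambda>i. v (inv_into UNIV w i)) * perm_mat r w) $$ (i, j)"
    using \<open>i < r\<close> \<open>j < r\<close> l(1) \<open>w j < r\<close> by (simp add: elim_entry permutes_inverses(2)[OF w])
qed auto

context nonarch_local_field
begin

text \<open>The value of the product of the square root of the modular character and the unramified
  character, as a function of the exponents on the diagonal.\<close>

definition cell_value :: "nat \<Rightarrow> (nat \<Rightarrow> complex) \<Rightarrow> (nat \<Rightarrow> int) \<Rightarrow> complex" where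
  "cell_value r z e = complex_of_real (sqrt (real (residue_card ord) powr (- pair r (\<lambda>i. 2 * weyl_vector r i) e))) * monomial r z e"

lemma cell_value_cong: "(\<And>i. i < r \<Longrightarrow> e i = f i) \<Longrightarrow> cell_value r z e = cell_value r z f"
  by (simp add: cell_value_def pair_def monomial_def)

text \<open>Uniqueness of the permutation and of the diagonal valuations makes the definite
  description well defined.\<close>

lemma iwahori_vector_cell:
  assumes "b \<in> borel_subgroup r" "v permutes {..<r}" "k \<in> J r"
  shows "iwahori_vector ord r z w (b * perm_mat r v * k) = (if v = w then cell_value r z (borel_weight ord b) else 0)"
  unfolding iwahori_vector_def
proof (rule the_equality)
  show "\<exists>b'\<in>borel_subgroup r. \<exists>w'. \<exists>k'\<in>J r. w' permutes {..<r} \<and>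
       b * perm_mat r v * k = b' * perm_mat r w' * k' \<and>
       (if v = w then cell_value r z (borel_weight ord b) else 0) =
       (if w' = w then complex_of_real (sqrt (modular_character ord r b')) * unramified_character ord r z b' else 0)"
    using assms by (intro bexI[of _ b] exI[of _ v] bexI[of _ k])
      (auto simp: cell_value_def modular_character_def unramified_character_def)
  fix x assume "\<exists>b'\<in>borel_subgroup r. \<exists>w'. \<exists>k'\<in>J r. w' permutes {..<r} \<and>
       b * perm_mat r v * k = b' * perm_mat r w' * k' \<and>
       x = (if w' = w then complex_of_real (sqrt (modular_character ord r b')) * unramified_character ord r z b' else 0)"
  then obtain b' w' k' where d: "b' \<in> borel_subgroup r" "k' \<in> J r" "w' permutes {..<r}"
      "b * perm_mat r v * k = b' * perm_mat r w' * k'"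
    and x: "x = (if w' = w then complex_of_real (sqrt (modular_character ord r b')) * unramified_character ord r z b' else 0)"
    by blast
  note u = iwahori_decomposition_unique[OF assms(1) d(1) assms(3) d(2) assms(2) d(3,4)]
  have "cell_value r z (borel_weight ord b) = cell_value r z (borel_weight ord b')"
    by (rule cell_value_cong) (simp add: borel_weight_def u(2))
  then show "x = (if v = w then cell_value r z (borel_weight ord b) else 0)"
    using x u(1) by (simp add: cell_value_def modular_character_def unramified_character_def)
qed

lemma iwahori_vector_right:
  assumes "g \<in> GL r" "k \<in> J r"
  shows "iwahori_vector ord r z w (g * k) = iwahori_vector ord r z w g"
proof -
  obtain b v l where d: "b \<in> borel_subgroup r" "v permutes {..<r}" "l \<in> J r" "g = b * perm_mat r v * l"
    using assms(1) by (rule iwahori_decomposition)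
  have "g * k = b * perm_mat r v * (l * k)"
    unfolding d(4) using d assms(2) K_carrier[OF iwahori_K] by (intro mat_assoc[of _ r]) (auto simp: borel_subgroup_def GL_carrier)
  then show ?thesis
    using iwahori_vector_cell[OF d(1,2) iwahori_mult[OF d(3) assms(2)], of z w] iwahori_vector_cell[OF d(1-3), of z w] d(4) by simp
qed

section \<open>Root elements and simple reflections\<close>

lemma adj_permutes: "Suc i < r \<Longrightarrow> adj i permutes {..<r}"
  by (rule permutes_swap_id) auto

definition root_elt :: "nat \<Rightarrow> nat \<Rightarrow> nat \<Rightarrow> 'a \<Rightarrow> 'a mat" where
  "root_elt r i j a = elim r i (\<lambda>l. if l = j then a else 0)"

lemma root_elt_carrier [simp]: "root_elt r i j a \<in> carrier_mat r r"
  by (simp add: root_elt_def)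

lemma mult_root_entry:
  assumes "A \<in> carrier_mat r r" "p < r" "q < r" "i < r" "i \<noteq> j"
  shows "(A * root_elt r i j a) $$ (p, q) = A $$ (p, q) + (if q = j then A $$ (p, i) * a else 0)"
  using mult_elim_entry[OF assms(1-4)] assms(5) by (auto simp: root_elt_def)

lemma root_mult_entry:
  assumes "A \<in> carrier_mat r r" "p < r" "q < r" "i < r" "j < r" "i \<noteq> j"
  shows "(root_elt r i j a * A) $$ (p, q) = A $$ (p, q) + (if p = i then a * A $$ (j, q) else 0)"
proof -
  have "(\<Sum>l\<in>{..<r} - {i}. (if l = j then a else 0) * A $$ (l, q)) = (\<Sum>l\<in>{..<r} - {i}. if l = j then a * A $$ (j, q) else 0)"
    by (intro sum.cong) auto
  then show ?thesis
    using elim_mult_entry[OF assms(1-4), of "\<lambda>l. if l = j then a else 0"] assms by (auto simp: root_elt_def)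
qed

lemma root_elt_inverse:
  assumes "i < r"
  shows "root_elt r i j a * root_elt r i j (- a) = 1\<^sub>m r"
proof -
  have "(\<lambda>l. - (if l = j then a else 0)) = (\<lambda>l. if l = j then - a else 0)" by auto
  then show ?thesis using elim_inverse[OF assms, of "\<lambda>l. if l = j then a else 0"] by (simp add: root_elt_def)
qed

lemma root_elt_J: "i < j \<Longrightarrow> i < r \<Longrightarrow> a \<in> frac 0 \<Longrightarrow> root_elt r i j a \<in> J r"
  unfolding root_elt_def by (rule elim_J) auto

lemma root_elt_K: "i < r \<Longrightarrow> a \<in> frac 0 \<Longrightarrow> root_elt r i j a \<in> K r"
  unfolding root_elt_def by (rule elim_K) auto

lemma perm_root:
  assumes w: "w permutes {..<r}"
  shows "perm_mat r w * root_elt r i j a = root_elt r (w i) (w j) a * perm_mat r w"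
proof -
  have "(\<lambda>l. if inv_into UNIV w l = j then a else 0) = (\<lambda>l. if l = w j then a else 0)"
    by (auto simp: fun_eq_iff permutes_inverses[OF w])
  then show ?thesis using perm_elim[OF w, of i "\<lambda>l. if l = j then a else 0"] by (simp add: root_elt_def)
qed

lemma root_elt_borel:
  assumes "i < j \<or> a = 0" "i < r"
  shows "root_elt r i j a \<in> borel_subgroup r" "m < r \<Longrightarrow> root_elt r i j a $$ (m, m) = 1"
  unfolding root_elt_def by (rule borel_elim; use assms in auto)+

text \<open>Moved to the left past \<open>perm_mat r v\<close>, the root element of (i, j) becomes
  that of (v i, v j). If it is upper triangular, the Borel part absorbs it without any change of its
  diagonal.\<close>

lemma cell_unipotent:
  assumes b: "b \<in> borel_subgroup r" and v: "v permutes {..<r}" and k: "k \<in> J r"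
    and root: "v i < v j \<or> a = 0" and ij: "i < r" "j < r" and u: "u permutes {..<r}"
  shows "iwahori_vector ord r z w (b * perm_mat r v * (root_elt r i j a * perm_mat r u * k)) =
    (if v \<circ> u = w then cell_value r z (borel_weight ord b) else 0)"
proof -
  let ?E = "root_elt r (v i) (v j) a"
  have vi: "v i < r" using permutes_in_image[OF v, of i] ij by simp
  have E: "?E \<in> borel_subgroup r" "\<And>m. m < r \<Longrightarrow> ?E $$ (m, m) = 1" using root_elt_borel[OF root vi] by auto
  have c: "b \<in> carrier_mat r r" "k \<in> carrier_mat r r" using b k K_carrier[OF iwahori_K] by (auto simp: borel_subgroup_def GL_carrier)
  have "b * perm_mat r v * (root_elt r i j a * perm_mat r u * k) = b * perm_mat r v * (root_elt r i j a * perm_mat r u) * k"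
    using c by (intro mat_assoc[of _ r, symmetric]) auto
  also have "b * perm_mat r v * (root_elt r i j a * perm_mat r u) = b * (perm_mat r v * (root_elt r i j a * perm_mat r u))"
    using c by (intro mat_assoc[of _ r]) auto
  also have "perm_mat r v * (root_elt r i j a * perm_mat r u) = perm_mat r v * root_elt r i j a * perm_mat r u"
    by (intro mat_assoc[of _ r, symmetric]) auto
  also have "\<dots> = ?E * perm_mat r v * perm_mat r u" by (simp only: perm_root[OF v])
  also have "\<dots> = ?E * (perm_mat r v * perm_mat r u)" by (intro mat_assoc[of _ r]) auto
  also have "perm_mat r v * perm_mat r u = (perm_mat r (v \<circ> u) :: 'a mat)" by (rule perm_mat_comp[OF v u])
  also have "b * (?E * perm_mat r (v \<circ> u)) = b * ?E * perm_mat r (v \<circ> u)"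
    using c by (intro mat_assoc[of _ r, symmetric]) auto
  finally have eq: "b * perm_mat r v * (root_elt r i j a * perm_mat r u * k) = b * ?E * perm_mat r (v \<circ> u) * k" .
  have "cell_value r z (borel_weight ord (b * ?E)) = cell_value r z (borel_weight ord b)"
    by (rule cell_value_cong) (simp add: borel_weight_def borel_mult_diag[OF b E(1)] E(2))
  then show ?thesis
    unfolding eq iwahori_vector_cell[OF borel_subgroup_mult[OF b E(1)] permutes_compose[OF u v] k] by simp
qed

text \<open>The last hypothesis says that the product y of k with the root elements on both sides
  has its entry (i, i + 1) in the maximal ideal. Conjugation by the simple reflection then keeps y
  in the Iwahori subgroup, as (i, i + 1) is the only position above the diagonal that moves below
  it.\<close>

lemma hecke_factor_swap:
  assumes k: "k \<in> J r" and i: "Suc i < r" and a: "a \<in> frac 0" "a' \<in> frac 0"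
    and u: "k $$ (i, Suc i) + a * k $$ (i, i) - a' * (k $$ (Suc i, Suc i) + a * k $$ (Suc i, i)) \<in> frac 1"
  obtains l where "l \<in> J r" "k * root_elt r i (Suc i) a * perm_mat r (adj i) =
    root_elt r i (Suc i) a' * perm_mat r (adj i) * l"
proof -
  let ?s = "adj i"
  let ?P = "perm_mat r ?s :: 'a mat"
  have s: "?s permutes {..<r}" by (rule adj_permutes[OF i])
  have PP: "?P * ?P = 1\<^sub>m r" unfolding perm_mat_comp[OF s s] by (simp add: perm_mat_id)
  have kc: "k \<in> carrier_mat r r" using k K_carrier[OF iwahori_K] by blast
  define y where "y = root_elt r i (Suc i) (- a') * (k * root_elt r i (Suc i) a)"
  have y: "y \<in> J r" unfolding y_def using k a i by (intro iwahori_mult root_elt_J) (auto intro: frac_minus)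
  have yc: "y \<in> carrier_mat r r" using y K_carrier[OF iwahori_K] by blast
  have "y $$ (i, Suc i) \<in> frac 1"
    using u i kc by (simp add: y_def root_mult_entry mult_root_entry algebra_simps del: index_mult_mat)
  note y1 = this
  define l where "l = ?P * (y * ?P)"
  have lK: "l \<in> K r" unfolding l_def using y s by (intro K_mult perm_mat_K iwahori_K)
  have entry: "l $$ (p, q) = y $$ (?s p, ?s q)" if "p < r" "q < r" for p q
  proof -
    have sp: "?s p < r" using permutes_in_image[OF s, of p] that by simp
    have "l $$ (?s (?s p), q) = (y * ?P) $$ (?s p, q)"
      unfolding l_def by (rule perm_mat_mult_entry) (use yc s sp that in auto)
    also have "\<dots> = y $$ (?s p, ?s q)" by (rule mult_perm_mat_entry) (use yc s sp that in auto)
    finally show ?thesis by simp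
  qed
  have "l $$ (p, q) \<in> frac 1" if "p < r" "q < p" for p q
  proof (cases "p = Suc i \<and> q = i")
    case True
    then show ?thesis using entry[of p q] y1 that by simp
  next
    case False
    then have "?s q < ?s p" using that by (auto simp: Transposition.transpose_def)
    moreover have "?s p < r" using permutes_in_image[OF s, of p] that by simp
    ultimately show ?thesis using entry[of p q] that y by (auto simp: iwahori_iff)
  qed
  then have "l \<in> J r" using lK by (simp add: iwahori_iff)
  moreover have "root_elt r i (Suc i) a' * ?P * l = k * root_elt r i (Suc i) a * ?P"
  proof -
    have "?P * l = ?P * ?P * (y * ?P)" unfolding l_def using yc by (intro mat_assoc[of _ r, symmetric]) auto
    then have 1: "?P * l = y * ?P" using yc left_mult_one_mat[of "y * ?P" r r] by (simp add: PP)
    have "root_elt r i (Suc i) a' * ?P * l = root_elt r i (Suc i) a' * (?P * l)"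
      using lK K_carrier by (intro mat_assoc[of _ r]) auto
    also have "\<dots> = root_elt r i (Suc i) a' * y * ?P" unfolding 1 using yc by (intro mat_assoc[of _ r, symmetric]) auto
    also have "root_elt r i (Suc i) a' * y = root_elt r i (Suc i) a' * root_elt r i (Suc i) (- a') * (k * root_elt r i (Suc i) a)"
      unfolding y_def using kc by (intro mat_assoc[of _ r, symmetric]) auto
    also have "\<dots> = k * root_elt r i (Suc i) a"
      using root_elt_inverse[of i r "Suc i" a'] i kc left_mult_one_mat[of "k * root_elt r i (Suc i) a" r r] by simp
    finally show ?thesis .
  qed
  ultimately show ?thesis using that by simp
qed

text \<open>After the swap of columns the diagonal entry at (i, i) is a unit. It serves as pivot to
  clear the entry (i + 1, i) by a lower root element, and what remains lies in the Iwahori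
  subgroup.\<close>

lemma hecke_factor_stay:
  assumes k: "k \<in> J r" and i: "Suc i < r" and a: "a \<in> frac 0"
    and u: "k $$ (i, Suc i) + a * k $$ (i, i) \<notin> frac 1"
  obtains l c where "l \<in> J r" "k * root_elt r i (Suc i) a * perm_mat r (adj i) = root_elt r (Suc i) i c * perm_mat r id * l"
proof -
  let ?s = "adj i"
  let ?P = "perm_mat r ?s :: 'a mat"
  let ?u = "k $$ (i, Suc i) + a * k $$ (i, i)" and ?d = "k $$ (Suc i, Suc i) + a * k $$ (Suc i, i)"
  have s: "?s permutes {..<r}" by (rule adj_permutes[OF i])
  have kc: "k \<in> carrier_mat r r" using k K_carrier[OF iwahori_K] by blast
  have ent: "k $$ (p, q) \<in> frac 0" if "p < r" "q < r" for p q using K_entry[OF iwahori_K[OF k]] that by blast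
  have low: "k $$ (p, q) \<in> frac 1" if "p < r" "q < p" for p q using k that by (auto simp: iwahori_iff)
  have u0: "?u \<in> frac 0" "?d \<in> frac 0" using i a by (auto intro!: frac_add frac_mult0 ent)
  define c where "c = ?d / ?u"
  have c: "c \<in> frac 0" unfolding c_def by (rule divide_unit[OF u0(2,1) u])
  have un0: "?u \<noteq> 0" using u by auto
  define m where "m = k * root_elt r i (Suc i) a * ?P"
  have mK: "m \<in> K r" unfolding m_def using k a i s by (intro K_mult perm_mat_K iwahori_K root_elt_K) auto
  have mc: "m \<in> carrier_mat r r" using mK by (rule K_carrier)
  have m: "m $$ (p, q) = k $$ (p, ?s q) + (if q = i then a * k $$ (p, i) else 0)" if "p < r" "q < r" for p q
  proof -
    have sq: "?s q < r" using permutes_in_image[OF s, of q] that by simp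
    have "m $$ (p, q) = (k * root_elt r i (Suc i) a) $$ (p, ?s q)"
      unfolding m_def by (rule mult_perm_mat_entry) (use kc s that in auto)
    also have "\<dots> = k $$ (p, ?s q) + (if ?s q = Suc i then k $$ (p, i) * a else 0)"
      using mult_root_entry[OF kc that(1) sq, of i "Suc i" a] i by simp
    also have "?s q = Suc i \<longleftrightarrow> q = i" by (auto simp: Transposition.transpose_def)
    finally show ?thesis by (simp add: mult.commute)
  qed
  define l where "l = root_elt r (Suc i) i (- c) * m"
  have lK: "l \<in> K r" unfolding l_def using mK c i by (intro K_mult root_elt_K frac_minus) auto
  have l: "l $$ (p, q) = m $$ (p, q) + (if p = Suc i then - c * m $$ (i, q) else 0)" if "p < r" "q < r" for p q
    unfolding l_def by (rule root_mult_entry) (use mc that i in auto)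
  have "l $$ (p, q) \<in> frac 1" if pq: "p < r" "q < p" for p q
  proof (cases "p = Suc i")
    case False
    then have "l $$ (p, q) = k $$ (p, ?s q) + (if q = i then a * k $$ (p, i) else 0)"
      using l m pq by simp
    moreover have "?s q < p" using pq False by (auto simp: Transposition.transpose_def)
    ultimately show ?thesis using pq a by (auto intro!: frac_add frac_mult0 low)
  next
    case p: True
    show ?thesis
    proof (cases "q = i")
      case True
      then have "l $$ (p, q) = ?d - c * ?u" using l m pq p i by simp
      then show ?thesis using un0 by (simp add: c_def)
    next
      case False
      then have q: "q < i" using pq p by simp
      then have "?s q = q" by (simp add: Transposition.transpose_def)
      then have "l $$ (p, q) = k $$ (p, q) - c * k $$ (i, q)" using l m pq p q i by simp
      then show ?thesis using pq q i c by (auto intro!: frac_diff frac_mult0 low)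
    qed
  qed
  then have "l \<in> J r" using lK by (simp add: iwahori_iff)
  moreover have "root_elt r (Suc i) i c * perm_mat r id * l = m"
  proof -
    have "root_elt r (Suc i) i c * perm_mat r id * l = root_elt r (Suc i) i c * l"
      by (simp add: perm_mat_id right_mult_one_mat[of _ r r])
    also have "\<dots> = root_elt r (Suc i) i c * root_elt r (Suc i) i (- c) * m"
      unfolding l_def using mc by (intro mat_assoc[of _ r, symmetric]) auto
    finally show ?thesis using root_elt_inverse[OF i] mc by simp
  qed
  ultimately show ?thesis using that[of l c] by (simp add: m_def)
qed

end

section \<open>Residues and the Hecke operator of a simple reflection\<close>

context nonarch_local_field
begin

definition residue_system :: "'a set \<Rightarrow> bool" where
  "residue_system A \<longleftrightarrow> finite A \<and> card A = residue_card ord \<and> A \<subseteq> frac 0 \<and>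
     (\<forall>x\<in>frac 0. \<exists>!a. a \<in> A \<and> x - a \<in> frac 1)"

lemma residue_systemD:
  assumes "residue_system A"
  shows "finite A" "card A = residue_card ord" "A \<subseteq> frac 0"
    and "x \<in> frac 0 \<Longrightarrow> \<exists>!a. a \<in> A \<and> x - a \<in> frac 1"
proof -
  note 1 = assms[unfolded residue_system_def]
  show "finite A" "card A = residue_card ord" "A \<subseteq> frac 0"
    by (rule conjunct1[OF 1] conjunct1[OF conjunct2[OF 1]] conjunct1[OF conjunct2[OF conjunct2[OF 1]]])+
  have "\<forall>x\<in>frac 0. \<exists>!a. a \<in> A \<and> x - a \<in> frac 1"
    by (rule conjunct2[OF conjunct2[OF conjunct2[OF 1]]])
  then show "x \<in> frac 0 \<Longrightarrow> \<exists>!a. a \<in> A \<and> x - a \<in> frac 1" by (rule bspec)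
qed

lemma ex_residue_system: "\<exists>A. residue_system A"
proof -
  define R where "R = {(x, y). x \<in> frac 0 \<and> y \<in> frac 0 \<and> x - y \<in> frac 1}"
  have eqv: "equiv (frac 0) R"
  proof (rule equivI)
    show "R \<subseteq> frac 0 \<times> frac 0" by (auto simp: R_def)
    show "refl_on (frac 0) R" by (auto simp: refl_on_def R_def)
    show "sym R"
    proof (rule symI)
      fix x y assume "(x, y) \<in> R"
      then show "(y, x) \<in> R" using frac_minus[of "x - y" 1] by (auto simp: R_def)
    qed
    show "trans R"
    proof (rule transI)
      fix x y z assume "(x, y) \<in> R" "(y, z) \<in> R"
      then show "(x, z) \<in> R" using frac_add[of "x - y" 1 "y - z"] by (auto simp: R_def)
    qed
  qed
  have rf: "residue_field ord = frac 0 // R" by (simp add: residue_field_def R_def)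
  define \<sigma> where "\<sigma> C = (SOME x. x \<in> C)" for C :: "'a set"
  have \<sigma>: "\<sigma> C \<in> C" if "C \<in> frac 0 // R" for C
    unfolding \<sigma>_def using in_quotient_imp_non_empty[OF eqv that] by (auto intro: someI)
  have inj: "inj_on \<sigma> (frac 0 // R)"
  proof (rule inj_onI)
    fix C D assume CD: "C \<in> frac 0 // R" "D \<in> frac 0 // R" "\<sigma> C = \<sigma> D"
    then have "\<sigma> C \<in> C \<inter> D" using \<sigma>[OF CD(1)] \<sigma>[OF CD(2)] by simp
    then show "C = D" using quotient_disj[OF eqv CD(1,2)] by blast
  qed
  show ?thesis
    unfolding residue_system_def
  proof (intro exI[of _ "\<sigma> ` (frac 0 // R)"] conjI ballI)
    show "finite (\<sigma> ` (frac 0 // R))" using finite_residue_field rf by simp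
    show "card (\<sigma> ` (frac 0 // R)) = residue_card ord" by (simp add: card_image[OF inj] residue_card_def rf)
    show "\<sigma> ` (frac 0 // R) \<subseteq> frac 0"
      using \<sigma> in_quotient_imp_subset[OF eqv] by blast
    fix x assume x: "x \<in> frac 0"
    have cls: "R `` {x} \<in> frac 0 // R" using x by (rule quotientI)
    show "\<exists>!a. a \<in> \<sigma> ` (frac 0 // R) \<and> x - a \<in> frac 1"
    proof (rule ex1I[of _ "\<sigma> (R `` {x})"])
      show "\<sigma> (R `` {x}) \<in> \<sigma> ` (frac 0 // R) \<and> x - \<sigma> (R `` {x}) \<in> frac 1"
        using cls \<sigma>[OF cls] by (auto simp: R_def)
      fix a assume a: "a \<in> \<sigma> ` (frac 0 // R) \<and> x - a \<in> frac 1"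
      then obtain C where C: "C \<in> frac 0 // R" "a = \<sigma> C" by auto
      then have aC: "a \<in> C" using \<sigma> by simp
      then have "a \<in> frac 0" using in_quotient_imp_subset[OF eqv C(1)] by blast
      then have "a \<in> R `` {x}" using a x by (simp add: R_def)
      then have "C = R `` {x}" using quotient_disj[OF eqv C(1) cls] aC by blast
      then show "a = \<sigma> (R `` {x})" using C by simp
    qed
  qed
qed

text \<open>0 and 1 are not congruent modulo the maximal ideal.\<close>

lemma residue_card_ge_2: "2 \<le> residue_card ord"
proof -
  obtain A where "residue_system A" using ex_residue_system by blast
  note A = residue_systemD(1,2)[OF this] and ex = residue_systemD(4)[OF this]
  from ex[OF frac_zero] obtain a where a: "a \<in> A" "0 - a \<in> frac 1" by blast
  from ex[OF frac_one] obtain b where b: "b \<in> A" "1 - b \<in> frac 1" by blast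
  have "a \<noteq> b"
  proof
    assume "a = b"
    have "(1 - b) - (0 - a) \<in> frac 1" by (rule frac_diff[OF b(2) a(2)])
    then show False using one_notin_frac1 \<open>a = b\<close> by simp
  qed
  then have "card {a, b} \<le> card A" using a b A(1) by (intro card_mono) auto
  then show ?thesis using A(2) \<open>a \<noteq> b\<close> by simp
qed

lemma adj_comp_eq: "v \<circ> adj i = w \<longleftrightarrow> v = w \<circ> adj i"
  by (auto simp: fun_eq_iff) (metis transpose_involutory)+

text \<open>
  The products \<open>root_elt r i (Suc i) a * perm_mat r (adj i)\<close> represent the q left cosets of the
  Iwahori subgroup in the double coset of a simple reflection.
\<close>

lemma hecke_sum:
  assumes g: "g \<in> GL r" and i: "Suc i < r" and w: "w permutes {..<r}"
    and A: "finite A" "card A = residue_card ord" "A \<subseteq> frac 0" "\<And>x. x \<in> frac 0 \<Longrightarrow> \<exists>!a. a \<in> A \<and> x - a \<in> frac 1"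
  shows "(\<Sum>a\<in>A. iwahori_vector ord r z w (g * (root_elt r i (Suc i) a * perm_mat r (adj i)))) =
    (if w i < w (Suc i) then iwahori_vector ord r z (w \<circ> adj i) g
     else of_nat (residue_card ord) * iwahori_vector ord r z (w \<circ> adj i) g
        + (of_nat (residue_card ord) - 1) * iwahori_vector ord r z w g)"
proof -
  obtain b v k where d: "b \<in> borel_subgroup r" "v permutes {..<r}" "k \<in> J r" and gd: "g = b * perm_mat r v * k"
    using g by (rule iwahori_decomposition)
  let ?s = "adj i" and ?q = "of_nat (residue_card ord) :: complex"
  have s: "?s permutes {..<r}" by (rule adj_permutes[OF i])
  have c: "b \<in> carrier_mat r r" "k \<in> carrier_mat r r" using d K_carrier[OF iwahori_K] by (auto simp: borel_subgroup_def GL_carrier)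
  define val where "val = cell_value r z (borel_weight ord b)"
  have phi_g: "iwahori_vector ord r z u g = (if v = u then val else 0)" for u
    unfolding gd val_def by (rule iwahori_vector_cell[OF d])
  define f where "f a = iwahori_vector ord r z w (g * (root_elt r i (Suc i) a * perm_mat r ?s))" for a
  have f: "f a = iwahori_vector ord r z w (b * perm_mat r v * (k * root_elt r i (Suc i) a * perm_mat r ?s))" for a
  proof -
    have "g * (root_elt r i (Suc i) a * perm_mat r ?s) = b * perm_mat r v * (k * (root_elt r i (Suc i) a * perm_mat r ?s))"
      unfolding gd using c by (intro mat_assoc[of _ r]) auto
    also have "k * (root_elt r i (Suc i) a * perm_mat r ?s) = k * root_elt r i (Suc i) a * perm_mat r ?s"
      using c by (intro mat_assoc[of _ r, symmetric]) auto
    finally show ?thesis by (simp add: f_def)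
  qed
  have ent: "k $$ (p, q) \<in> frac 0" if "p < r" "q < r" for p q using K_entry[OF iwahori_K[OF d(3)]] that by blast
  have vne: "v i \<noteq> v (Suc i)" using permutes_inj[OF d(2)] by (simp add: inj_eq)
  have swap: "f a = (if v \<circ> ?s = w then val else 0)"
    if a: "a \<in> frac 0" "a' \<in> frac 0" "v i < v (Suc i) \<or> a' = 0"
     "k $$ (i, Suc i) + a * k $$ (i, i) - a' * (k $$ (Suc i, Suc i) + a * k $$ (Suc i, i)) \<in> frac 1" for a a'
  proof -
    obtain l where l: "l \<in> J r" "k * root_elt r i (Suc i) a * perm_mat r ?s = root_elt r i (Suc i) a' * perm_mat r ?s * l"
      using d(3) i a(1,2,4) by (rule hecke_factor_swap)
    show ?thesis unfolding f l(2) val_def by (rule cell_unipotent) (use d l a i s in auto)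
  qed
  have total: "(\<Sum>a\<in>A. f a) = (if v i < v (Suc i) then ?q * (if v \<circ> ?s = w then val else 0)
     else (if v \<circ> ?s = w then val else 0) + (?q - 1) * (if v = w then val else 0))"
  proof (cases "v i < v (Suc i)")
    case True
    \<comment> \<open>The root (v i, v (i + 1)) is positive, so any integral \<open>a'\<close> may
      be absorbed. As \<open>?d\<close> is a unit, \<open>a' = ?u / ?d\<close> makes the expression
      in \<open>swap\<close> vanish, and all q terms fall into the same cell.\<close>
    have "f a = (if v \<circ> ?s = w then val else 0)" if "a \<in> A" for a
    proof -
      have a: "a \<in> frac 0" using A that by auto
      let ?d = "k $$ (Suc i, Suc i) + a * k $$ (Suc i, i)" and ?u = "k $$ (i, Suc i) + a * k $$ (i, i)"
      have d0: "?d \<in> frac 0" "?u \<in> frac 0" using i a by (auto intro!: frac_add frac_mult0 ent)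
      have "a * k $$ (Suc i, i) \<in> frac 1" using d(3) i a by (intro frac_mult0) (auto simp: iwahori_iff)
      then have du: "?d \<notin> frac 1" using iwahori_diag_unit[OF d(3) i] frac_diff[of ?d 1 "a * k $$ (Suc i, i)"] by auto
      then have dn: "?d \<noteq> 0" by auto
      have "?u / ?d \<in> frac 0" by (rule divide_unit[OF d0(2,1) du])
      then show ?thesis using a True dn by (intro swap[of a "?u / ?d"]) auto
    qed
    then show ?thesis using True A(2) by simp
  next
    case False
    \<comment> \<open>Now only \<open>a' = 0\<close> can be used in \<open>swap\<close>, which
      requires \<open>?u a\<close> in the maximal ideal. This singles out one representative
      \<open>a0\<close>; for the other q - 1 the entry is a unit and the cell of v does not
      change.\<close>
    let ?u = "\<lambda>a. k $$ (i, Suc i) + a * k $$ (i, i)"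
    have ku: "k $$ (i, i) \<notin> frac 1" using iwahori_diag_unit[OF d(3)] i by simp
    have k0: "k $$ (i, i) \<noteq> 0" using ku by auto
    have x: "- k $$ (i, Suc i) / k $$ (i, i) \<in> frac 0" using i ku by (intro divide_unit frac_minus ent) auto
    from A(4)[OF this] obtain a0 where a0: "a0 \<in> A" "- k $$ (i, Suc i) / k $$ (i, i) - a0 \<in> frac 1"
      and uniq: "\<And>a. a \<in> A \<Longrightarrow> - k $$ (i, Suc i) / k $$ (i, i) - a \<in> frac 1 \<Longrightarrow> a = a0" by blast
    have u_iff: "?u a \<in> frac 1 \<longleftrightarrow> - k $$ (i, Suc i) / k $$ (i, i) - a \<in> frac 1" if "a \<in> A" for a
    proof
      assume "?u a \<in> frac 1"
      then have "- ?u a / k $$ (i, i) \<in> frac 1" using i ku by (intro divide_unit frac_minus ent) auto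
      then show "- k $$ (i, Suc i) / k $$ (i, i) - a \<in> frac 1" using k0 by (simp add: field_simps)
    next
      assume "- k $$ (i, Suc i) / k $$ (i, i) - a \<in> frac 1"
      then have "- (- k $$ (i, Suc i) / k $$ (i, i) - a) * k $$ (i, i) \<in> frac 1"
        using i by (intro frac_mult0' frac_minus ent) auto
      moreover have "- (- k $$ (i, Suc i) / k $$ (i, i) - a) * k $$ (i, i) = ?u a"
        using k0 by (simp add: distrib_right)
      ultimately show "?u a \<in> frac 1" by (simp only:)
    qed
    have f0: "f a0 = (if v \<circ> ?s = w then val else 0)"
      using u_iff[OF a0(1)] a0 A by (intro swap[of a0 0]) auto
    have f1: "f a = (if v = w then val else 0)" if "a \<in> A - {a0}" for a
    proof -
      have a: "a \<in> frac 0" "?u a \<notin> frac 1" using A that u_iff[of a] uniq[of a] by auto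
      obtain l e where l: "l \<in> J r" "k * root_elt r i (Suc i) a * perm_mat r ?s = root_elt r (Suc i) i e * perm_mat r id * l"
        using d(3) i a by (rule hecke_factor_stay)
      have "v (Suc i) < v i" using False vne by simp
      then have "f a = (if v \<circ> id = w then val else 0)"
        unfolding f l(2) val_def by (intro cell_unipotent) (use d l i permutes_id in auto)
      then show ?thesis by simp
    qed
    have "(\<Sum>a\<in>A. f a) = f a0 + (\<Sum>a\<in>A - {a0}. f a)" using A(1) a0(1) by (rule sum.remove)
    also have "(\<Sum>a\<in>A - {a0}. f a) = (\<Sum>a\<in>A - {a0}. if v = w then val else 0)" by (intro sum.cong f1) auto
    also have "\<dots> = (?q - 1) * (if v = w then val else 0)"
    proof -
      have "card (A - {a0}) = residue_card ord - 1" using A a0 by simp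
      moreover have "1 \<le> residue_card ord" using residue_card_ge_2 by simp
      ultimately show ?thesis by (simp add: of_nat_diff)
    qed
    finally show ?thesis using False f0 by simp
  qed
  \<comment> \<open>The case distinction was made on v, the cell of g, but the claim is about w. On
    the cells where the vectors are nonzero, v is w or w composed with the reflection, which
    reverses the comparison.\<close>
  have "v i < v (Suc i) \<longleftrightarrow> w (Suc i) < w i" if "v = w \<circ> ?s"
    using that by simp
  moreover have "w i \<noteq> w (Suc i)" using permutes_inj[OF w] by (simp add: inj_eq)
  moreover have "v = w \<circ> ?s \<Longrightarrow> v \<noteq> w"
  proof
    assume "v = w \<circ> ?s" "v = w"
    then have "w (Suc i) = w i" by (metis comp_apply transpose_apply_first)
    then show False using \<open>w i \<noteq> w (Suc i)\<close> by simp
  qed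
  ultimately show ?thesis
    unfolding phi_g f_def[symmetric] total adj_comp_eq by auto
qed

section \<open>The rotation element\<close>

definition unit_weight :: "nat \<Rightarrow> nat \<Rightarrow> int" where
  "unit_weight m = (\<lambda>i. if i = m then 1 else 0)"

text \<open>An element of length zero in the extended affine Weyl group; it permutes the affine
  simple roots cyclically.\<close>

definition rotation_elt :: "'a \<Rightarrow> nat \<Rightarrow> 'a mat" where
  "rotation_elt p r = torus_elt p r (unit_weight (r - 1)) * perm_mat r (cycle_down r)"

lemma rotation_elt_carrier [simp]: "rotation_elt p r \<in> carrier_mat r r"
  by (simp add: rotation_elt_def)

text \<open>Conjugation shifts rows and columns cyclically by one, divides the new row 0 by the
  uniformizer and multiplies the new column 0 by it. The former last row is divisible off the
  diagonal, and the former last column becomes divisible, as its new place below the diagonal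
  demands.\<close>

lemma rotation_normalizes:
  assumes p: "uniformizer ord p" and r: "0 < r" and k: "k \<in> J r"
  obtains l where "l \<in> J r" "k * rotation_elt p r = rotation_elt p r * l"
proof -
  have p0: "p \<noteq> 0" "ord p = 1" using p by (auto simp: uniformizer_def)
  let ?T = "torus_elt p r (unit_weight (r - 1))" and ?T' = "torus_elt p r (\<lambda>i. - unit_weight (r - 1) i)"
  let ?P = "perm_mat r (cycle_down r) :: 'a mat" and ?P' = "perm_mat r (inv_into UNIV (cycle_down r)) :: 'a mat"
  note c = cycle_down_permutes[OF r]
  note TT = torus_inverse[OF p0(1), of r "unit_weight (r - 1)"] and PP = perm_mat_inverse[OF c]
  define cj where "cj x = ?P' * (?T' * (x * (?T * ?P)))" for x
  have cjc: "cj x \<in> carrier_mat r r" if "x \<in> carrier_mat r r" for x using that by (simp add: cj_def)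
  have RP: "rotation_elt p r * (?P' * (?T' * y)) = y" if "y \<in> carrier_mat r r" for y
  proof -
    have "rotation_elt p r * (?P' * (?T' * y)) = ?T * (?P * (?P' * (?T' * y)))"
      unfolding rotation_elt_def using that by (intro mat_assoc[of _ r]) auto
    also have "?P * (?P' * (?T' * y)) = ?P * ?P' * (?T' * y)" using that by (intro mat_assoc[of _ r, symmetric]) auto
    also have "\<dots> = ?T' * y" unfolding PP by (rule left_mult_one_mat[of _ r r]) (use that in simp)
    also have "?T * (?T' * y) = ?T * ?T' * y" using that by (intro mat_assoc[of _ r, symmetric]) auto
    also have "\<dots> = y" unfolding TT by (rule left_mult_one_mat[of _ r r]) (use that in simp)
    finally show ?thesis .
  qed
  have cj: "rotation_elt p r * cj x = x * rotation_elt p r" if "x \<in> carrier_mat r r" for x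
    unfolding cj_def using RP[of "x * (?T * ?P)"] that by (simp add: rotation_elt_def)
  have inj: "y = y'" if "rotation_elt p r * y = rotation_elt p r * y'" "y \<in> carrier_mat r r" "y' \<in> carrier_mat r r" for y y'
  proof -
    have L: "?P' * (?T' * (rotation_elt p r * y)) = y" if "y \<in> carrier_mat r r" for y
    proof -
      have "rotation_elt p r * y = ?T * (?P * y)" unfolding rotation_elt_def using that by (intro mat_assoc[of _ r]) auto
      then have "?T' * (rotation_elt p r * y) = ?T' * ?T * (?P * y)"
        using that mat_assoc[of ?T' r ?T "?P * y"] by simp
      also have "\<dots> = ?P * y" unfolding TT by (rule left_mult_one_mat[of _ r r]) (use that in simp)
      finally have "?P' * (?T' * (rotation_elt p r * y)) = ?P' * ?P * y"
        using that mat_assoc[of ?P' r ?P y] by simp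
      also have "\<dots> = y" unfolding PP by (rule left_mult_one_mat[of _ r r]) (use that in simp)
      finally show ?thesis .
    qed
    show ?thesis using L[OF that(2)] L[OF that(3)] that(1) by simp
  qed
  have entry: "cj x $$ (i, j) = p powi (- (if i = 0 then 1 else 0)) * x $$ (cycle_down r i, cycle_down r j) * p powi (if j = 0 then 1 else 0)"
    if "x \<in> carrier_mat r r" "i < r" "j < r" for x i j
  proof -
    let ?i = "cycle_down r i" and ?j = "cycle_down r j"
    have ci: "?i < r" "?j < r" using permutes_in_image[OF c, of i] permutes_in_image[OF c, of j] that by auto
    have e: "unit_weight (r - 1) ?i = (if i = 0 then 1 else 0)" "unit_weight (r - 1) ?j = (if j = 0 then 1 else 0)"
      using that by (auto simp: unit_weight_def cycle_down_def)
    have "?P * cj x = ?T' * (x * (?T * ?P))"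
    proof -
      have "?P * cj x = ?P * ?P' * (?T' * (x * (?T * ?P)))" unfolding cj_def using that by (intro mat_assoc[of _ r, symmetric]) auto
      then show ?thesis unfolding PP using that left_mult_one_mat[of "?T' * (x * (?T * ?P))" r r] by simp
    qed
    then have "cj x $$ (i, j) = (?T' * (x * (?T * ?P))) $$ (?i, j)"
      using perm_mat_mult_entry[OF cjc[OF that(1)] c that(2,3)] by simp
    also have "\<dots> = p powi (- unit_weight (r - 1) ?i) * (x * (?T * ?P)) $$ (?i, j)"
      by (rule torus_mult_entry(1)) (use that ci in auto)
    also have "x * (?T * ?P) = x * ?T * ?P" using that by (intro mat_assoc[of _ r, symmetric]) auto
    also have "(x * ?T * ?P) $$ (?i, j) = (x * ?T) $$ (?i, ?j)" by (rule mult_perm_mat_entry) (use that c ci in auto)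
    also have "\<dots> = x $$ (?i, ?j) * p powi unit_weight (r - 1) ?j" by (rule torus_mult_entry(2)) (use that ci in auto)
    finally show ?thesis by (simp only: e mult.assoc)
  qed
  have pm: "p powi (- 1) * y \<in> frac 0" if "y \<in> frac 1" for y
  proof -
    have "p powi (- 1) \<in> frac (- 1)" using p0 by (simp add: frac_iff power_int_minus ord_inverse)
    then show ?thesis using frac_mult[of "p powi (- 1)" "- 1" y 1] that by simp
  qed
  have pp: "y * p \<in> frac 1" if "y \<in> frac 0" for y
    using frac_mult[of y 0 p 1] that p0 by (simp add: frac_iff)
  have int: "cj x $$ (i, j) \<in> frac 0 \<and> (j < i \<longrightarrow> cj x $$ (i, j) \<in> frac 1)" if x: "x \<in> J r" and ij: "i < r" "j < r" for x i j
  proof -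
    have xc: "x \<in> carrier_mat r r" using x K_carrier[OF iwahori_K] by blast
    have ent: "x $$ (a, b) \<in> frac 0" if "a < r" "b < r" for a b using K_entry[OF iwahori_K[OF x]] that by blast
    have low: "x $$ (a, b) \<in> frac 1" if "a < r" "b < a" for a b using x that by (auto simp: iwahori_iff)
    note E = entry[OF xc ij]
    consider "i = 0" "j = 0" | "i = 0" "j \<noteq> 0" | "i \<noteq> 0" "j = 0" | "i \<noteq> 0" "j \<noteq> 0" by blast
    then show ?thesis
    proof cases
      case 1
      then have "cj x $$ (i, j) = x $$ (r - 1, r - 1)" using E p0 by (simp add: cycle_down_def power_int_minus)
      then show ?thesis using 1 ent r by simp
    next
      case 2
      then have "cj x $$ (i, j) = p powi (- 1) * x $$ (r - 1, j - 1)" using E ij by (simp add: cycle_down_def)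
      moreover have "x $$ (r - 1, j - 1) \<in> frac 1" using 2 ij by (intro low) auto
      ultimately show ?thesis using 2 pm by simp
    next
      case 3
      then have "cj x $$ (i, j) = x $$ (i - 1, r - 1) * p" using E ij by (simp add: cycle_down_def)
      moreover have "x $$ (i - 1, r - 1) \<in> frac 0" using 3 ij by (intro ent) auto
      ultimately have "cj x $$ (i, j) \<in> frac 1" using pp by simp
      then show ?thesis using frac_mono by simp
    next
      case 4
      then have "cj x $$ (i, j) = x $$ (i - 1, j - 1)" using E ij by (simp add: cycle_down_def)
      then show ?thesis using 4 ij ent low by auto
    qed
  qed
  obtain k' where k': "k' \<in> J r" "k * k' = 1\<^sub>m r" "k' * k = 1\<^sub>m r" using k by (rule iwahori_inverse)
  have kc: "k \<in> carrier_mat r r" "k' \<in> carrier_mat r r" using k k'(1) K_carrier[OF iwahori_K] by blast+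
  have prod: "cj x * cj y = 1\<^sub>m r" if "x * y = 1\<^sub>m r" "x \<in> carrier_mat r r" "y \<in> carrier_mat r r" for x y
  proof (rule inj)
    have "rotation_elt p r * (cj x * cj y) = rotation_elt p r * cj x * cj y"
      using that cjc by (intro mat_assoc[of _ r, symmetric]) auto
    also have "\<dots> = x * (rotation_elt p r * cj y)" unfolding cj[OF that(2)] using that cjc by (intro mat_assoc[of _ r]) auto
    also have "\<dots> = x * y * rotation_elt p r" unfolding cj[OF that(3)] using that by (intro mat_assoc[of _ r, symmetric]) auto
    also have "\<dots> = rotation_elt p r * 1\<^sub>m r"
      unfolding that(1) left_mult_one_mat[OF rotation_elt_carrier] right_mult_one_mat[OF rotation_elt_carrier] by (rule refl)
    finally show "rotation_elt p r * (cj x * cj y) = rotation_elt p r * 1\<^sub>m r" .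
  qed (use that cjc in auto)
  have "integral_mat ord r (cj k)" "integral_mat ord r (cj k')"
    using int[OF k] int[OF k'(1)] cjc kc by (auto simp: integral_mat_def)
  then have "cj k \<in> K r" unfolding GL_integers_def using prod[OF k'(2)] prod[OF k'(3)] kc by blast
  then have "cj k \<in> J r" using int[OF k] by (auto simp: iwahori_iff)
  then show ?thesis using that[of "cj k"] cj[OF kc(1)] by simp
qed

lemma cell_value_add_unit:
  assumes m: "m < r" and z: "\<And>i. i < r \<Longrightarrow> z i \<noteq> 0"
  shows "cell_value r z (\<lambda>i. e i + unit_weight m i) =
    complex_of_real (real (residue_card ord) powr (- weyl_vector r m)) * z m * cell_value r z e"
proof -
  let ?q = "real (residue_card ord)"
  have q: "0 < ?q" using residue_card_ge_2 by simp
  have "pair r (\<lambda>i. 2 * weyl_vector r i) (\<lambda>i. e i + unit_weight m i) =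
    pair r (\<lambda>i. 2 * weyl_vector r i) e + (\<Sum>i<r. if i = m then 2 * weyl_vector r m else 0)"
    unfolding pair_def sum.distrib[symmetric] by (intro sum.cong) (auto simp: unit_weight_def algebra_simps)
  then have pr: "pair r (\<lambda>i. 2 * weyl_vector r i) (\<lambda>i. e i + unit_weight m i) = pair r (\<lambda>i. 2 * weyl_vector r i) e + 2 * weyl_vector r m"
    using m by simp
  have "monomial r z (\<lambda>i. e i + unit_weight m i) = (\<Prod>i<r. z i powi e i * (if i = m then z m else 1))"
    unfolding monomial_def unit_weight_def using z by (intro prod.cong) (auto simp: power_int_add)
  also have "\<dots> = monomial r z e * z m" using m by (simp add: prod.distrib monomial_def)
  finally have mo: "monomial r z (\<lambda>i. e i + unit_weight m i) = monomial r z e * z m" .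
  have "sqrt (?q powr (- pair r (\<lambda>i. 2 * weyl_vector r i) (\<lambda>i. e i + unit_weight m i))) =
    sqrt (?q powr (- pair r (\<lambda>i. 2 * weyl_vector r i) e)) * ?q powr (- weyl_vector r m)"
    unfolding pr using q by (simp add: powr_half_sqrt[symmetric] powr_powr powr_add[symmetric] algebra_simps)
  then show ?thesis unfolding cell_value_def mo by simp
qed

text \<open>The rotation element passes through the Iwahori part because it normalizes it, and its
  torus part passes through v. This raises the exponent at \<open>v (r - 1)\<close> by one, and
  \<open>v (r - 1) = w 0\<close> on the cell where the vector is nonzero.\<close>

lemma iwahori_vector_rotation:
  assumes p: "uniformizer ord p" and g: "g \<in> GL r" and r: "0 < r" and w: "w permutes {..<r}"
    and z: "\<And>i. i < r \<Longrightarrow> z i \<noteq> 0"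
  shows "iwahori_vector ord r z w (g * rotation_elt p r) =
    complex_of_real (real (residue_card ord) powr (- weyl_vector r (w 0))) * z (w 0) *
    iwahori_vector ord r z (w \<circ> inv_into UNIV (cycle_down r)) g"
proof -
  obtain b v k where d: "b \<in> borel_subgroup r" "v permutes {..<r}" "k \<in> J r" and gd: "g = b * perm_mat r v * k"
    using g by (rule iwahori_decomposition)
  have p0: "p \<noteq> 0" "ord p = 1" using p by (auto simp: uniformizer_def)
  have c: "b \<in> carrier_mat r r" "k \<in> carrier_mat r r" using d K_carrier[OF iwahori_K] by (auto simp: borel_subgroup_def GL_carrier)
  note cy = cycle_down_permutes[OF r]
  obtain l where l: "l \<in> J r" "k * rotation_elt p r = rotation_elt p r * l" using p r d(3) by (rule rotation_normalizes)
  have lc: "l \<in> carrier_mat r r" using l K_carrier[OF iwahori_K] by blast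
  let ?e = "unit_weight (r - 1)" and ?P = "perm_mat r (cycle_down r) :: 'a mat"
  let ?f = "\<lambda>i. ?e (inv_into UNIV v i)"
  let ?T = "torus_elt p r ?f"
  have fe: "?f = unit_weight (v (r - 1))"
    by (auto simp: unit_weight_def fun_eq_iff permutes_inv_eq[OF d(2)])
  have T: "?T \<in> borel_subgroup r" by (rule torus_borel[OF p0(1)])
  have "g * rotation_elt p r = b * perm_mat r v * (k * rotation_elt p r)"
    unfolding gd using c by (intro mat_assoc[of _ r]) auto
  also have "\<dots> = b * perm_mat r v * rotation_elt p r * l"
    unfolding l(2) using c lc by (intro mat_assoc[of _ r, symmetric]) auto
  also have "b * perm_mat r v * rotation_elt p r = b * (perm_mat r v * rotation_elt p r)"
    using c by (intro mat_assoc[of _ r]) auto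
  also have "perm_mat r v * rotation_elt p r = perm_mat r v * torus_elt p r ?e * ?P"
    unfolding rotation_elt_def by (intro mat_assoc[of _ r, symmetric]) auto
  also have "\<dots> = ?T * perm_mat r v * ?P" by (simp only: perm_torus[OF d(2)])
  also have "\<dots> = ?T * (perm_mat r v * ?P)" by (intro mat_assoc[of _ r]) auto
  also have "perm_mat r v * ?P = (perm_mat r (v \<circ> cycle_down r) :: 'a mat)" by (rule perm_mat_comp[OF d(2) cy])
  also have "b * (?T * perm_mat r (v \<circ> cycle_down r)) = b * ?T * perm_mat r (v \<circ> cycle_down r)"
    using c by (intro mat_assoc[of _ r, symmetric]) auto
  finally have eq: "g * rotation_elt p r = b * ?T * perm_mat r (v \<circ> cycle_down r) * l" .
  have "borel_weight ord (b * ?T) i = borel_weight ord b i + unit_weight (v (r - 1)) i" if "i < r" for i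
  proof -
    have "(b * ?T) $$ (i, i) = b $$ (i, i) * p powi ?f i" using borel_mult_diag[OF d(1) T that] that by (simp add: torus_entry)
    moreover have "p powi ?f i \<noteq> 0" "ord (p powi ?f i) = ?f i" using p0 by (auto simp: unit_weight_def)
    ultimately show ?thesis using ord_mult[of "b $$ (i, i)" "p powi ?f i"] borel_diag_nonzero[OF d(1) that] fun_cong[OF fe, of i] by (simp add: borel_weight_def)
  qed
  then have "cell_value r z (borel_weight ord (b * ?T)) = cell_value r z (\<lambda>i. borel_weight ord b i + unit_weight (v (r - 1)) i)"
    by (rule cell_value_cong)
  also have "\<dots> = complex_of_real (real (residue_card ord) powr (- weyl_vector r (v (r - 1)))) * z (v (r - 1)) * cell_value r z (borel_weight ord b)"
    using permutes_in_image[OF d(2), of "r - 1"] r by (intro cell_value_add_unit z) auto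
  finally have cv: "cell_value r z (borel_weight ord (b * ?T)) = \<dots>" .
  have "v \<circ> cycle_down r = w \<longleftrightarrow> v = w \<circ> inv_into UNIV (cycle_down r)"
    using permutes_inv_o[OF cy] by (auto simp: comp_assoc)
  moreover have "v (r - 1) = w 0" if "v \<circ> cycle_down r = w"
    using fun_cong[OF that, of 0] by (simp add: cycle_down_def)
  ultimately show ?thesis
    unfolding eq iwahori_vector_cell[OF borel_subgroup_mult[OF d(1) T] permutes_compose[OF cy d(2)] l(1)]
    unfolding gd iwahori_vector_cell[OF d] cv by auto
qed

end

section \<open>Recursions for spherical averages\<close>

context nonarch_local_field
begin

section \<open>Congruences modulo powers of the maximal ideal\<close>

definition near :: "nat \<Rightarrow> int \<Rightarrow> 'a mat \<Rightarrow> 'a mat \<Rightarrow> bool" where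
  "near r n x y \<longleftrightarrow> (\<forall>i<r. \<forall>j<r. x $$ (i, j) - y $$ (i, j) \<in> frac n)"

lemma near_refl: "near r n x x"
  by (simp add: near_def)

lemma near_sym: "near r n x y \<Longrightarrow> near r n y x"
  unfolding near_def using frac_minus by (metis minus_diff_eq)

lemma near_trans: "near r n x y \<Longrightarrow> near r n y z \<Longrightarrow> near r n x z"
  unfolding near_def
proof (intro allI impI)
  fix i j assume "\<forall>i<r. \<forall>j<r. x $$ (i, j) - y $$ (i, j) \<in> frac n" "\<forall>i<r. \<forall>j<r. y $$ (i, j) - z $$ (i, j) \<in> frac n" "i < r" "j < r"
  then have "(x $$ (i, j) - y $$ (i, j)) + (y $$ (i, j) - z $$ (i, j)) \<in> frac n" by (intro frac_add) auto
  then show "x $$ (i, j) - z $$ (i, j) \<in> frac n" by simp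
qed

lemma near_mult_right:
  assumes "near r n x y" "x \<in> carrier_mat r r" "y \<in> carrier_mat r r" "c \<in> carrier_mat r r"
    and c: "\<And>i j. i < r \<Longrightarrow> j < r \<Longrightarrow> c $$ (i, j) \<in> frac m"
  shows "near r (n + m) (x * c) (y * c)"
  unfolding near_def
proof (intro allI impI)
  fix i j assume ij: "i < r" "j < r"
  have "(x * c) $$ (i, j) - (y * c) $$ (i, j) = (\<Sum>l<r. (x $$ (i, l) - y $$ (i, l)) * c $$ (l, j))"
    using assms ij by (simp add: mat_mult_entry[of _ r] sum_subtractf[symmetric] algebra_simps del: index_mult_mat)
  also have "\<dots> \<in> frac (n + m)"
    using assms ij by (intro frac_sum frac_mult) (auto simp: near_def)
  finally show "(x * c) $$ (i, j) - (y * c) $$ (i, j) \<in> frac (n + m)" .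
qed

lemma near_mult_left:
  assumes "near r n x y" "x \<in> carrier_mat r r" "y \<in> carrier_mat r r" "c \<in> carrier_mat r r"
    and c: "\<And>i j. i < r \<Longrightarrow> j < r \<Longrightarrow> c $$ (i, j) \<in> frac m"
  shows "near r (m + n) (c * x) (c * y)"
  unfolding near_def
proof (intro allI impI)
  fix i j assume ij: "i < r" "j < r"
  have "(c * x) $$ (i, j) - (c * y) $$ (i, j) = (\<Sum>l<r. c $$ (i, l) * (x $$ (l, j) - y $$ (l, j)))"
    using assms ij by (simp add: mat_mult_entry[of _ r] sum_subtractf[symmetric] algebra_simps del: index_mult_mat)
  also have "\<dots> \<in> frac (m + n)"
    using assms ij by (intro frac_sum frac_mult) (auto simp: near_def)
  finally show "(c * x) $$ (i, j) - (c * y) $$ (i, j) \<in> frac (m + n)" .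
qed

lemma near_K_mult:
  assumes "near r n x y" "x \<in> K r" "y \<in> K r" "c \<in> K r"
  shows "near r n (x * c) (y * c)" "near r n (c * x) (c * y)"
  using near_mult_right[OF assms(1) assms(2-4)[THEN K_carrier], of 0] near_mult_left[OF assms(1) assms(2-4)[THEN K_carrier], of 0]
    K_entry[OF assms(4)] by simp_all

definition K_ball :: "nat \<Rightarrow> int \<Rightarrow> 'a mat \<Rightarrow> 'a mat set" where
  "K_ball r n k = {h \<in> K r. near r n h k}"

lemma K_ball_eq: "near r n h k \<Longrightarrow> K_ball r n h = K_ball r n k"
  unfolding K_ball_def using near_sym near_trans by blast

lemma K_ball_translate:
  assumes k: "k \<in> K r"
  shows "K_ball r n k = (\<lambda>g. k * g) ` K_ball r n (1\<^sub>m r)"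
proof
  obtain k' where k': "k' \<in> K r" "k * k' = 1\<^sub>m r" "k' * k = 1\<^sub>m r" using k by (rule K_inverse)
  note c = K_carrier[OF k] K_carrier[OF k'(1)]
  show "(\<lambda>g. k * g) ` K_ball r n (1\<^sub>m r) \<subseteq> K_ball r n k"
  proof
    fix h assume "h \<in> (\<lambda>g. k * g) ` K_ball r n (1\<^sub>m r)"
    then obtain g where g: "g \<in> K r" "near r n g (1\<^sub>m r)" "h = k * g" by (auto simp: K_ball_def)
    from near_K_mult(2)[OF g(2,1) K_one k] show "h \<in> K_ball r n k"
      using K_mult[OF k g(1)] g c by (simp add: K_ball_def)
  qed
  show "K_ball r n k \<subseteq> (\<lambda>g. k * g) ` K_ball r n (1\<^sub>m r)"
  proof
    fix h assume h: "h \<in> K_ball r n k"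
    then have hK: "h \<in> K r" "near r n h k" by (auto simp: K_ball_def)
    have "k' * h \<in> K_ball r n (1\<^sub>m r)"
      using near_K_mult(2)[OF hK(2,1) k k'(1)] K_mult[OF k'(1) hK(1)] k' by (simp add: K_ball_def)
    moreover have "k * (k' * h) = h"
      using mat_assoc[OF c(1,2) K_carrier[OF hK(1)]] k' K_carrier[OF hK(1)] by simp
    ultimately show "h \<in> (\<lambda>g. k * g) ` K_ball r n (1\<^sub>m r)" by (metis imageI)
  qed
qed

text \<open>Multiplication by integral matrices preserves congruences on either side, which is the
  normality of the congruence subgroups.\<close>

lemma K_ball_translate_right:
  assumes k: "k \<in> K r" and c: "c \<in> K r"
  shows "(\<lambda>g. g * c) ` K_ball r n k = K_ball r n (k * c)"
proof
  obtain c' where c': "c' \<in> K r" "c * c' = 1\<^sub>m r" "c' * c = 1\<^sub>m r" using c by (rule K_inverse)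
  note cc = K_carrier[OF k] K_carrier[OF c] K_carrier[OF c'(1)]
  show "(\<lambda>g. g * c) ` K_ball r n k \<subseteq> K_ball r n (k * c)"
    using near_K_mult(1) k c K_mult by (auto simp: K_ball_def)
  show "K_ball r n (k * c) \<subseteq> (\<lambda>g. g * c) ` K_ball r n k"
  proof
    fix h assume "h \<in> K_ball r n (k * c)"
    then have h: "h \<in> K r" "near r n h (k * c)" by (auto simp: K_ball_def)
    have "k * c * c' = k" using mat_assoc[OF cc] c' cc by simp
    then have "h * c' \<in> K_ball r n k"
      using near_K_mult(1)[OF h(2,1) K_mult[OF k c] c'(1)] K_mult[OF h(1) c'(1)] by (simp add: K_ball_def)
    moreover have "h * c' * c = h" using mat_assoc[OF K_carrier[OF h(1)] cc(3,2)] c' K_carrier[OF h(1)] by simp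
    ultimately show "h \<in> (\<lambda>g. g * c) ` K_ball r n k" by (metis imageI)
  qed
qed

text \<open>Digit expansion: once x is known modulo the n-th power, the quotient of the error by the
  n-th power of the uniformizer contributes one more residue.\<close>

lemma finite_residue_system:
  "\<exists>R. finite R \<and> (\<forall>x\<in>frac 0. \<exists>a\<in>R. x - a \<in> frac (int n))"
proof (induction n)
  case 0
  show ?case by (intro exI[of _ "{0}"]) auto
next
  case (Suc n)
  obtain R where R: "finite R" "\<forall>x\<in>frac 0. \<exists>a\<in>R. x - a \<in> frac (int n)" using Suc.IH by blast
  obtain A where "residue_system A" using ex_residue_system by blast
  note A = residue_systemD[OF this]
  obtain p where p: "p \<noteq> 0" "ord p = 1" using ex_uniformizer by (auto simp: uniformizer_def)
  have pn: "ord (p ^ n) = int n" by (induction n) (use p in \<open>auto simp: ord_mult\<close>)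
  show ?case
  proof (intro exI[of _ "(\<lambda>(a, b). a + p ^ n * b) ` (R \<times> A)"] conjI ballI)
    show "finite ((\<lambda>(a, b). a + p ^ n * b) ` (R \<times> A))" using R(1) A(1) by simp
    fix x assume "x \<in> frac 0"
    with R(2) obtain a where a: "a \<in> R" "x - a \<in> frac (int n)" by blast
    have "(x - a) / p ^ n \<in> frac 0"
      using a(2) p pn by (cases "x = a") (auto simp: frac_iff ord_divide)
    then obtain b where b: "b \<in> A" "(x - a) / p ^ n - b \<in> frac 1" using A(4) by blast
    have "p ^ n * ((x - a) / p ^ n - b) \<in> frac (int n + 1)"
      by (intro frac_mult b) (simp add: frac_iff pn)
    moreover have "p ^ n * ((x - a) / p ^ n - b) = x - (a + p ^ n * b)" using p by (simp add: field_simps)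
    ultimately show "\<exists>c\<in>(\<lambda>(a, b). a + p ^ n * b) ` (R \<times> A). x - c \<in> frac (int (Suc n))"
      using a(1) b(1) by (intro bexI[of _ "a + p ^ n * b"]) (auto simp: add.commute)
  qed
qed

lemma finite_image_factor:
  assumes "finite (f ` S)" "\<And>x y. x \<in> S \<Longrightarrow> y \<in> S \<Longrightarrow> f x = f y \<Longrightarrow> g x = g y"
  shows "finite (g ` S)"
proof -
  have "g ` S \<subseteq> (\<lambda>c. g (SOME x. x \<in> S \<and> f x = c)) ` f ` S"
  proof
    fix y assume "y \<in> g ` S"
    then obtain x where x: "x \<in> S" "y = g x" by auto
    define x' where "x' = (SOME u. u \<in> S \<and> f u = f x)"
    have "x' \<in> S \<and> f x' = f x" unfolding x'_def by (rule someI[of _ x]) (use x in simp)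
    then have "g x' = y" using assms(2)[of x' x] x by simp
    then show "y \<in> (\<lambda>c. g (SOME x. x \<in> S \<and> f x = c)) ` f ` S" using x(1) by (auto simp: x'_def)
  qed
  then show ?thesis using assms(1) finite_subset by blast
qed

text \<open>A ball is determined by the residue representatives of the matrix entries, and there are
  finitely many of these.\<close>

lemma finite_K_balls: "finite (K_ball r n ` K r)"
proof -
  obtain R where R: "finite R" "\<forall>x\<in>frac 0. \<exists>a\<in>R. x - a \<in> frac (int (nat n))"
    using finite_residue_system[of "nat n"] by blast
  define \<rho> where "\<rho> x = (SOME a. a \<in> R \<and> x - a \<in> frac n)" for x
  have \<rho>: "\<rho> x \<in> R \<and> x - \<rho> x \<in> frac n" if x: "x \<in> frac 0" for x
  proof -
    obtain a where "a \<in> R" "x - a \<in> frac n" using bspec[OF R(2) x] frac_mono[of _ "int (nat n)" n] by auto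
    then show ?thesis unfolding \<rho>_def by (intro someI[of "\<lambda>a. a \<in> R \<and> x - a \<in> frac n" a]) simp
  qed
  define code where "code k = (\<lambda>(i, j)\<in>{..<r} \<times> {..<r}. \<rho> (k $$ (i, j)))" for k :: "'a mat"
  show ?thesis
  proof (rule finite_image_factor[of code])
    have "code ` K r \<subseteq> {..<r} \<times> {..<r} \<rightarrow>\<^sub>E R"
      unfolding code_def image_subset_iff restrict_PiE_iff using \<rho> K_entry by auto
    then show "finite (code ` K r)" by (rule finite_subset) (intro finite_PiE, use R in auto)
    fix x y assume xy: "x \<in> K r" "y \<in> K r" "code x = code y"
    have "near r n x y" unfolding near_def
    proof (intro allI impI)
      fix i j assume ij: "i < r" "j < r"
      have "\<rho> (x $$ (i, j)) = \<rho> (y $$ (i, j))" using fun_cong[OF xy(3), of "(i, j)"] ij by (simp add: code_def)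
      then show "x $$ (i, j) - y $$ (i, j) \<in> frac n"
        using \<rho>[OF K_entry[OF xy(1) ij]] \<rho>[OF K_entry[OF xy(2) ij]] frac_diff[of "x $$ (i, j) - \<rho> (x $$ (i, j))" n "y $$ (i, j) - \<rho> (y $$ (i, j))"] by simp
    qed
    then show "K_ball r n x = K_ball r n y" by (rule K_ball_eq)
  qed
qed

lemma in_K_ball: "k \<in> K r \<Longrightarrow> k \<in> K_ball r n k"
  by (simp add: K_ball_def near_refl)

lemma K_ball_J: "1 \<le> n \<Longrightarrow> K_ball r n (1\<^sub>m r) \<subseteq> J r"
proof
  fix h assume n: "1 \<le> n" and h: "h \<in> K_ball r n (1\<^sub>m r)"
  have "h $$ (i, j) \<in> frac 1" if "i < r" "j < i" for i j
  proof -
    have "j < r" using that by simp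
    then have "h $$ (i, j) - (1\<^sub>m r :: 'a mat) $$ (i, j) \<in> frac n" using h that unfolding K_ball_def near_def by blast
    then show ?thesis using that n frac_mono by auto
  qed
  then show "h \<in> J r" using h by (auto simp: K_ball_def iwahori_iff)
qed

lemma J_near: "near r 1 h g \<Longrightarrow> g \<in> J r \<Longrightarrow> h \<in> K r \<Longrightarrow> h \<in> J r"
proof -
  assume a: "near r 1 h g" "g \<in> J r" "h \<in> K r"
  have "h $$ (i, j) \<in> frac 1" if "i < r" "j < i" for i j
  proof -
    have "h $$ (i, j) - g $$ (i, j) \<in> frac 1" "g $$ (i, j) \<in> frac 1"
      using a that by (auto simp: near_def iwahori_iff)
    then show ?thesis using frac_add by fastforce
  qed
  then show ?thesis using a by (simp add: iwahori_iff)
qed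

section \<open>Integration over the maximal compact subgroup\<close>

context
  fixes dk :: "'a mat measure" and r :: nat
  assumes haar: "normalized_haar ord r dk"
begin

lemma haar_space: "space dk = K r"
  using haar by (simp add: normalized_haar_def)

lemma open_sets:
  assumes "U \<subseteq> K r" "\<And>g h. g \<in> U \<Longrightarrow> h \<in> K r \<Longrightarrow> near r n h g \<Longrightarrow> h \<in> U"
  shows "U \<in> sets dk"
proof -
  have "open_in_GL_integers ord r U"
    unfolding open_in_GL_integers_def using assms by (auto simp: near_def intro!: exI[of _ n])
  then show ?thesis using haar unfolding normalized_haar_def by (auto intro: sigma_sets.Basic)
qed

lemma K_ball_sets: "K_ball r n k \<in> sets dk"
  by (rule open_sets[of _ n]) (auto simp: K_ball_def intro: near_trans)

lemma J_sets: "J r \<in> sets dk"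
  by (rule open_sets[of _ 1]) (auto simp: iwahori_K intro: J_near)

lemma J_measure: "emeasure dk (J r) = 1"
  using haar by (simp add: normalized_haar_def)

lemma K_ball_emeasure: "k \<in> K r \<Longrightarrow> emeasure dk (K_ball r n k) = emeasure dk (K_ball r n (1\<^sub>m r))"
  using haar K_ball_sets unfolding normalized_haar_def by (simp add: K_ball_translate)

lemma K_ball_finite: "1 \<le> n \<Longrightarrow> k \<in> K r \<Longrightarrow> emeasure dk (K_ball r n k) < \<infinity>"
proof -
  assume "1 \<le> n" "k \<in> K r"
  then have "emeasure dk (K_ball r n k) \<le> emeasure dk (J r)"
    unfolding K_ball_emeasure[OF \<open>k \<in> K r\<close>] by (intro emeasure_mono K_ball_J J_sets)
  then show ?thesis by (simp add: J_measure le_less_trans[of _ 1])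
qed

definition locally_const :: "int \<Rightarrow> ('a mat \<Rightarrow> complex) \<Rightarrow> bool" where
  "locally_const n f \<longleftrightarrow> (\<forall>h\<in>K r. \<forall>k\<in>K r. near r n h k \<longrightarrow> f h = f k)"

text \<open>There are finitely many balls, and left invariance gives them all the same measure. It
  is finite because for positive n the ball around 1 is contained in the Iwahori subgroup, which has
  volume 1.\<close>

lemma locally_const_integral:
  assumes f: "locally_const n f" and n: "1 \<le> n"
  shows "has_bochner_integral dk f (\<Sum>C\<in>K_ball r n ` K r. measure dk (K_ball r n (1\<^sub>m r)) *\<^sub>R f (SOME k. k \<in> C))"
proof -
  let ?D = "K_ball r n ` K r" and ?F = "\<lambda>C. f (SOME k. k \<in> C)"
  have rep: "f k = ?F C" if "C \<in> ?D" "k \<in> C" for C k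
  proof -
    from that(1) obtain h where h: "h \<in> K r" "C = K_ball r n h" by auto
    have "(SOME k. k \<in> C) \<in> C" using that(2) by (rule someI)
    then have "(SOME k. k \<in> C) \<in> K r" "near r n (SOME k. k \<in> C) h" using h by (auto simp: K_ball_def)
    moreover have "k \<in> K r" "near r n k h" using that h by (auto simp: K_ball_def)
    ultimately show ?thesis using f unfolding locally_const_def by (metis near_sym near_trans)
  qed
  have "has_bochner_integral dk (\<lambda>k. \<Sum>C\<in>?D. indicator C k *\<^sub>R ?F C) (\<Sum>C\<in>?D. measure dk (K_ball r n (1\<^sub>m r)) *\<^sub>R ?F C)"
  proof (rule has_bochner_integral_sum)
    fix C assume "C \<in> ?D"
    then obtain h where h: "h \<in> K r" "C = K_ball r n h" by auto
    have "measure dk C = measure dk (K_ball r n (1\<^sub>m r))" using K_ball_emeasure[OF h(1)] h by (simp add: measure_def)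
    then show "has_bochner_integral dk (\<lambda>k. indicator C k *\<^sub>R ?F C) (measure dk (K_ball r n (1\<^sub>m r)) *\<^sub>R ?F C)"
      using has_bochner_integral_indicator[of C dk "?F C"] K_ball_sets K_ball_finite[OF n h(1)] h by simp
  qed
  moreover have "(\<Sum>C\<in>?D. indicator C k *\<^sub>R ?F C) = f k" if "k \<in> space dk" for k
  proof -
    have k: "k \<in> K r" using that haar_space by simp
    have "k \<in> C \<longleftrightarrow> C = K_ball r n k" if "C \<in> ?D" for C
    proof -
      obtain h where "h \<in> K r" "C = K_ball r n h" using \<open>C \<in> ?D\<close> by auto
      then show ?thesis using in_K_ball[OF k] K_ball_eq[of r n k h] by (auto simp: K_ball_def)
    qed
    moreover have "?F (K_ball r n k) = f k" using rep[of "K_ball r n k" k] in_K_ball[OF k] k by simp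
    ultimately have "(\<Sum>C\<in>?D. indicator C k *\<^sub>R ?F C) = (\<Sum>C\<in>?D. if C = K_ball r n k then f k else 0)"
      by (intro sum.cong) (auto simp: indicator_def)
    then show ?thesis using k by (simp add: finite_K_balls)
  qed
  ultimately show ?thesis by (subst has_bochner_integral_cong[OF refl _ refl]) auto
qed

lemma locally_const_integrable: "locally_const n f \<Longrightarrow> 1 \<le> n \<Longrightarrow> integrable dk f"
  using locally_const_integral by (auto simp: integrable.simps)

text \<open>\<open>normalized_haar\<close> provides left invariance. Right invariance on locally
  constant functions follows because right translation permutes balls of equal measure.\<close>

lemma locally_const_right_translate:
  assumes f: "locally_const n f" and n: "1 \<le> n" and c: "c \<in> K r"
  shows "(LINT k|dk. f (k * c)) = (LINT k|dk. f k)"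
proof -
  let ?D = "K_ball r n ` K r" and ?\<tau> = "\<lambda>C. (\<lambda>g. g * c) ` C"
  have f': "locally_const n (\<lambda>k. f (k * c))"
    using f near_K_mult(1) K_mult c unfolding locally_const_def by blast
  obtain c' where c': "c' \<in> K r" "c * c' = 1\<^sub>m r" "c' * c = 1\<^sub>m r" using c by (rule K_inverse)
  have inv: "g * c * c' = g" "g * c' * c = g" if "g \<in> K r" for g
    using mat_assoc[OF K_carrier[OF that] K_carrier[OF c] K_carrier[OF c'(1)]]
      mat_assoc[OF K_carrier[OF that] K_carrier[OF c'(1)] K_carrier[OF c]] c' K_carrier[OF that] by auto
  have bij: "bij_betw ?\<tau> ?D ?D"
  proof (rule bij_betw_byWitness[where f' = "\<lambda>C. (\<lambda>g. g * c') ` C"])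
    have sub: "C \<subseteq> K r" if "C \<in> ?D" for C using that by (auto simp: K_ball_def)
    show "\<forall>C\<in>?D. (\<lambda>g. g * c') ` ?\<tau> C = C"
    proof
      fix C assume "C \<in> ?D"
      then have "g * c * c' = g" if "g \<in> C" for g using sub inv that by blast
      then show "(\<lambda>g. g * c') ` ?\<tau> C = C" by (simp add: image_image cong: image_cong)
    qed
    show "\<forall>C\<in>?D. ?\<tau> ((\<lambda>g. g * c') ` C) = C"
    proof
      fix C assume "C \<in> ?D"
      then have "g * c' * c = g" if "g \<in> C" for g using sub inv that by blast
      then show "?\<tau> ((\<lambda>g. g * c') ` C) = C" by (simp add: image_image cong: image_cong)
    qed
    show "?\<tau> ` ?D \<subseteq> ?D" using K_ball_translate_right[OF _ c] K_mult[OF _ c] by auto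
    show "(\<lambda>C. (\<lambda>g. g * c') ` C) ` ?D \<subseteq> ?D" using K_ball_translate_right[OF _ c'(1)] K_mult[OF _ c'(1)] by auto
  qed
  have rep: "f ((SOME k. k \<in> C) * c) = f (SOME k. k \<in> ?\<tau> C)" if CD: "C \<in> ?D" for C
  proof -
    obtain h where h: "h \<in> K r" "C = K_ball r n h" using CD by auto
    have "(SOME k. k \<in> C) \<in> C" using in_K_ball[OF h(1)] h(2) by (metis someI)
    then have 1: "(SOME k. k \<in> C) * c \<in> ?\<tau> C" by simp
    then have 2: "(SOME k. k \<in> ?\<tau> C) \<in> ?\<tau> C" by (rule someI)
    have t: "?\<tau> C = K_ball r n (h * c)" using K_ball_translate_right[OF h(1) c] h(2) by simp
    from 1 2 show ?thesis
      using f near_trans near_sym unfolding t K_ball_def locally_const_def by (metis (mono_tags, lifting) mem_Collect_eq)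
  qed
  have "(LINT k|dk. f (k * c)) = (\<Sum>C\<in>?D. measure dk (K_ball r n (1\<^sub>m r)) *\<^sub>R f ((SOME k. k \<in> C) * c))"
    using locally_const_integral[OF f' n] by (rule has_bochner_integral_integral_eq)
  also have "\<dots> = (\<Sum>C\<in>?D. measure dk (K_ball r n (1\<^sub>m r)) *\<^sub>R f (SOME k. k \<in> ?\<tau> C))"
    by (intro sum.cong refl) (simp add: rep)
  also have "\<dots> = (\<Sum>C\<in>?D. measure dk (K_ball r n (1\<^sub>m r)) *\<^sub>R f (SOME k. k \<in> C))"
    by (rule sum.reindex_bij_betw[OF bij])
  also have "\<dots> = (LINT k|dk. f k)"
    using locally_const_integral[OF f n] by (rule has_bochner_integral_integral_eq[symmetric])
  finally show ?thesis .
qed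

text \<open>By right invariance under the Iwahori subgroup it suffices that
  \<open>g' * (u * g)\<close>, with g' the inverse of g, lies in that subgroup for every u in a
  small congruence subgroup.\<close>

lemma iwahori_vector_locally_const:
  assumes g: "g \<in> GL r"
  obtains n where "1 \<le> n" "locally_const n (\<lambda>k. iwahori_vector ord r z w (k * g))"
proof -
  obtain g' where g': "g \<in> carrier_mat r r" "g' \<in> carrier_mat r r" "g * g' = 1\<^sub>m r" "g' * g = 1\<^sub>m r"
    using g by (rule GL_E)
  define E where "E = (\<lambda>(i, j). \<bar>ord (g $$ (i, j))\<bar> + \<bar>ord (g' $$ (i, j))\<bar>) ` ({..<r} \<times> {..<r})"
  define m where "m = Max (insert 0 E)"
  have fin: "finite (insert 0 E)" by (simp add: E_def)
  have m0: "0 \<le> m" unfolding m_def using fin by (intro Max_ge) auto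
  have bound: "\<bar>ord (g $$ (i, j))\<bar> + \<bar>ord (g' $$ (i, j))\<bar> \<le> m" if "i < r" "j < r" for i j
    unfolding m_def using fin that by (intro Max_ge) (auto simp: E_def)
  have ent: "g $$ (i, j) \<in> frac (- m)" "g' $$ (i, j) \<in> frac (- m)" if "i < r" "j < r" for i j
    using bound[OF that] by (auto simp: frac_iff)
  \<comment> \<open>Conjugation loses at most m in valuation for each of g and its inverse; the
    remaining 1 gives a congruence modulo the maximal ideal.\<close>
  define n where "n = 2 * m + 1"
  have n: "1 \<le> n" using m0 by (simp add: n_def)
  have conj: "near r 1 (g' * (u * g)) (1\<^sub>m r)" if u: "u \<in> K r" "near r n u (1\<^sub>m r)" for u
  proof -
    have uc: "u \<in> carrier_mat r r" using u(1) by (rule K_carrier)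
    have "near r (n + - m) (u * g) (1\<^sub>m r * g)"
      by (rule near_mult_right[OF u(2)]) (use uc g' ent in auto)
    then have "near r (- m + (n + - m)) (g' * (u * g)) (g' * (1\<^sub>m r * g))"
      by (rule near_mult_left) (use uc g' ent in auto)
    then show ?thesis using g' by (simp add: n_def)
  qed
  have J: "g' * (u * g) \<in> J r" if u: "u \<in> K r" "near r n u (1\<^sub>m r)" for u
  proof -
    obtain u' where u': "u' \<in> K r" "u * u' = 1\<^sub>m r" "u' * u = 1\<^sub>m r" using u(1) by (rule K_inverse)
    note uc = K_carrier[OF u(1)] K_carrier[OF u'(1)]
    \<comment> \<open>The inverse of u is congruent to 1 as well, so the conjugate and its inverse
      are both integral.\<close>
    have "near r n (u' * u) (u' * 1\<^sub>m r)" by (rule near_K_mult(2)[OF u(2,1) K_one u'(1)])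
    then have nu': "near r n u' (1\<^sub>m r)" using u' uc near_sym by simp
    have int: "integral_mat ord r x" if "near r 1 x (1\<^sub>m r)" "x \<in> carrier_mat r r" for x
    proof -
      have "x $$ (i, j) \<in> frac 0" if ij: "i < r" "j < r" for i j
      proof -
        have "x $$ (i, j) - (1\<^sub>m r :: 'a mat) $$ (i, j) \<in> frac 0"
          using \<open>near r 1 x (1\<^sub>m r)\<close> ij frac_mono[of _ 1 0] by (auto simp: near_def)
        moreover have "(1\<^sub>m r :: 'a mat) $$ (i, j) \<in> frac 0" using ij by simp
        ultimately show ?thesis using frac_add[of "x $$ (i, j) - (1\<^sub>m r :: 'a mat) $$ (i, j)" 0 "(1\<^sub>m r :: 'a mat) $$ (i, j)"] by simp
      qed
      then show ?thesis using that(2) by (simp add: integral_mat_def)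
    qed
    have prod: "g' * (x * g) * (g' * (y * g)) = 1\<^sub>m r" if "x \<in> carrier_mat r r" "y \<in> carrier_mat r r" "x * y = 1\<^sub>m r" for x y
    proof -
      have "g' * (x * g) * (g' * (y * g)) = g' * (x * g * (g' * (y * g)))" using that g' by (intro mat_assoc[of _ r]) auto
      also have "x * g * (g' * (y * g)) = x * (g * (g' * (y * g)))" using that g' by (intro mat_assoc[of _ r]) auto
      also have "g * (g' * (y * g)) = g * g' * (y * g)" using that g' by (intro mat_assoc[of _ r, symmetric]) auto
      also have "\<dots> = y * g" unfolding g'(3) by (rule left_mult_one_mat[of _ r r]) (use that g' in simp)
      also have "x * (y * g) = x * y * g" using that g' by (intro mat_assoc[of _ r, symmetric]) auto
      finally show ?thesis using that g' by simp
    qed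
    have "g' * (u * g) \<in> K r"
      unfolding GL_integers_def
      using int[OF conj[OF u]] int[OF conj[OF u'(1) nu']] prod[OF uc u'(2)] prod[OF uc(2,1) u'(3)] uc g' by auto
    then show ?thesis using conj[OF u] K_ball_J[of 1 r] by (auto simp: K_ball_def)
  qed
  have "locally_const n (\<lambda>k. iwahori_vector ord r z w (k * g))"
    unfolding locally_const_def
  proof (intro ballI impI)
    fix h k assume hk: "h \<in> K r" "k \<in> K r" "near r n h k"
    obtain k' where k': "k' \<in> K r" "k * k' = 1\<^sub>m r" "k' * k = 1\<^sub>m r" using hk(2) by (rule K_inverse)
    define u where "u = k' * h"
    have u: "u \<in> K r" "near r n u (1\<^sub>m r)"
      using near_K_mult(2)[OF hk(3,1,2) k'(1)] K_mult[OF k'(1) hk(1)] k' by (auto simp: u_def)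
    note c = K_carrier[OF hk(1)] K_carrier[OF hk(2)] K_carrier[OF k'(1)] K_carrier[OF u(1)]
    have "k * g * (g' * (u * g)) = k * (g * (g' * (u * g)))" using c g' by (intro mat_assoc[of _ r]) auto
    also have "g * (g' * (u * g)) = g * g' * (u * g)" using c g' by (intro mat_assoc[of _ r, symmetric]) auto
    also have "\<dots> = u * g" unfolding g'(3) by (rule left_mult_one_mat[of _ r r]) (use c g' in simp)
    also have "k * (u * g) = k * u * g" using c g' by (intro mat_assoc[of _ r, symmetric]) auto
    also have "k * u = k * k' * h" unfolding u_def using c by (intro mat_assoc[of _ r, symmetric]) auto
    finally have "k * g * (g' * (u * g)) = h * g" using k' c by simp
    then show "iwahori_vector ord r z w (h * g) = iwahori_vector ord r z w (k * g)"
      using iwahori_vector_right[OF GL_mult[OF K_GL[OF hk(2)] g] J[OF u], of z w] by simp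
  qed
  then show ?thesis using that n by blast
qed

section \<open>Relations between spherical averages\<close>

abbreviation S :: "(nat \<Rightarrow> complex) \<Rightarrow> (nat \<Rightarrow> nat) \<Rightarrow> 'a mat \<Rightarrow> complex" where
  "S z w g \<equiv> spherical_average ord r dk z w g"

lemma average_integrable: "g \<in> GL r \<Longrightarrow> integrable dk (\<lambda>k. iwahori_vector ord r z w (k * g))"
  using iwahori_vector_locally_const locally_const_integrable by metis

text \<open>A factor from K on the left of g becomes a right translation of the variable of
  integration.\<close>

lemma average_left:
  assumes g: "g \<in> GL r" and c: "c \<in> K r"
  shows "S z w (c * g) = S z w g"
proof -
  obtain n where n: "1 \<le> n" "locally_const n (\<lambda>k. iwahori_vector ord r z w (k * g))"
    using g by (rule iwahori_vector_locally_const)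
  have "S z w (c * g) = (LINT k|dk. iwahori_vector ord r z w (k * c * g))"
    unfolding spherical_average_def
  proof (rule Bochner_Integration.integral_cong[OF refl])
    fix k assume "k \<in> space dk"
    then have "k * c * g = k * (c * g)" using haar_space c g by (intro mat_assoc[of _ r]) (auto intro: K_carrier GL_carrier)
    then show "iwahori_vector ord r z w (k * (c * g)) = iwahori_vector ord r z w (k * c * g)" by simp
  qed
  also have "\<dots> = S z w g"
    unfolding spherical_average_def by (rule locally_const_right_translate[OF n(2,1) c])
  finally show ?thesis .
qed

lemma average_hecke:
  assumes g: "g \<in> GL r" and i: "Suc i < r" and w: "w permutes {..<r}"
    and A: "finite A" "card A = residue_card ord" "A \<subseteq> frac 0" "\<And>x. x \<in> frac 0 \<Longrightarrow> \<exists>!a. a \<in> A \<and> x - a \<in> frac 1"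
  shows "(\<Sum>a\<in>A. S z w (g * (root_elt r i (Suc i) a * perm_mat r (adj i)))) =
    (if w i < w (Suc i) then S z (w \<circ> adj i) g
     else of_nat (residue_card ord) * S z (w \<circ> adj i) g + (of_nat (residue_card ord) - 1) * S z w g)"
proof -
  let ?X = "\<lambda>a. root_elt r i (Suc i) a * perm_mat r (adj i)"
  have X: "?X a \<in> GL r" if "a \<in> A" for a
    using A(3) that i adj_permutes[OF i] by (intro GL_mult perm_mat_GL K_GL[OF root_elt_K]) auto
  have "(\<Sum>a\<in>A. S z w (g * ?X a)) = (LINT k|dk. (\<Sum>a\<in>A. iwahori_vector ord r z w (k * (g * ?X a))))"
    unfolding spherical_average_def
    by (intro Bochner_Integration.integral_sum[symmetric] average_integrable GL_mult[OF g X])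
  also have "\<dots> = (LINT k|dk. (if w i < w (Suc i) then iwahori_vector ord r z (w \<circ> adj i) (k * g)
     else of_nat (residue_card ord) * iwahori_vector ord r z (w \<circ> adj i) (k * g)
        + (of_nat (residue_card ord) - 1) * iwahori_vector ord r z w (k * g)))"
  proof (rule Bochner_Integration.integral_cong[OF refl])
    fix k assume "k \<in> space dk"
    then have k: "k \<in> K r" using haar_space by simp
    have "k * (g * ?X a) = k * g * ?X a" for a
      using k g by (intro mat_assoc[of _ r, symmetric]) (auto intro: K_carrier GL_carrier)
    then show "(\<Sum>a\<in>A. iwahori_vector ord r z w (k * (g * ?X a))) =
      (if w i < w (Suc i) then iwahori_vector ord r z (w \<circ> adj i) (k * g)
     else of_nat (residue_card ord) * iwahori_vector ord r z (w \<circ> adj i) (k * g)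
        + (of_nat (residue_card ord) - 1) * iwahori_vector ord r z w (k * g))"
      using hecke_sum[OF GL_mult[OF K_GL[OF k] g] i w A] by simp
  qed
  also have "\<dots> = (if w i < w (Suc i) then S z (w \<circ> adj i) g
     else of_nat (residue_card ord) * S z (w \<circ> adj i) g + (of_nat (residue_card ord) - 1) * S z w g)"
    unfolding spherical_average_def using average_integrable[OF g] by simp
  finally show ?thesis .
qed

text \<open>
  Since \<open>lam (Suc i) \<le> lam i\<close>, the coset representatives can be moved past the torus element into
  K, under which the average is left invariant.
\<close>

lemma average_swap:
  assumes p: "uniformizer ord p" and i: "Suc i < r" and w: "w permutes {..<r}" and lam: "lam (Suc i) \<le> lam i"
  shows "of_nat (residue_card ord) * S z w (torus_elt p r (lam \<circ> adj i)) =
    (if w i < w (Suc i) then S z (w \<circ> adj i) (torus_elt p r lam)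
     else of_nat (residue_card ord) * S z (w \<circ> adj i) (torus_elt p r lam)
       + (of_nat (residue_card ord) - 1) * S z w (torus_elt p r lam))"
proof -
  have p0: "p \<noteq> 0" "ord p = 1" using p by (auto simp: uniformizer_def)
  obtain A where "residue_system A" using ex_residue_system by blast
  note A = residue_systemD[OF this]
  let ?s = "adj i" and ?T = "\<lambda>e. torus_elt p r e"
  let ?P = "perm_mat r ?s :: 'a mat"
  have s: "?s permutes {..<r}" by (rule adj_permutes[OF i])
  have TG: "?T e \<in> GL r" for e using torus_borel[OF p0(1)] by (auto simp: borel_subgroup_def)
  have "S z w (?T lam * (root_elt r i (Suc i) a * ?P)) = S z w (?T (lam \<circ> ?s))" if "a \<in> A" for a
  proof -
    \<comment> \<open>Moving the root element to the left of the torus element scales its parameter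
      by this power of the uniformizer, whose exponent is nonnegative by the assumption on
      \<open>lam\<close>.\<close>
    define a' where "a' = p powi (lam i - lam (Suc i)) * a"
    have a: "a \<in> frac 0" using A that by auto
    have "p powi (lam i - lam (Suc i)) \<in> frac 0"
    proof -
      have "p powi (lam i - lam (Suc i)) = p ^ nat (lam i - lam (Suc i))" using lam by (simp add: power_int_def)
      moreover have "ord (p ^ n) = int n" for n by (induction n) (use p0 in \<open>auto simp: ord_mult\<close>)
      ultimately show ?thesis by (simp add: frac_iff)
    qed
    then have a': "a' \<in> frac 0" using a by (simp add: a'_def frac_mult0)
    have comm: "?T lam * root_elt r i (Suc i) a = root_elt r i (Suc i) a' * ?T lam"
    proof (rule mat_eqI[where r = r])
      fix k l assume kl: "k < r" "l < r"
      have "(?T lam * root_elt r i (Suc i) a) $$ (k, l) = p powi lam k * root_elt r i (Suc i) a $$ (k, l)"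
        by (rule torus_mult_entry(1)) (use kl in auto)
      moreover have "(root_elt r i (Suc i) a' * ?T lam) $$ (k, l) = root_elt r i (Suc i) a' $$ (k, l) * p powi lam l"
        by (rule torus_mult_entry(2)) (use kl in auto)
      moreover have "p powi lam i = p powi (lam i - lam (Suc i)) * p powi lam (Suc i)"
        using p0 by (simp flip: power_int_add)
      ultimately show "(?T lam * root_elt r i (Suc i) a) $$ (k, l) = (root_elt r i (Suc i) a' * ?T lam) $$ (k, l)"
        using kl by (auto simp: root_elt_def elim_entry a'_def simp del: index_mult_mat)
    qed auto
    have "(\<lambda>i. (lam \<circ> ?s) (inv_into UNIV ?s i)) = lam" by (simp add: fun_eq_iff)
    then have TP: "?T lam * ?P = ?P * ?T (lam \<circ> ?s)"
      using perm_torus[OF s, of p "lam \<circ> ?s"] by (simp only:)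
    have "?T lam * (root_elt r i (Suc i) a * ?P) = ?T lam * root_elt r i (Suc i) a * ?P"
      by (intro mat_assoc[of _ r, symmetric]) auto
    also have "\<dots> = root_elt r i (Suc i) a' * (?T lam * ?P)" unfolding comm by (intro mat_assoc[of _ r]) auto
    also have "\<dots> = root_elt r i (Suc i) a' * ?P * ?T (lam \<circ> ?s)" unfolding TP by (intro mat_assoc[of _ r, symmetric]) auto
    finally show ?thesis
      using average_left[OF TG K_mult[OF root_elt_K[OF _ a', of i] perm_mat_K[OF s]]] i by simp
  qed
  then have "(\<Sum>a\<in>A. S z w (?T lam * (root_elt r i (Suc i) a * ?P))) = of_nat (residue_card ord) * S z w (?T (lam \<circ> ?s))"
    using A(2) by simp
  then show ?thesis using average_hecke[OF TG i w A, of z lam] by simp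
qed

text \<open>
  The rotation element normalizes the Iwahori subgroup.
\<close>

lemma average_rotation:
  assumes p: "uniformizer ord p" and r: "0 < r" and w: "w permutes {..<r}" and z: "\<And>i. i < r \<Longrightarrow> z i \<noteq> 0"
  shows "S z w (torus_elt p r (\<lambda>i. lam (cycle_down r i) + (if i = 0 then 1 else 0))) =
    complex_of_real (real (residue_card ord) powr (- weyl_vector r (w 0))) * z (w 0) *
    S z (w \<circ> inv_into UNIV (cycle_down r)) (torus_elt p r lam)"
proof -
  have p0: "p \<noteq> 0" using p by (auto simp: uniformizer_def)
  note c = cycle_down_permutes[OF r]
  let ?T = "\<lambda>e. torus_elt p r e" and ?P = "perm_mat r (cycle_down r) :: 'a mat"
  let ?mu = "\<lambda>i. lam (cycle_down r i) + (if i = 0 then 1 else 0)"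
  have TG: "?T e \<in> GL r" for e using torus_borel[OF p0] by (auto simp: borel_subgroup_def)
  have "?T (\<lambda>i. ?mu (inv_into UNIV (cycle_down r) i)) = ?T (\<lambda>i. lam i + unit_weight (r - 1) i)"
  proof (rule mat_eqI[where r = r])
    fix i j assume "i < r" "j < r"
    moreover have "inv_into UNIV (cycle_down r) i = 0 \<longleftrightarrow> i = r - 1"
      unfolding permutes_inv_eq[OF c] by (auto simp: cycle_down_def)
    then have "?mu (inv_into UNIV (cycle_down r) i) = lam i + unit_weight (r - 1) i"
      by (simp only: permutes_inverses(1)[OF c] unit_weight_def)
    ultimately show "?T (\<lambda>i. ?mu (inv_into UNIV (cycle_down r) i)) $$ (i, j) = ?T (\<lambda>i. lam i + unit_weight (r - 1) i) $$ (i, j)"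
      by (simp only: torus_entry)
  qed auto
  then have "?P * ?T ?mu = ?T (\<lambda>i. lam i + unit_weight (r - 1) i) * ?P"
    using perm_torus[OF c, of p ?mu] by simp
  also have "\<dots> = ?T lam * ?T (unit_weight (r - 1)) * ?P" by (simp add: torus_add[OF p0])
  also have "\<dots> = ?T lam * rotation_elt p r" unfolding rotation_elt_def by (intro mat_assoc[of _ r]) auto
  finally have eq: "?P * ?T ?mu = ?T lam * rotation_elt p r" .
  \<comment> \<open>The permutation matrix of the cycle lies in K and may be inserted on the
    left.\<close>
  have "S z w (?T ?mu) = S z w (?T lam * rotation_elt p r)"
    using average_left[OF TG perm_mat_K[OF c], of z w ?mu] by (simp add: eq)
  also have "\<dots> = (LINT k|dk. complex_of_real (real (residue_card ord) powr (- weyl_vector r (w 0))) * z (w 0) *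
     iwahori_vector ord r z (w \<circ> inv_into UNIV (cycle_down r)) (k * ?T lam))"
    unfolding spherical_average_def
  proof (rule Bochner_Integration.integral_cong[OF refl])
    fix k assume "k \<in> space dk"
    then have k: "k \<in> K r" using haar_space by simp
    have "k * (?T lam * rotation_elt p r) = k * ?T lam * rotation_elt p r"
      using k by (intro mat_assoc[of _ r, symmetric]) (auto intro: K_carrier)
    then show "iwahori_vector ord r z w (k * (?T lam * rotation_elt p r)) =
       complex_of_real (real (residue_card ord) powr (- weyl_vector r (w 0))) * z (w 0) *
       iwahori_vector ord r z (w \<circ> inv_into UNIV (cycle_down r)) (k * ?T lam)"
      using iwahori_vector_rotation[OF p GL_mult[OF K_GL[OF k] TG] r w z] by simp
  qed
  also have "\<dots> = complex_of_real (real (residue_card ord) powr (- weyl_vector r (w 0))) * z (w 0) *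
     S z (w \<circ> inv_into UNIV (cycle_down r)) (?T lam)"
    unfolding spherical_average_def by (rule integral_mult_right_zero)
  finally show ?thesis .
qed

text \<open>On K the vector of the identity is the indicator of the Iwahori subgroup: if k = b l
  lies in the identity cell, then b is integral and upper triangular and so belongs to that subgroup
  itself.\<close>

lemma average_identity: "S z id (torus_elt p r (\<lambda>_. 0)) = 1"
proof -
  have "S z id (torus_elt p r (\<lambda>_. 0)) = (LINT k|dk. complex_of_real (indicator (J r) k))"
    unfolding spherical_average_def
  proof (rule Bochner_Integration.integral_cong[OF refl])
    fix k assume "k \<in> space dk"
    then have k: "k \<in> K r" using haar_space by simp
    obtain b v l where d: "b \<in> borel_subgroup r" "v permutes {..<r}" "l \<in> J r" "k = b * perm_mat r v * l"
      using K_GL[OF k] by (rule iwahori_decomposition)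
    have "iwahori_vector ord r z id k = complex_of_real (indicator (J r) k)"
    proof (cases "k \<in> J r")
      case True
      have "iwahori_vector ord r z id (1\<^sub>m r * perm_mat r id * k) = cell_value r z (borel_weight ord (1\<^sub>m r))"
        using iwahori_vector_cell[OF borel_one permutes_id True, of z id] by simp
      also have "\<dots> = cell_value r z (\<lambda>_. 0)" by (rule cell_value_cong) (simp add: borel_weight_def)
      also have "\<dots> = 1" using residue_card_ge_2 by (simp add: cell_value_def pair_def monomial_def)
      finally have "iwahori_vector ord r z id (1\<^sub>m r * perm_mat r id * k) = 1" .
      moreover have "1\<^sub>m r * perm_mat r id * k = k" using K_carrier[OF k] by (simp add: perm_mat_id)
      ultimately show ?thesis using True by simp
    next
      case False
      have "v \<noteq> id"
      proof
        assume "v = id"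
        obtain l' where l': "l' \<in> J r" "l * l' = 1\<^sub>m r" using d(3) by (rule iwahori_inverse)
        have c: "b \<in> carrier_mat r r" "l \<in> carrier_mat r r" "l' \<in> carrier_mat r r"
          using d(1,3) l'(1) K_carrier[OF iwahori_K] by (auto simp: borel_subgroup_def GL_carrier)
        have "k = b * l" using d(4) \<open>v = id\<close> c by (simp add: perm_mat_id)
        then have "k * l' = b" using mat_assoc[OF c] l' c by simp
        then have "b \<in> K r" using K_mult[OF k iwahori_K[OF l'(1)]] by simp
        moreover have "b $$ (i, j) = 0" if "i < r" "j < i" for i j
          using d(1) c(1) that by (auto simp: borel_subgroup_def dest: upper_triangularD)
        ultimately have "b \<in> J r" by (simp add: iwahori_iff)
        then have "k \<in> J r" using \<open>k = b * l\<close> d(3) iwahori_mult by simp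
        then show False using False by simp
      qed
      then show ?thesis using iwahori_vector_cell[OF d(1-3), of z id] d(4) False by simp
    qed
    then show "iwahori_vector ord r z id (k * torus_elt p r (\<lambda>_. 0)) = complex_of_real (indicator (J r) k)"
      using K_carrier[OF k] by (simp add: torus_zero)
  qed
  also have "\<dots> = 1"
    using J_sets J_measure by (simp add: measure_def)
  finally show ?thesis .
qed

end

end

section \<open>Comparison of the two sides\<close>

text \<open>
  Adjacent transpositions move a nonzero entry to an end of the weight, where the rotation or its
  inverse decreases the sum of the absolute values.
\<close>

lemma recursion_unique:
  fixes D :: "(nat \<Rightarrow> int) \<Rightarrow> (nat \<Rightarrow> nat) \<Rightarrow> 'b::field"
  assumes r: "0 < r" and q: "q \<noteq> 0"
    and cong: "\<And>lam lam' w. (\<And>i. i < r \<Longrightarrow> lam i = lam' i) \<Longrightarrow> D lam w = D lam' w"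
    and base: "D (\<lambda>_. 0) id = 0"
    and swap_lt: "\<And>lam w i. Suc i < r \<Longrightarrow> w permutes {..<r} \<Longrightarrow> lam (Suc i) \<le> lam i \<Longrightarrow> w i < w (Suc i) \<Longrightarrow>
      q * D (lam \<circ> adj i) w = D lam (w \<circ> adj i)"
    and swap_gt: "\<And>lam w i. Suc i < r \<Longrightarrow> w permutes {..<r} \<Longrightarrow> lam (Suc i) \<le> lam i \<Longrightarrow> w (Suc i) < w i \<Longrightarrow>
      q * D (lam \<circ> adj i) w = q * D lam (w \<circ> adj i) + (q - 1) * D lam w"
    and rotate: "\<And>lam w. w permutes {..<r} \<Longrightarrow>
      D (rotate_weight r lam) w = c w * D lam (w \<circ> inv_into UNIV (cycle_down r))"
    and c: "\<And>w. w permutes {..<r} \<Longrightarrow> c w \<noteq> 0"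
  shows "w permutes {..<r} \<Longrightarrow> D lam w = 0"
proof -
  \<comment> \<open>Vanishing is tracked for all permutations at once, since the swap relations mix
    w with its composite with the transposition.\<close>
  define E where "E lam \<longleftrightarrow> (\<forall>w. w permutes {..<r} \<longrightarrow> D lam w = 0)" for lam
  have comp_adj: "w \<circ> adj i permutes {..<r}" if "w permutes {..<r}" "Suc i < r" for w i
    by (rule permutes_compose[OF permutes_swap_id that(1)]) (use that in auto)
  have invol: "f \<circ> adj i \<circ> adj i = f" for f :: "nat \<Rightarrow> 'c" and i by (simp add: comp_assoc)
  have cases: "w i < w (Suc i) \<or> w (Suc i) < w i" if "w permutes {..<r}" for w i
    using permutes_inj[OF that] by (metis inj_eq linorder_neqE_nat n_not_Suc_n)
  have 1: "E (lam \<circ> adj i)" if i: "Suc i < r" and le: "lam (Suc i) \<le> lam i" and E: "E lam" for lam i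
    unfolding E_def
  proof (intro allI impI)
    fix w assume w: "w permutes {..<r}"
    have "D lam w = 0" "D lam (w \<circ> adj i) = 0" using E w comp_adj[OF w i] unfolding E_def by auto
    then show "D (lam \<circ> adj i) w = 0"
      using cases[OF w, of i] swap_lt[OF i w le] swap_gt[OF i w le] q by auto
  qed
  \<comment> \<open>Inverting the swap: \<open>swap_lt\<close> first gives the permutations with a
    descent at i, and these are then eliminated from \<open>swap_gt\<close> to obtain the
    others.\<close>
  have 2: "E lam" if i: "Suc i < r" and le: "lam (Suc i) \<le> lam i" and E: "E (lam \<circ> adj i)" for lam i
    unfolding E_def
  proof (intro allI impI)
    fix w assume w: "w permutes {..<r}"
    let ?v = "w \<circ> adj i"
    have v: "?v permutes {..<r}" by (rule comp_adj[OF w i])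
    have 0: "D (lam \<circ> adj i) w = 0" "D (lam \<circ> adj i) ?v = 0" using E w v unfolding E_def by auto
    show "D lam w = 0"
    proof (cases "w (Suc i) < w i")
      case True
      then show ?thesis using swap_lt[OF i v le] 0 by (simp add: invol)
    next
      case False
      then have lt: "w i < w (Suc i)" using cases[OF w, of i] by simp
      have "D lam ?v = 0" using swap_lt[OF i w le lt] 0 by simp
      then show ?thesis using swap_gt[OF i v le] 0 lt q by (simp add: invol)
    qed
  qed
  have swap: "E lam" if "Suc i < r" "E (lam \<circ> adj i)" for lam i
    using that 1[of i "lam \<circ> adj i"] 2[of i lam] by (cases "lam (Suc i) \<le> lam i") (auto simp: invol)
  have cyc: "cycle_down r permutes {..<r}" by (rule cycle_down_permutes[OF r])
  have rot: "E (rotate_weight r lam) \<longleftrightarrow> E lam" for lam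
  proof
    assume E: "E (rotate_weight r lam)"
    show "E lam" unfolding E_def
    proof (intro allI impI)
      fix w assume w: "w permutes {..<r}"
      have v: "w \<circ> cycle_down r permutes {..<r}" by (rule permutes_compose[OF cyc w])
      have "D (rotate_weight r lam) (w \<circ> cycle_down r) = c (w \<circ> cycle_down r) * D lam w"
        using rotate[OF v, of lam] by (simp add: comp_assoc permutes_inv_o[OF cyc])
      then show "D lam w = 0" using E v c[OF v] unfolding E_def by simp
    qed
  next
    assume E: "E lam"
    show "E (rotate_weight r lam)" unfolding E_def
    proof (intro allI impI)
      fix w assume w: "w permutes {..<r}"
      have "w \<circ> inv_into UNIV (cycle_down r) permutes {..<r}" by (rule permutes_compose[OF permutes_inv[OF cyc] w])
      then show "D (rotate_weight r lam) w = 0" using rotate[OF w, of lam] E unfolding E_def by simp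
    qed
  qed
  \<comment> \<open>The zero weight is fixed by all swaps, so \<open>swap_lt\<close> alone carries
    the vanishing from the identity along adjacent transpositions to every permutation.\<close>
  let ?P = "\<lambda>w. w permutes {..<r} \<and> D (\<lambda>_. 0) w = 0"
  have zadj: "?P (w \<circ> adj i)" if w: "?P w" and i: "Suc i < r" for w i
  proof -
    have v: "w \<circ> adj i permutes {..<r}" using comp_adj w i by blast
    have z: "(\<lambda>_. 0 :: int) \<circ> adj i = (\<lambda>_. 0)" by auto
    consider "w i < w (Suc i)" | "w (Suc i) < w i" using cases[of w i] w by blast
    then show ?thesis
    proof cases
      case 1
      then show ?thesis using swap_lt[OF i, of w "\<lambda>_. 0"] w v by (simp add: z)
    next
      case 2
      then show ?thesis using swap_lt[OF i v, of "\<lambda>_. 0"] w v q by (simp add: z invol)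
    qed
  qed
  have ztrans: "a < b \<Longrightarrow> b < r \<Longrightarrow> ?P w \<Longrightarrow> ?P (w \<circ> Transposition.transpose a b)" for a b w
  proof (induction b arbitrary: w)
    case (Suc b)
    show ?case
    proof (cases "a = b")
      case True
      then show ?thesis using zadj Suc.prems by blast
    next
      case False
      then have "Transposition.transpose a (Suc b) = adj b \<circ> Transposition.transpose a b \<circ> adj b"
        using Suc.prems by (auto simp: Transposition.transpose_def fun_eq_iff)
      moreover have "?P (w \<circ> adj b \<circ> Transposition.transpose a b \<circ> adj b)"
        using zadj Suc.IH Suc.prems False by (metis less_SucE Suc_lessD)
      ultimately show ?thesis by (simp only: comp_assoc)
    qed
  qed simp
  have zero: "E (\<lambda>_. 0)" unfolding E_def
  proof (intro allI impI)
    fix w assume "w permutes {..<r}"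
    with finite_lessThan have "?P w"
    proof (induction rule: permutes_rev_induct)
      case id
      then show ?case using base permutes_id by blast
    next
      case (swap a b p)
      show ?case
      proof (cases "a < b")
        case True
        then show ?thesis using ztrans[of a b p] swap by blast
      next
        case False
        then have "b < a" using swap by simp
        then show ?thesis using ztrans[of b a p] swap unfolding transpose_commute[of a b] by blast
      qed
    qed
    then show "D (\<lambda>_. 0) w = 0" by simp
  qed
  have sum_adj: "(\<Sum>j<r. \<bar>(lam \<circ> adj i) j\<bar>) = (\<Sum>j<r. \<bar>lam j\<bar>)" if "Suc i < r" for lam :: "nat \<Rightarrow> int" and i
  proof -
    have "adj i permutes {..<r}" by (rule permutes_swap_id) (use that in auto)
    from sum.permute[OF this, of "\<lambda>j. \<bar>lam j\<bar>"] show ?thesis by (simp add: comp_def)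
  qed
  obtain m where m: "r = Suc m" using r by (cases r) auto
  have "(\<Sum>j<r. \<bar>lam j\<bar>) = int n \<Longrightarrow> E lam" for n lam
  proof (induction n arbitrary: lam)
    case 0
    then have "lam i = 0" if "i < r" for i using that by (simp add: sum_nonneg_eq_0_iff)
    then show ?case using zero cong[of lam "\<lambda>_. 0"] unfolding E_def by simp
  next
    case (Suc n)
    have first: "E lam" if "0 < lam 0" "(\<Sum>j<r. \<bar>lam j\<bar>) = int (Suc n)" for lam
    proof -
      define \<mu> where "\<mu> j = (if j = m then lam 0 - 1 else lam (Suc j))" for j
      have "(\<Sum>j<r. \<bar>\<mu> j\<bar>) = (\<Sum>j<m. \<bar>lam (Suc j)\<bar>) + (lam 0 - 1)"
        using that(1) by (simp add: m \<mu>_def)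
      moreover have "(\<Sum>j<r. \<bar>lam j\<bar>) = lam 0 + (\<Sum>j<m. \<bar>lam (Suc j)\<bar>)"
        using that(1) by (simp only: m sum.lessThan_Suc_shift)
      ultimately have "E \<mu>" using that(2) by (intro Suc.IH) simp
      then have "E (rotate_weight r \<mu>)" using rot by blast
      moreover have "rotate_weight r \<mu> i = lam i" if "i < r" for i
        using that by (auto simp: rotate_weight_def \<mu>_def m)
      ultimately show ?thesis using cong[of "rotate_weight r \<mu>" lam] unfolding E_def by simp
    qed
    have pos: "i < r \<Longrightarrow> 0 < lam i \<Longrightarrow> (\<Sum>j<r. \<bar>lam j\<bar>) = int (Suc n) \<Longrightarrow> E lam" for i lam
    proof (induction i arbitrary: lam)
      case 0
      then show ?case using first by blast
    next
      case (Suc i)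
      have "E (lam \<circ> adj i)"
        by (rule Suc.IH) (use Suc.prems sum_adj[of i lam] in simp_all)
      then show ?case using swap Suc.prems by blast
    qed
    have last: "E lam" if "lam m < 0" "(\<Sum>j<r. \<bar>lam j\<bar>) = int (Suc n)" for lam
    proof -
      have "(\<Sum>j<r. \<bar>rotate_weight r lam j\<bar>) = \<bar>lam m + 1\<bar> + (\<Sum>j<m. \<bar>lam j\<bar>)"
        unfolding m sum.lessThan_Suc_shift by (simp add: rotate_weight_def)
      moreover have "(\<Sum>j<r. \<bar>lam j\<bar>) = (\<Sum>j<m. \<bar>lam j\<bar>) + \<bar>lam m\<bar>" by (simp add: m)
      ultimately have "E (rotate_weight r lam)" using that by (intro Suc.IH) simp
      then show ?thesis using rot by blast
    qed
    have neg: "d \<le> m \<Longrightarrow> lam (m - d) < 0 \<Longrightarrow> (\<Sum>j<r. \<bar>lam j\<bar>) = int (Suc n) \<Longrightarrow> E lam" for d lam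
    proof (induction d arbitrary: lam)
      case 0
      then show ?case using last by simp
    next
      case (Suc d)
      define i where "i = m - Suc d"
      have i: "Suc i < r" "m - d = Suc i" using Suc.prems by (auto simp: i_def m)
      have "E (lam \<circ> adj i)"
        by (rule Suc.IH) (use Suc.prems sum_adj[OF i(1), of lam] i(2) i_def in simp_all)
      then show ?case using swap i by blast
    qed
    have "\<exists>i<r. lam i \<noteq> 0"
    proof (rule ccontr)
      assume "\<not> ?thesis"
      then have "(\<Sum>j<r. \<bar>lam j\<bar>) = 0" by simp
      then show False using Suc.prems by simp
    qed
    then obtain i where i: "i < r" "lam i \<noteq> 0" by blast
    show ?case
    proof (cases "0 < lam i")
      case True
      then show ?thesis using pos i Suc.prems by blast
    next
      case False
      then have "lam (m - (m - i)) < 0" using i m by simp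
      then show ?thesis using neg[of "m - i" lam] Suc.prems by simp
    qed
  qed
  from this[of lam "nat (\<Sum>j<r. \<bar>lam j\<bar>)"] have "E lam" by (simp add: sum_nonneg)
  then show "w permutes {..<r} \<Longrightarrow> D lam w = 0" unfolding E_def by blast
qed

text \<open>The pairing of the Weyl vector with the antidominant rearrangement of \<open>lam\<close>
  is - 1/4 of this quantity, which does not mention the sorting permutation and is defined for every
  weight alike.\<close>

definition spread :: "nat \<Rightarrow> (nat \<Rightarrow> int) \<Rightarrow> int" where
  "spread r lam = (\<Sum>i<r. \<Sum>j<r. \<bar>lam i - lam j\<bar>)"

lemma spread_permute:
  assumes "p permutes {..<r}"
  shows "spread r (lam \<circ> p) = spread r lam"
proof -
  have "spread r (lam \<circ> p) = (\<Sum>i<r. \<Sum>j<r. \<bar>lam (p i) - lam j\<bar>)"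
    unfolding spread_def using sum.permute[OF assms, of "\<lambda>j. \<bar>lam (p i) - lam j\<bar>" for i] by (simp add: comp_def)
  also have "\<dots> = spread r lam"
    unfolding spread_def using sum.permute[OF assms, of "\<lambda>i. \<Sum>j<r. \<bar>lam i - lam j\<bar>"] by (simp add: comp_def)
  finally show ?thesis .
qed

lemma spread_increasing:
  assumes "\<And>i j. i \<le> j \<Longrightarrow> j < r \<Longrightarrow> \<mu> i \<le> \<mu> j"
  shows "spread r \<mu> = (\<Sum>i<r. (4 * int i + 2 - 2 * int r) * \<mu> i)"
proof -
  \<comment> \<open>The sign of i - j; ties may be counted as positive, since their difference is 0.
    The coefficient obtained below is - 4 times the Weyl vector.\<close>
  let ?s = "\<lambda>i j. if j \<le> i then 1 else - 1 :: int"
  have s1: "(\<Sum>j<n. ?s i j) = (if n \<le> Suc i then int n else 2 * (int i + 1) - int n)" for i n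
    by (induction n) auto
  have s2: "(\<Sum>i<n. ?s i j) = (if n \<le> j then - int n else int n - 2 * int j)" for j n
    by (induction n) auto
  have "\<bar>\<mu> i - \<mu> j\<bar> = ?s i j * \<mu> i - ?s i j * \<mu> j" if "i < r" "j < r" for i j
    using assms[of i j] assms[of j i] that by auto
  then have "spread r \<mu> = (\<Sum>i<r. \<Sum>j<r. ?s i j * \<mu> i - ?s i j * \<mu> j)"
    unfolding spread_def by (intro sum.cong refl) auto
  also have "\<dots> = (\<Sum>i<r. \<Sum>j<r. ?s i j * \<mu> i) - (\<Sum>i<r. \<Sum>j<r. ?s i j * \<mu> j)"
    by (simp only: sum_subtractf)
  also have "(\<Sum>i<r. \<Sum>j<r. ?s i j * \<mu> j) = (\<Sum>j<r. \<Sum>i<r. ?s i j * \<mu> j)" by (rule sum.swap)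
  also have "(\<Sum>i<r. \<Sum>j<r. ?s i j * \<mu> i) - (\<Sum>j<r. \<Sum>i<r. ?s i j * \<mu> j) =
      (\<Sum>i<r. ((\<Sum>j<r. ?s i j) - (\<Sum>j<r. ?s j i)) * \<mu> i)"
    by (simp only: sum_subtractf left_diff_distrib sum_distrib_right)
  also have "\<dots> = (\<Sum>i<r. (4 * int i + 2 - 2 * int r) * \<mu> i)"
    unfolding s1 s2 by (intro sum.cong refl) auto
  finally show ?thesis .
qed

lemma pair_weyl_vector_antidominant:
  assumes "y permutes {..<r}" "antidominant r (act y lam)"
  shows "pair r (weyl_vector r) (act y lam) = - (real_of_int (spread r lam) / 4)"
proof -
  have "act y lam = lam \<circ> inv_into UNIV y" by (auto simp: act_def)
  then have "spread r lam = spread r (act y lam)" using spread_permute[OF permutes_inv[OF assms(1)], of lam] by simp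
  also have "\<dots> = (\<Sum>i<r. (4 * int i + 2 - 2 * int r) * act y lam i)"
    by (rule spread_increasing) (use assms(2) in \<open>auto simp: antidominant_def dominant_def\<close>)
  finally have "real_of_int (spread r lam) = (\<Sum>i<r. (4 * real i + 2 - 2 * real r) * of_int (act y lam i))" by simp
  also have "\<dots> = (\<Sum>i<r. - 4 * (weyl_vector r i * of_int (act y lam i)))"
    by (intro sum.cong refl) (simp add: weyl_vector_def field_simps)
  also have "\<dots> = - 4 * pair r (weyl_vector r) (act y lam)" by (simp only: pair_def sum_distrib_left)
  finally show ?thesis by simp
qed

text \<open>Adding 1 to the last entry increases its distance to each entry that is at most as large
  and decreases the distance to each other entry, by 1 in both cases, and every pair is counted
  twice.\<close>

lemma spread_rotate:
  assumes "0 < r"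
  shows "spread r (rotate_weight r lam) =
    spread r lam + 4 * int (card {m. m < r - 1 \<and> lam m \<le> lam (r - 1)}) - 2 * (int r - 1)"
proof -
  obtain m where m: "r = Suc m" using assms by (cases r) auto
  \<comment> \<open>Splitting off the last entry of \<open>lam\<close> and the first entry of the
    rotated weight leaves the same r - 1 entries.\<close>
  have last: "spread (Suc m) f = spread m f + 2 * (\<Sum>i<m. \<bar>f i - f m\<bar>)" for f :: "nat \<Rightarrow> int"
    by (simp add: spread_def sum.distrib abs_minus_commute)
  have first: "spread (Suc m) f = spread m (f \<circ> Suc) + 2 * (\<Sum>i<m. \<bar>f (Suc i) - f 0\<bar>)" for f :: "nat \<Rightarrow> int"
    unfolding spread_def sum.lessThan_Suc_shift by (simp add: sum.distrib abs_minus_commute)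
  have rw: "rotate_weight (Suc m) lam 0 = lam m + 1" "\<And>i. i < m \<Longrightarrow> rotate_weight (Suc m) lam (Suc i) = lam i"
    by (auto simp: rotate_weight_def)
  have "spread m (rotate_weight (Suc m) lam \<circ> Suc) = spread m lam"
    unfolding spread_def by (intro sum.cong refl) (simp add: rw)
  moreover have "(\<Sum>i<m. \<bar>rotate_weight (Suc m) lam (Suc i) - rotate_weight (Suc m) lam 0\<bar>) =
      (\<Sum>i<m. \<bar>lam i - lam m\<bar> + (2 * (if lam i \<le> lam m then 1 else 0) - 1))"
    by (intro sum.cong refl) (auto simp: rw)
  moreover have "(\<Sum>i<m. if lam i \<le> lam m then 1 else 0 :: int) = int (card {i. i < m \<and> lam i \<le> lam m})"
  proof -
    have "{i. i < m \<and> lam i \<le> lam m} = {i \<in> {..<m}. lam i \<le> lam m}" by auto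
    then show ?thesis by (simp flip: sum.inter_filter)
  qed
  ultimately show ?thesis
    unfolding m first[of "rotate_weight (Suc m) lam"] last[of lam]
    by (simp add: sum.distrib sum_subtractf sum_distrib_left[symmetric])
qed

text \<open>The right-hand side of the theorem with the pairing expressed through
  \<open>spread\<close>, so that it makes sense without choosing \<open>y\<close>.\<close>

definition normalized_lattice_value :: "nat \<Rightarrow> nat \<Rightarrow> (nat \<Rightarrow> complex) \<Rightarrow> (nat \<Rightarrow> int) \<Rightarrow> (nat \<Rightarrow> nat) \<Rightarrow> complex" where
  "normalized_lattice_value q r z lam w = complex_of_real (real q powr (- (real_of_int (spread r lam) / 4))) *
     of_nat q ^ (r * (r - 1) div 2) * lattice_value r (1 / of_nat q) z lam w"

lemma normalized_lattice_value_cong: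
  assumes "\<And>i. i < r \<Longrightarrow> lam i = lam' i"
  shows "normalized_lattice_value q r z lam w = normalized_lattice_value q r z lam' w"
proof -
  have "spread r lam = spread r lam'" unfolding spread_def by (intro sum.cong refl) (simp add: assms)
  moreover have "color_config r lam = color_config r lam'" by (auto simp: color_config_def fun_eq_iff assms)
  moreover have "(\<Sum>i<r. \<bar>lam i\<bar>) = (\<Sum>i<r. \<bar>lam' i\<bar>)" by (intro sum.cong refl) (simp add: assms)
  ultimately show ?thesis by (simp add: normalized_lattice_value_def lattice_value_def)
qed

text \<open>The normalization is invariant under permutations of the weight, so this is the lattice
  recursion at t = 1/q multiplied by q.\<close>

lemma normalized_lattice_value_swap:
  assumes q: "2 \<le> q" and z: "\<And>i. i < r \<Longrightarrow> z i \<noteq> 0" and i: "Suc i < r" and w: "w permutes {..<r}"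
    and lam: "lam (Suc i) \<le> lam i"
  shows "w i < w (Suc i) \<Longrightarrow> of_nat q * normalized_lattice_value q r z (lam \<circ> adj i) w =
      normalized_lattice_value q r z lam (w \<circ> adj i)" (is "_ \<Longrightarrow> ?A")
    and "w (Suc i) < w i \<Longrightarrow> of_nat q * normalized_lattice_value q r z (lam \<circ> adj i) w =
      of_nat q * normalized_lattice_value q r z lam (w \<circ> adj i) + (of_nat q - 1) * normalized_lattice_value q r z lam w"
      (is "_ \<Longrightarrow> ?B")
proof -
  have s: "adj i permutes {..<r}" by (rule permutes_swap_id) (use i in auto)
  have sp: "spread r (lam \<circ> adj i) = spread r lam" by (rule spread_permute[OF s])
  show ?A if lt: "w i < w (Suc i)"
    using lattice_value_swap(1)[where t = "1 / of_nat q" and z = z, OF z i w lam lt] q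
    by (simp add: normalized_lattice_value_def sp)
  show ?B if lt: "w (Suc i) < w i"
  proof -
    have ww: "w \<circ> adj i \<circ> adj i = w" by (simp add: comp_assoc)
    have "(w \<circ> adj i) i < (w \<circ> adj i) (Suc i)" using lt by simp
    from lattice_value_swap(2)[where t = "1 / of_nat q" and z = z, OF z i permutes_compose[OF s w] lam this]
    have "lattice_value r (1 / of_nat q) z (lam \<circ> adj i) w =
      lattice_value r (1 / of_nat q) z lam (w \<circ> adj i) + (1 - 1 / of_nat q) * lattice_value r (1 / of_nat q) z lam w"
      unfolding ww .
    then have "of_nat q * lattice_value r (1 / of_nat q) z (lam \<circ> adj i) w =
      of_nat q * lattice_value r (1 / of_nat q) z lam (w \<circ> adj i) + (of_nat q - 1) * lattice_value r (1 / of_nat q) z lam w"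
      using q by (simp add: field_simps)
    from arg_cong[OF this, of "(*) (complex_of_real (real q powr (- (real_of_int (spread r lam) / 4))) *
     of_nat q ^ (r * (r - 1) div 2))"] show ?thesis
      unfolding normalized_lattice_value_def sp by (simp only: algebra_simps)
  qed
qed

lemma normalized_lattice_value_rotate:
  assumes q: "2 \<le> q" and r: "0 < r" and z: "\<And>i. i < r \<Longrightarrow> z i \<noteq> 0" and w: "w permutes {..<r}"
  shows "normalized_lattice_value q r z (rotate_weight r lam) w =
    complex_of_real (real q powr (- weyl_vector r (w 0))) * z (w 0) *
    normalized_lattice_value q r z lam (w \<circ> inv_into UNIV (cycle_down r))"
proof -
  let ?a = "card {m. m < r - 1 \<and> lam m \<le> lam (r - 1)}" and ?v = "w \<circ> inv_into UNIV (cycle_down r)"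
  let ?t = "1 / of_nat q :: complex"
  have cyc: "cycle_down r permutes {..<r}" by (rule cycle_down_permutes[OF r])
  have v: "?v permutes {..<r}" by (rule permutes_compose[OF permutes_inv[OF cyc] w])
  have "inv_into UNIV (cycle_down r) m = (if Suc m = r then 0 else Suc m)" if "m < r" for m
    using that by (subst permutes_inv_eq[OF cyc]) (auto simp: cycle_down_def)
  then have wv: "w (if Suc m = r then 0 else Suc m) = ?v m" if "m < r" for m using that by simp
  have w0: "w 0 < r" using permutes_in_image[OF w, of 0] r by simp
  have pow: "?t ^ n = complex_of_real (real q powr (- real n))" for n
    using q by (simp add: powr_minus powr_realpow power_divide field_simps)
  have "lattice_value r ?t z (rotate_weight r lam) w * ?t ^ ?a = ?t ^ (r - 1 - w 0) * z (w 0) * lattice_value r ?t z lam ?v"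
    by (rule lattice_value_rotate[OF r z w v wv])
  then have "lattice_value r ?t z (rotate_weight r lam) w =
    complex_of_real (real q powr real ?a * real q powr (- real (r - 1 - w 0))) * (z (w 0) * lattice_value r ?t z lam ?v)"
    using q unfolding pow by (simp add: powr_minus field_simps)
  \<comment> \<open>The change of \<open>spread\<close> contributes the exponent - a + (r - 1)/2
    with a the count \<open>?a\<close>. It cancels a and combines with - (r - 1 - w 0) to minus the
    Weyl vector at \<open>w 0\<close>.\<close>
  moreover have "real q powr (- (real_of_int (spread r (rotate_weight r lam)) / 4)) *
      (real q powr real ?a * real q powr (- real (r - 1 - w 0))) =
    real q powr (- weyl_vector r (w 0)) * real q powr (- (real_of_int (spread r lam) / 4))"
    unfolding powr_add[symmetric] spread_rotate[OF r]
    using w0 r by (intro arg_cong[of _ _ "\<lambda>x. real q powr x"]) (simp add: weyl_vector_def of_nat_diff field_simps)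
  ultimately show ?thesis
    unfolding normalized_lattice_value_def by (simp add: mult_ac flip: of_real_mult)
qed

text \<open>The power of q for the positive roots cancels the power of t = 1/q found in
  \<open>lattice_value_zero\<close>.\<close>

lemma normalized_lattice_value_zero:
  assumes "2 \<le> q" "0 < r"
  shows "normalized_lattice_value q r z (\<lambda>_. 0) id = 1"
  using assms by (simp add: normalized_lattice_value_def lattice_value_zero spread_def power_divide)

lemma rotate_weight_cycle_down:
  "rotate_weight r lam = (\<lambda>i. lam (cycle_down r i) + (if i = 0 then 1 else 0))"
  by (simp add: rotate_weight_def cycle_down_def)

lemma (in nonarch_local_field) spherical_average_eq_lattice_value:
  assumes haar: "normalized_haar ord r dk" and p: "uniformizer ord p" and r: "0 < r"
    and z: "\<And>i. i < r \<Longrightarrow> z i \<noteq> 0" and w: "w permutes {..<r}"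
  shows "spherical_average ord r dk z w (torus_elt p r lam) = normalized_lattice_value (residue_card ord) r z lam w"
proof -
  define q where "q = residue_card ord"
  have q: "2 \<le> q" using residue_card_ge_2 by (simp add: q_def)
  let ?F = "\<lambda>lam w. spherical_average ord r dk z w (torus_elt p r lam)" and ?G = "normalized_lattice_value q r z"
  \<comment> \<open>All recursions are linear and homogeneous, so the difference of the two sides
    satisfies them with initial value 0.\<close>
  have "?F lam w - ?G lam w = 0"
  proof (rule recursion_unique[where D = "\<lambda>lam w. ?F lam w - ?G lam w" and q = "of_nat q"
        and c = "\<lambda>w. complex_of_real (real q powr (- weyl_vector r (w 0))) * z (w 0)" and r = r])
    show "0 < r" by fact
    show "of_nat q \<noteq> (0 :: complex)" using q by simp
    show "w permutes {..<r}" by fact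
    show "?F lam w - ?G lam w = ?F lam' w - ?G lam' w" if "\<And>i. i < r \<Longrightarrow> lam i = lam' i" for lam lam' w
    proof -
      have "torus_elt p r lam = torus_elt p r lam'" by (rule eq_matI) (auto simp: torus_elt_def that)
      then show ?thesis using normalized_lattice_value_cong[OF that] by simp
    qed
    show "?F (\<lambda>_. 0) id - ?G (\<lambda>_. 0) id = 0"
      using average_identity[OF haar] normalized_lattice_value_zero[OF q r] by simp
    show "complex_of_real (real q powr (- weyl_vector r (w 0))) * z (w 0) \<noteq> 0" if "w permutes {..<r}" for w
      using z[of "w 0"] permutes_in_image[OF that, of 0] r q by simp
    show "?F (rotate_weight r lam) w - ?G (rotate_weight r lam) w =
      complex_of_real (real q powr (- weyl_vector r (w 0))) * z (w 0) *
      (?F lam (w \<circ> inv_into UNIV (cycle_down r)) - ?G lam (w \<circ> inv_into UNIV (cycle_down r)))"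
      if "w permutes {..<r}" for lam w
    proof -
      have "?F (rotate_weight r lam) w = complex_of_real (real q powr (- weyl_vector r (w 0))) * z (w 0) *
          ?F lam (w \<circ> inv_into UNIV (cycle_down r))"
        unfolding q_def rotate_weight_cycle_down by (rule average_rotation[OF haar p r that z])
      moreover have "?G (rotate_weight r lam) w = complex_of_real (real q powr (- weyl_vector r (w 0))) * z (w 0) *
          ?G lam (w \<circ> inv_into UNIV (cycle_down r))"
        by (rule normalized_lattice_value_rotate[OF q r z that])
      ultimately show ?thesis by (simp only: right_diff_distrib)
    qed
    fix lam :: "nat \<Rightarrow> int" and w i assume i: "Suc i < r" "w permutes {..<r}" "lam (Suc i) \<le> lam i"
    note F = average_swap[where z = z and lam = lam, OF haar p i]
    note G = normalized_lattice_value_swap[where z = z and lam = lam, OF q z i]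
    show "of_nat q * (?F (lam \<circ> adj i) w - ?G (lam \<circ> adj i) w) = ?F lam (w \<circ> adj i) - ?G lam (w \<circ> adj i)"
      if "w i < w (Suc i)"
      using F G(1) that unfolding right_diff_distrib by (simp add: q_def)
    show "of_nat q * (?F (lam \<circ> adj i) w - ?G (lam \<circ> adj i) w) =
        of_nat q * (?F lam (w \<circ> adj i) - ?G lam (w \<circ> adj i)) + (of_nat q - 1) * (?F lam w - ?G lam w)"
      if "w (Suc i) < w i"
      using F G(2) that unfolding right_diff_distrib by (simp add: q_def)
  qed
  then show ?thesis by (simp add: q_def)
qed

theorem theorem6p9:
  fixes ord :: "'a::field \<Rightarrow> int" and varpi :: 'a and r :: nat
    and dk :: "'a mat measure" and z :: "nat \<Rightarrow> complex"
    and lam :: "nat \<Rightarrow> int" and y w :: "nat \<Rightarrow> nat"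
    and kind :: weight_kind and M N :: int
  assumes "nonarch_local_field ord"
    and "uniformizer ord varpi"
    and "1 \<le> r"
    and "normalized_haar ord r dk"
    and "\<And>i. i < r \<Longrightarrow> z i \<noteq> 0"
    and "minimal_antidominant r lam y"
    and "w permutes {..<r}"
    and "M \<le> - act y lam (r - 1)"
    and "- act y lam 0 \<le> N"
  defines "q \<equiv> residue_card ord"
  shows "spherical_average ord r dk z w (torus_elt varpi r lam) =
    complex_of_real (real q powr pair r (weyl_vector r) (act y lam)) *
    of_nat q ^ (r * (r - 1) div 2) *
    partition_function kind r M N (\<lambda>i. - act y lam i)
      (act (y \<circ> longest_element r) standard_flag)
      (act (w \<circ> longest_element r) standard_flag)
      (\<lambda>i. inverse (z i)) (1 / of_nat q)"
proof -
  interpret nonarch_local_field ord by fact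
  have r: "0 < r" using assms(3) by simp
  have q: "2 \<le> q" using residue_card_ge_2 by (simp add: q_def)
  have y: "y permutes {..<r}" "antidominant r (act y lam)"
    using assms(6) by (simp_all add: minimal_antidominant_def)
  have "1 / of_nat q \<noteq> (1 :: complex)" using q by simp
  from partition_function_lattice_value[where z = z and lam = lam, OF r this assms(5) y assms(7-9), of kind]
  show ?thesis
    using spherical_average_eq_lattice_value[where z = z and lam = lam, OF assms(4,2) r assms(5,7)]
    unfolding normalized_lattice_value_def pair_weyl_vector_antidominant[OF y] q_def by simp
qed

end
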